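(* Let $\Omega=\mathbb{Z}\omega_1+\mathbb{Z}\omega_2$ be a lattice in $\mathbb{C}$, with Weierstrass functions $\wp,\zeta,\sigma$, Serre functions $f_u$ and associated elliptic curve $E$. Let $t_1,\dots,t_r$ be complex numbers linearly independent over $\mathbb{Q}$. Let $u_1,\dots,u_s$ be complex numbers. 1. Assume that $\omega_1,\omega_2,u_1,\dots,u_s$ are linearly independent over $\mathbb{Q}$. Then the $4+r+s$ functions $$z,\ \wp(z),\ \zeta(z),\ \sigma(z),\ e^{t_1z},\dots,e^{t_rz},\ f_{u_1}(z),\dots,f_{u_s}(z)$$ are algebraically independent over $\mathbb{C}$. 2. Assume further that the elliptic curve $E$ has complex multiplication with field of endomorphisms $k$. Let $\alpha_1,\dots,\alpha_s$ be elements of $\mathrm{End}(E)\smallsetminus\mathbb{Z}$. Assume that $\omega_1,u_1,\dots,u_s$ are linearly independent over $k$. Then the $4+r+2s$ functions $$z,\ \wp(z),\ \zeta(z),\ \sigma(z),\ e^{t_1z},\dots,e^{t_rz},\ f_{u_1}(z),\dots,f_{u_s}(z),\ f_{u_1}(\alpha_1z),\dots,f_{u_s}(\alpha_sz)$$ are algebraically independent over $\mathbb{C}$.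
   Context: For a lattice $\Omega=\mathbb{Z}\omega_1+\mathbb{Z}\omega_2$ in $\mathbb{C}$, the Weierstrass sigma function is $\sigma(z)=z\prod_{\omega\in\Omega\smallsetminus\{0\}}\left(1-\frac z\omega\right)\exp\left(\frac z\omega+\frac{z^2}{2\omega^2}\right)$, the Weierstrass zeta function is $\zeta=\sigma'/\sigma$, and the Weierstrass elliptic function is $\wp=-\zeta'$. For $u\in\mathbb{C}\smallsetminus\Omega$ the Serre function is $f_u(z)=\frac{\sigma(z+u)}{\sigma(z)\sigma(u)}e^{-\zeta(u)z}$. $E$ is the elliptic curve with period lattice $\Omega$. The ring $\mathrm{End}(E)$ is identified with $\{\alpha\in\mathbb{C}: \alpha\Omega\subset\Omega\}$, and $k=\mathrm{End}(E)\otimes_{\mathbb{Z}}\mathbb{Q}$ (the fraction field of $\mathrm{End}(E)$) is the field of endomorphisms of $E$; so $k=\mathbb{Q}$ in the non-CM case and $k=\mathbb{Q}(\omega_2/\omega_1)$, an imaginary quadratic field, in the complex multiplication (CM) case, i.e. when $\mathrm{End}(E)\neq\mathbb{Z}$. *)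

theory Defs
  imports "HOL-Complex_Analysis.Complex_Analysis" "HOL-Library.Poly_Mapping"
begin

section \<open>Linear independence over a subfield of the complex numbers\<close>

text \<open>
  Independence of a finite \<^emph>\<open>family\<close> (so repeated entries are dependent), with scalars in a set
  \<^term>\<open>K\<close> of complex numbers, used below for the subfields \<^term>\<open>\<real>\<close>, \<^term>\<open>\<rat>\<close> and the field
  of endomorphisms of an elliptic curve.
\<close>

definition lin_indep_over :: "complex set \<Rightarrow> complex list \<Rightarrow> bool" where
  "lin_indep_over K vs \<longleftrightarrow>
     (\<forall>c. (\<forall>i<length vs. c i \<in> K) \<and> (\<Sum>i<length vs. c i * vs ! i) = 0
        \<longrightarrow> (\<forall>i<length vs. c i = 0))"

section \<open>Period lattices and endomorphisms\<close>

definition is_lattice_basis :: "complex \<Rightarrow> complex \<Rightarrow> bool" where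
  "is_lattice_basis \<omega>1 \<omega>2 \<longleftrightarrow> lin_indep_over \<real> [\<omega>1, \<omega>2]"

definition period_lattice :: "complex \<Rightarrow> complex \<Rightarrow> complex set" where
  "period_lattice \<omega>1 \<omega>2 = {of_int m * \<omega>1 + of_int n * \<omega>2 | m n. True}"

text \<open>
  The endomorphism ring of \<open>E = \<complex>/\<Omega>\<close>, identified with the ring of complex multipliers of \<open>\<Omega>\<close>,
  and its fraction field \<open>k = End(E) \<otimes> \<rat>\<close> inside \<open>\<complex>\<close>.
\<close>

definition End_ring :: "complex set \<Rightarrow> complex set" where
  "End_ring \<Omega> = {\<alpha>. \<forall>\<omega>\<in>\<Omega>. \<alpha> * \<omega> \<in> \<Omega>}"

definition End_field :: "complex set \<Rightarrow> complex set" where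
  "End_field \<Omega> = {\<alpha> / \<beta> | \<alpha> \<beta>. \<alpha> \<in> End_ring \<Omega> \<and> \<beta> \<in> End_ring \<Omega> \<and> \<beta> \<noteq> 0}"

definition has_CM :: "complex set \<Rightarrow> bool" where
  "has_CM \<Omega> \<longleftrightarrow> End_ring \<Omega> \<noteq> \<int>"

section \<open>Weierstrass and Serre functions\<close>

text \<open>
  The product over \<open>\<Omega> - {0}\<close> is the unconditional limit of its finite subproducts; it exists since
  the product converges absolutely. The functions \<open>\<zeta>\<close>, \<open>\<wp>\<close>, \<open>f\<^sub>u\<close> carry arbitrary values at
  their poles, which is harmless because identities of meromorphic functions are taken off sparse
  sets below.
\<close>

definition weierstrass_sigma :: "complex set \<Rightarrow> complex \<Rightarrow> complex" where
  "weierstrass_sigma \<Omega> z =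
     z * Lim (finite_subsets_at_top (\<Omega> - {0}))
           (\<lambda>X. \<Prod>\<omega>\<in>X. (1 - z / \<omega>) * exp (z / \<omega> + z\<^sup>2 / (2 * \<omega>\<^sup>2)))"

definition weierstrass_zeta :: "complex set \<Rightarrow> complex \<Rightarrow> complex" where
  "weierstrass_zeta \<Omega> z = deriv (weierstrass_sigma \<Omega>) z / weierstrass_sigma \<Omega> z"

definition weierstrass_wp :: "complex set \<Rightarrow> complex \<Rightarrow> complex" where
  "weierstrass_wp \<Omega> z = - deriv (weierstrass_zeta \<Omega>) z"

definition serre_fun :: "complex set \<Rightarrow> complex \<Rightarrow> complex \<Rightarrow> complex" where
  "serre_fun \<Omega> u z =
     weierstrass_sigma \<Omega> (z + u) / (weierstrass_sigma \<Omega> z * weierstrass_sigma \<Omega> u)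
       * exp (- weierstrass_zeta \<Omega> u * z)"

section \<open>Algebraic independence of meromorphic functions\<close>

text \<open>
  A polynomial in the variables \<open>X\<^sub>0, X\<^sub>1, \<dots>\<close> maps exponent vectors (of finite support) to
  coefficients, with finite support.
\<close>

type_synonym cmpoly = "(nat \<Rightarrow>\<^sub>0 nat) \<Rightarrow>\<^sub>0 complex"

definition cmpoly_vars :: "cmpoly \<Rightarrow> nat set" where
  "cmpoly_vars P = (\<Union>m\<in>Poly_Mapping.keys P. Poly_Mapping.keys m)"

definition cmpoly_eval :: "cmpoly \<Rightarrow> (nat \<Rightarrow> complex) \<Rightarrow> complex" where
  "cmpoly_eval P x =
     (\<Sum>m\<in>Poly_Mapping.keys P. Poly_Mapping.lookup P m
        * (\<Prod>i\<in>Poly_Mapping.keys m. x i ^ Poly_Mapping.lookup m i))"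

text \<open>
  Algebraic independence over \<open>\<complex>\<close> in the field of meromorphic functions on \<open>\<complex>\<close>: no nonzero
  polynomial in as many variables as there are functions vanishes on them. A meromorphic function
  is the zero element of that field iff it is \<open>0\<close> outside a set without limit points.
\<close>

definition alg_indep_mero :: "(complex \<Rightarrow> complex) list \<Rightarrow> bool" where
  "alg_indep_mero Fs \<longleftrightarrow>
     (\<forall>P. cmpoly_vars P \<subseteq> {..<length Fs} \<and> (\<forall>\<^sub>\<approx>z. cmpoly_eval P (\<lambda>i. (Fs ! i) z) = 0)
        \<longrightarrow> P = 0)"

end

theory Submission
  imports Defs
begin

text \<open>
  Under translation by a period \<open>w\<close>, each of \<open>\<sigma>\<close>, \<open>e\<^sup>t\<^sup>z\<close> and \<open>f\<^sub>u(\<alpha> z)\<close> is multiplied by some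
  \<open>exp (A z + B)\<close>, whereas \<open>z\<close>, \<open>wp\<close> and \<open>\<zeta>\<close> grow polynomially along the lattice. Their monomials have
  logarithmic derivatives in a differential ring \<open>R\<close> containing \<open>z\<close>, \<open>wp\<close> and \<open>\<zeta>\<close>, so that a shortest
  linear relation over \<open>R\<close> has two terms, and comparing growth along the lattice shows that two distinct
  monomials have the same multipliers. If \<open>\<sigma>(z + u) e\<^sup>s\<^sup>z / \<sigma>(z)\<close> is elliptic, then \<open>u\<close> is a period, since
  there is no elliptic function with a single simple pole; this turns equality of multipliers into a
  linear relation between the \<open>u\<^sub>i\<close> (or \<open>u\<^sub>i\<close> and \<open>cnj \<alpha>\<^sub>i * u\<^sub>i\<close>) modulo periods, and then between the
  \<open>t\<^sub>i\<close>. The functions \<open>z\<close>, \<open>wp\<close>, \<open>\<zeta>\<close> are independent because \<open>(z, \<zeta>)\<close> is translated by two linearly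
  independent vectors, on which \<open>wp\<close> is constant.
\<close>

section \<open>Lattices\<close>

text \<open>Both parts are instances of one statement about finitely many pairs
  \<open>(u, \<alpha>)\<close> with \<alpha> in \<open>End_ring \<Omega>\<close>: part 1 takes
  \<alpha> = 1, part 2 takes each \<open>u\<close> once with 1 and once with its own \<alpha>. The
  conjugate enters because \<open>eta\<close> agrees on \<Omega> with a real-linear map a w + b
  cnj(w). In \<open>eta (\<alpha> * w) * u\<close> the antilinear part is that of
  \<open>eta w * (cnj \<alpha> * u)\<close>, and the difference is a multiple of \<open>w\<close>,
  hence absorbed by a factor e^(s z). A nonreal \<alpha> makes 1 and \<open>cnj \<alpha>\<close>
  independent over the rationals, which separates f_u(z) from f_u(\<alpha> z). The obstacle in the
  foundations is the quasi-periodicity of \<sigma>. It is read off from the product itself: shifting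
  the index set changes each finite product by the exponential of a quadratic, and oddness of
  \<sigma> then removes the quadratic term.\<close>

locale weierstrass_lattice =
  fixes \<omega>1 \<omega>2 :: complex and \<Omega> :: "complex set"
  assumes basis: "is_lattice_basis \<omega>1 \<omega>2"
    and lattice: "\<Omega> = period_lattice \<omega>1 \<omega>2"
begin

lemma real_indep:
  fixes a b :: real
  assumes "of_real a * \<omega>1 + of_real b * \<omega>2 = 0"
  shows "a = 0" "b = 0"
proof -
  define c where "c = (\<lambda>i::nat. if i = 0 then complex_of_real a else of_real b)"
  have "\<forall>i<length [\<omega>1, \<omega>2]. c i \<in> \<real>" by (auto simp: c_def)
  moreover have "(\<Sum>i<length [\<omega>1, \<omega>2]. c i * [\<omega>1, \<omega>2] ! i) = 0"
    using assms by (simp add: c_def)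
  ultimately have "\<forall>i<length [\<omega>1, \<omega>2]. c i = 0"
    using basis unfolding is_lattice_basis_def lin_indep_over_def by blast
  then have "c 0 = 0" "c 1 = 0" by auto
  then show "a = 0" "b = 0" by (auto simp: c_def)
qed

lemma nonzero: "\<omega>1 \<noteq> 0" "\<omega>2 \<noteq> 0"
  using real_indep[of 1 0] real_indep[of 0 1] by auto

text \<open>Up to sign this number is the area of the period parallelogram, the determinant behind
  Cramer's rule for the basis. Were it zero, the periods would be real multiples of each
  other.\<close>

lemma Im_nonzero: "Im (\<omega>2 * cnj \<omega>1) \<noteq> 0"
proof
  assume "Im (\<omega>2 * cnj \<omega>1) = 0"
  then obtain r where r: "\<omega>2 * cnj \<omega>1 = complex_of_real r"
    by (metis complex_is_Real_iff Reals_cases)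
  have "complex_of_real r * \<omega>1 = of_real ((norm \<omega>1)\<^sup>2) * \<omega>2"
    unfolding r[symmetric] by (simp add: complex_norm_square[of \<omega>1] algebra_simps flip: of_real_power)
  then have "of_real r * \<omega>1 + of_real (- (norm \<omega>1)\<^sup>2) * \<omega>2 = 0" by simp
  from real_indep(2)[OF this] nonzero show False by simp
qed

lemma mem_iff: "w \<in> \<Omega> \<longleftrightarrow> (\<exists>m n. w = of_int m * \<omega>1 + of_int n * \<omega>2)"
  by (auto simp: lattice period_lattice_def)

lemma lattice_eq_range: "\<Omega> = range (\<lambda>(m, n). of_int m * \<omega>1 + of_int n * \<omega>2)"
  unfolding set_eq_iff mem_iff by (force intro: range_eqI)

lemma zero_mem [simp]: "0 \<in> \<Omega>"
  by (auto simp: mem_iff intro: exI[of _ 0])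

lemma basis_mem [simp]: "\<omega>1 \<in> \<Omega>" "\<omega>2 \<in> \<Omega>"
proof -
  have "\<omega>1 = of_int 1 * \<omega>1 + of_int 0 * \<omega>2" "\<omega>2 = of_int 0 * \<omega>1 + of_int 1 * \<omega>2" by auto
  then show "\<omega>1 \<in> \<Omega>" "\<omega>2 \<in> \<Omega>" unfolding mem_iff by blast+
qed

lemma add_mem: "a \<in> \<Omega> \<Longrightarrow> b \<in> \<Omega> \<Longrightarrow> a + b \<in> \<Omega>"
proof -
  assume "a \<in> \<Omega>" "b \<in> \<Omega>"
  then obtain m n m' n' where "a = of_int m * \<omega>1 + of_int n * \<omega>2"
    "b = of_int m' * \<omega>1 + of_int n' * \<omega>2" by (auto simp: mem_iff)
  then have "a + b = of_int (m + m') * \<omega>1 + of_int (n + n') * \<omega>2" by (simp add: algebra_simps)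
  then show ?thesis unfolding mem_iff by blast
qed

lemma of_int_mult_mem: "a \<in> \<Omega> \<Longrightarrow> of_int k * a \<in> \<Omega>"
proof -
  assume "a \<in> \<Omega>"
  then obtain m n where "a = of_int m * \<omega>1 + of_int n * \<omega>2" by (auto simp: mem_iff)
  then have "of_int k * a = of_int (k * m) * \<omega>1 + of_int (k * n) * \<omega>2" by (simp add: algebra_simps)
  then show ?thesis unfolding mem_iff by blast
qed

lemma uminus_mem: "a \<in> \<Omega> \<Longrightarrow> - a \<in> \<Omega>"
  using of_int_mult_mem[of a "-1"] by simp

lemma diff_mem: "a \<in> \<Omega> \<Longrightarrow> b \<in> \<Omega> \<Longrightarrow> a - b \<in> \<Omega>"
  using add_mem[of a "- b"] uminus_mem[of b] by simp

lemma uminus_mem_iff [simp]: "- a \<in> \<Omega> \<longleftrightarrow> a \<in> \<Omega>"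
  using uminus_mem[of a] uminus_mem[of "- a"] by auto

lemma add_mem_iff: "w \<in> \<Omega> \<Longrightarrow> z + w \<in> \<Omega> \<longleftrightarrow> z \<in> \<Omega>"
  using add_mem[of z w] diff_mem[of "z + w" w] by auto

text \<open>Multiplying by \<open>cnj \<omega>1\<close> and taking imaginary parts kills the
  \<omega>1-coordinate, since |\<omega>1|^2 is real, and leaves the other coordinate times the area;
  likewise with \<omega>2. Counting lattice points thereby becomes counting pairs of
  integers.\<close>

lemma coordinate_bound:
  "\<exists>d>0. \<forall>m n. d * max \<bar>of_int m\<bar> \<bar>of_int n\<bar> \<le> norm (of_int m * \<omega>1 + of_int n * \<omega>2)"
proof -
  define \<Delta> where "\<Delta> = \<bar>Im (\<omega>2 * cnj \<omega>1)\<bar>"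
  have \<Delta>: "\<Delta> > 0" using Im_nonzero by (simp add: \<Delta>_def)
  define M where "M = max (norm \<omega>1) (norm \<omega>2)"
  have M: "M > 0" using nonzero by (simp add: M_def max_def)
  show ?thesis
  proof (intro exI[of _ "\<Delta> / M"] conjI allI)
    fix m n :: int
    define w where "w = of_int m * \<omega>1 + of_int n * \<omega>2"
    have 1: "Im (w * cnj \<omega>1) = of_int n * Im (\<omega>2 * cnj \<omega>1)" by (simp add: w_def algebra_simps)
    have 2: "Im (w * cnj \<omega>2) = - (of_int m * Im (\<omega>2 * cnj \<omega>1))" by (simp add: w_def algebra_simps)
    have "\<Delta> * \<bar>of_int n\<bar> = \<bar>Im (w * cnj \<omega>1)\<bar>" unfolding 1 by (simp add: \<Delta>_def abs_mult)
    also have "\<dots> \<le> norm w * norm \<omega>1" using abs_Im_le_cmod[of "w * cnj \<omega>1"] by (simp add: norm_mult)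
    also have "\<dots> \<le> norm w * M" by (intro mult_left_mono) (auto simp: M_def)
    finally have n: "\<Delta> * \<bar>of_int n\<bar> \<le> norm w * M" .
    have "\<Delta> * \<bar>of_int m\<bar> = \<bar>Im (w * cnj \<omega>2)\<bar>" unfolding 2 by (simp add: \<Delta>_def abs_mult)
    also have "\<dots> \<le> norm w * norm \<omega>2" using abs_Im_le_cmod[of "w * cnj \<omega>2"] by (simp add: norm_mult)
    also have "\<dots> \<le> norm w * M" by (intro mult_left_mono) (auto simp: M_def)
    finally have "\<Delta> * \<bar>of_int m\<bar> \<le> norm w * M" .
    with n have "\<Delta> * max \<bar>of_int m\<bar> \<bar>of_int n\<bar> \<le> norm w * M" by (auto simp: max_def)
    then show "\<Delta> / M * max \<bar>of_int m\<bar> \<bar>of_int n\<bar> \<le> norm (of_int m * \<omega>1 + of_int n * \<omega>2)"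
      using M by (simp add: w_def field_simps)
  qed (use \<Delta> M in auto)
qed

lemma bounded_finite: "finite {w \<in> \<Omega>. norm w \<le> R}"
proof -
  obtain d :: real where d: "d > 0"
    "\<And>m n. d * max \<bar>of_int m\<bar> \<bar>of_int n\<bar> \<le> norm (of_int m * \<omega>1 + of_int n * \<omega>2)"
    using coordinate_bound by blast
  define K where "K = \<lceil>R / d\<rceil>"
  have "{w \<in> \<Omega>. norm w \<le> R} \<subseteq> (\<lambda>(m, n). of_int m * \<omega>1 + of_int n * \<omega>2) ` ({-K..K} \<times> {-K..K})"
  proof
    fix w assume "w \<in> {w \<in> \<Omega>. norm w \<le> R}"
    then obtain m n where w: "w = of_int m * \<omega>1 + of_int n * \<omega>2" "norm w \<le> R" by (auto simp: mem_iff)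
    have "d * max \<bar>of_int m\<bar> \<bar>of_int n\<bar> \<le> R" using d(2)[of m n] w by simp
    then have "max \<bar>real_of_int m\<bar> \<bar>of_int n\<bar> \<le> R / d"
      using d(1) by (simp add: pos_le_divide_eq mult.commute del: max.bounded_iff)
    then have "max \<bar>real_of_int m\<bar> \<bar>of_int n\<bar> \<le> of_int K" unfolding K_def by linarith
    then have "m \<in> {-K..K}" "n \<in> {-K..K}" by auto
    then show "w \<in> (\<lambda>(m, n). of_int m * \<omega>1 + of_int n * \<omega>2) ` ({-K..K} \<times> {-K..K})"
      using w(1) by auto
  qed
  then show ?thesis by (rule finite_subset) auto
qed

lemma separated: "\<exists>d>0. \<forall>w\<in>\<Omega>. w \<noteq> 0 \<longrightarrow> d \<le> norm w"
proof -
  obtain d :: real where d: "d > 0"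
    "\<And>m n. d * max \<bar>of_int m\<bar> \<bar>of_int n\<bar> \<le> norm (of_int m * \<omega>1 + of_int n * \<omega>2)"
    using coordinate_bound by blast
  have "d \<le> norm w" if w: "w \<in> \<Omega>" "w \<noteq> 0" for w
  proof -
    obtain m n where mn: "w = of_int m * \<omega>1 + of_int n * \<omega>2" using w(1) by (auto simp: mem_iff)
    have "m \<noteq> 0 \<or> n \<noteq> 0" using w(2) mn by auto
    then have "max \<bar>real_of_int m\<bar> \<bar>of_int n\<bar> \<ge> 1" by linarith
    then have "d * 1 \<le> d * max \<bar>of_int m\<bar> \<bar>of_int n\<bar>" using d(1) by (intro mult_left_mono) auto
    then show ?thesis using d(2)[of m n] mn by simp
  qed
  then show ?thesis using d(1) by blast
qed

lemma closed_lattice: "closed \<Omega>"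
proof -
  obtain d where d: "d > 0" "\<And>w. w \<in> \<Omega> \<Longrightarrow> w \<noteq> 0 \<Longrightarrow> d \<le> norm w" using separated by blast
  show ?thesis
  proof (rule discrete_imp_closed[OF d(1)], intro ballI impI)
    fix x y assume "x \<in> \<Omega>" "y \<in> \<Omega>" "dist y x < d"
    then show "y = x" using d(2)[of "y - x"] diff_mem[of y x] by (auto simp: dist_norm)
  qed
qed

lemma countable_lattice: "countable \<Omega>"
proof -
  show ?thesis unfolding lattice_eq_range by simp
qed

end

text \<open>The exponent 3/2 is half of the 3 in the lattice sum and still exceeds 1. The
  \<open>max 1\<close> gives the value 1 at 0, so that a product of two terms also dominates the
  pairs with one zero coordinate.\<close>

lemma summable_on_int_powr:
  "(\<lambda>m::int. (1 / max 1 \<bar>of_int m\<bar>) powr (3/2) :: real) summable_on UNIV"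
proof -
  define f where "f = (\<lambda>m::int. (1 / max 1 \<bar>of_int m\<bar>) powr (3/2) :: real)"
  have s: "summable (\<lambda>n::nat. (1 / max 1 (real n)) powr (3/2))"
  proof -
    have "summable (\<lambda>n::nat. real n powr (-(3/2)))" by (subst summable_real_powr_iff) auto
    then show ?thesis
      by (rule summable_comparison_test_ev[rotated], intro eventually_sequentiallyI[of 1])
         (auto simp: powr_minus powr_divide max_def divide_simps)
  qed
  have n: "(\<lambda>n::nat. (1 / max 1 (real n)) powr (3/2)) summable_on UNIV"
    by (rule norm_summable_imp_summable_on) (use s in simp)
  have 1: "f summable_on (range int)"
    by (subst summable_on_reindex) (use n in \<open>auto simp: o_def f_def\<close>)
  have 2: "f summable_on (range (\<lambda>n. - int n))"
    by (subst summable_on_reindex) (use n in \<open>auto simp: o_def f_def inj_on_def\<close>)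
  have "f summable_on (range int \<union> range (\<lambda>n. - int n))"
    using 1 2 by (rule summable_on_union)
  also have "range int \<union> range (\<lambda>n. - int n) = UNIV"
  proof -
    have "m \<in> range int \<union> range (\<lambda>n. - int n)" for m
      by (cases m rule: int_cases2) auto
    then show ?thesis by blast
  qed
  finally show ?thesis by (simp add: f_def)
qed

context weierstrass_lattice
begin

text \<open>With M the larger coordinate in absolute value, M^(-3) is M^(-3/2) times itself, and
  each copy is at most the corresponding factor in a product of two single series.\<close>

lemma summable_inverse_cube: "(\<lambda>w. 1 / norm w ^ 3) summable_on \<Omega>"
proof -
  obtain d :: real where d: "d > 0"
    "\<And>m n. d * max \<bar>of_int m\<bar> \<bar>of_int n\<bar> \<le> norm (of_int m * \<omega>1 + of_int n * \<omega>2)"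
    using coordinate_bound by blast
  define f where "f = (\<lambda>m::int. (1 / max 1 \<bar>of_int m\<bar>) powr (3/2) :: real)"
  define L where "L = (\<lambda>(m, n). of_int m * \<omega>1 + of_int n * \<omega>2)"
  have fpos: "f m \<ge> 0" for m by (simp add: f_def)
  have f: "f summable_on UNIV" using summable_on_int_powr unfolding f_def .
  have "(\<lambda>p. f (fst p) * f (snd p)) summable_on (UNIV \<times> UNIV)"
  proof (rule summable_on_SigmaI[where g = "\<lambda>m. f m * infsum f UNIV"])
    fix m show "((\<lambda>n. f (fst (m, n)) * f (snd (m, n))) has_sum f m * infsum f UNIV) UNIV"
      using has_sum_cmult_right[OF has_sum_infsum[OF f], of "f m"] by simp
  next
    show "(\<lambda>m. f m * infsum f UNIV) summable_on UNIV"
      by (rule summable_on_cmult_left[OF f])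
  qed (use fpos in auto)
  then have "(\<lambda>p. f (fst p) * f (snd p)) summable_on UNIV" by simp
  then have sum: "(\<lambda>p. (1 / d ^ 3) * (f (fst p) * f (snd p))) summable_on UNIV"
    by (rule summable_on_cmult_right)
  have inj: "inj L"
  proof (rule injI)
    fix p q assume "L p = L q"
    then have "of_real (of_int (fst p - fst q)) * \<omega>1 + of_real (of_int (snd p - snd q)) * \<omega>2 = 0"
      by (simp add: L_def split_beta algebra_simps)
    from real_indep[OF this] show "p = q" by (simp add: prod_eq_iff)
  qed
  have "(\<lambda>p. 1 / norm (L p) ^ 3) summable_on UNIV"
  proof (rule summable_on_comparison_test[OF sum])
    fix p :: "int \<times> int"
    obtain m n where p: "p = (m, n)" by fastforce
    define M where "M = max \<bar>real_of_int m\<bar> \<bar>of_int n\<bar>"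
    show "1 / norm (L p) ^ 3 \<le> 1 / d ^ 3 * (f (fst p) * f (snd p))"
    proof (cases "p = (0, 0)")
      case True
      then show ?thesis using fpos d(1) by (simp add: L_def)
    next
      case False
      then have M1: "M \<ge> 1" using p unfolding M_def by (auto simp: max_def)
      have dM: "d * M \<le> norm (L p)" using d(2)[of m n] by (simp add: M_def L_def p)
      have "1 / norm (L p) ^ 3 \<le> 1 / (d * M) ^ 3"
      proof (intro divide_left_mono power_mono dM)
        have "0 < d * M" using M1 d(1) by simp
        with dM show "0 \<le> d * M" "0 < norm (L p) ^ 3 * (d * M) ^ 3"
          by (auto simp del: zero_less_norm_iff intro!: mult_pos_pos zero_less_power)
      qed simp
      also have "\<dots> = 1 / d ^ 3 * ((1 / M) powr (3/2) * (1 / M) powr (3/2))"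
      proof -
        have "(1 / M) powr (3/2) * (1 / M) powr (3/2) = (1 / M) powr 3"
          by (simp flip: powr_add)
        also have "\<dots> = (1 / M) ^ 3" using M1 by (subst powr_numeral) auto
        finally show ?thesis by (simp add: power_mult_distrib field_simps)
      qed
      also have "\<dots> \<le> 1 / d ^ 3 * (f (fst p) * f (snd p))"
        unfolding f_def p fst_conv snd_conv
        by (intro mult_left_mono mult_mono powr_mono2 divide_left_mono)
           (use M1 d(1) in \<open>auto simp: M_def\<close>)
      finally show ?thesis .
    qed
  qed auto
  then have "(\<lambda>w. 1 / norm w ^ 3) summable_on (range L)"
    using inj by (subst summable_on_reindex) (auto simp: o_def)
  also have "range L = \<Omega>" by (simp add: L_def lattice_eq_range)
  finally show ?thesis .
qed

end

section \<open>The sigma function\<close>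

text \<open>At \<open>w = 0\<close> the factor is \<open>z\<close> itself, so that \<sigma> becomes
  a single product over the whole lattice, an index set stable under negation and
  translation.\<close>

definition sigma_factor :: "complex \<Rightarrow> complex \<Rightarrow> complex" where
  "sigma_factor w z = (if w = 0 then z else (1 - z / w) * exp (z / w + z\<^sup>2 / (2 * w\<^sup>2)))"

lemma sigma_factor_eq_0_iff [simp]: "sigma_factor w z = 0 \<longleftrightarrow> z = w"
  by (auto simp: sigma_factor_def)

lemma sigma_factor_holomorphic [holomorphic_intros]: "sigma_factor w holomorphic_on A"
  unfolding sigma_factor_def by (cases "w = 0") (auto intro!: holomorphic_intros)

text \<open>The factor is the elementary Weierstrass factor of order 2 at z / w, which differs from
  1 by at most 3 |z / w|^3 when |z / w| is at most 1/2. The cutoff 2R ensures this, and 3/8 < 1/2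
  keeps the principal logarithm under control.\<close>

lemma sigma_factor_near_1:
  assumes "norm z \<le> R" "2 * R < norm w"
  shows "norm (sigma_factor w z - 1) < 1 / 2" "norm (sigma_factor w z - 1) \<le> 3 * R ^ 3 / norm w ^ 3"
proof -
  have R: "R \<ge> 0" using assms(1) norm_ge_zero[of z] by linarith
  have w: "w \<noteq> 0" using assms R by auto
  have zw: "norm (z / w) \<le> 1 / 2"
    using assms w by (simp add: norm_divide field_simps)
  have eq: "sigma_factor w z = weierstrass_factor 2 (z / w)"
    using w by (simp add: sigma_factor_def weierstrass_factor_def numeral_2_eq_2 power_divide mult.commute)
  have "norm (sigma_factor w z - 1) \<le> 3 * norm (z / w) ^ 3"
    unfolding eq using weierstrass_factor_bound[OF zw, of 2] by (simp add: numeral_3_eq_3 numeral_2_eq_2)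
  also have 1: "norm (z / w) ^ 3 \<le> (1 / 2) ^ 3" using zw by (intro power_mono) auto
  have "norm (z / w) ^ 3 \<le> (R / norm w) ^ 3"
    unfolding norm_divide by (intro power_mono divide_right_mono assms) auto
  finally show "norm (sigma_factor w z - 1) \<le> 3 * R ^ 3 / norm w ^ 3" by (simp add: power_divide)
  have "norm (sigma_factor w z - 1) \<le> 3 * norm (z / w) ^ 3"
    unfolding eq using weierstrass_factor_bound[OF zw, of 2] by (simp add: numeral_3_eq_3 numeral_2_eq_2)
  also have "\<dots> < 1 / 2" using 1 by (simp add: power_divide)
  finally show "norm (sigma_factor w z - 1) < 1 / 2" .
qed

section \<open>Convergence of the sigma product through logarithms\<close>

context weierstrass_lattice
begin

text \<open>The finitely many factors with |w| at most 2R may vanish in the disc of radius R; they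
  get logarithm 0 here and stay outside the exponential, indexed by \<open>near R\<close>.\<close>

definition sigma_log :: "real \<Rightarrow> complex \<Rightarrow> complex \<Rightarrow> complex" where
  "sigma_log R w z = (if norm w \<le> 2 * R then 0 else Ln (sigma_factor w z))"

lemma sigma_log_bound:
  assumes "norm z \<le> R"
  shows "norm (sigma_log R w z) \<le> 6 * R ^ 3 * (1 / norm w ^ 3)"
proof (cases "norm w \<le> 2 * R")
  case True
  have "R \<ge> 0" using assms norm_ge_zero[of z] by linarith
  then show ?thesis using True by (simp add: sigma_log_def)
next
  case False
  then have "norm (sigma_log R w z) \<le> 2 * norm (sigma_factor w z - 1)"
    using norm_Ln_le[OF sigma_factor_near_1(1)[OF assms, of w]] by (simp add: sigma_log_def)
  also have "\<dots> \<le> 2 * (3 * R ^ 3 / norm w ^ 3)"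
    using False sigma_factor_near_1(2)[OF assms, of w] by (intro mult_left_mono) auto
  finally show ?thesis by simp
qed

lemma sigma_log_exp:
  assumes "norm z \<le> R" "norm w > 2 * R"
  shows "exp (sigma_log R w z) = sigma_factor w z"
proof -
  have "norm w \<noteq> norm z" using assms norm_ge_zero[of z] by linarith
  then have "w \<noteq> z" by auto
  then show ?thesis using assms by (simp add: sigma_log_def)
qed

lemma sigma_log_uniform_limit:
  assumes "S \<subseteq> \<Omega>"
  shows "uniform_limit (cball 0 R) (\<lambda>X z. \<Sum>w\<in>X. sigma_log R w z)
           (\<lambda>z. \<Sum>\<^sub>\<infinity>w\<in>S. sigma_log R w z) (finite_subsets_at_top S)"
proof (rule Weierstrass_m_test_general)
  show "(\<lambda>w. 6 * R ^ 3 * (1 / norm w ^ 3)) summable_on S"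
    using summable_inverse_cube assms
    by (intro summable_on_cmult_right summable_on_subset_banach[where A = \<Omega> and B = S])
qed (use sigma_log_bound in auto)

lemma sigma_log_suminf_holomorphic:
  assumes "S \<subseteq> \<Omega>"
  shows "(\<lambda>z. \<Sum>\<^sub>\<infinity>w\<in>S. sigma_log R w z) holomorphic_on ball 0 R"
proof -
  have hol: "(\<lambda>z. sigma_log R w z) holomorphic_on cball 0 R" for w
  proof (cases "norm w \<le> 2 * R")
    case True
    then show ?thesis by (simp add: sigma_log_def)
  next
    case False
    have "sigma_factor w z \<notin> \<real>\<^sub>\<le>\<^sub>0" if "z \<in> cball 0 R" for z
    proof -
      have "norm (sigma_factor w z - 1) < 1 / 2"
        using that False by (intro sigma_factor_near_1(1)[of z R w]) auto
      then have "Re (sigma_factor w z) > 0"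
        using abs_Re_le_cmod[of "sigma_factor w z - 1"] by simp
      then show ?thesis by (auto simp: complex_nonpos_Reals_iff)
    qed
    then show ?thesis using False unfolding sigma_log_def by (auto intro!: holomorphic_intros)
  qed
  have hols: "(\<lambda>z. \<Sum>w\<in>X. sigma_log R w z) holomorphic_on cball 0 R" for X
    by (intro holomorphic_on_sum hol)
  have "\<forall>\<^sub>F X in finite_subsets_at_top S. continuous_on (cball 0 R) (\<lambda>z. \<Sum>w\<in>X. sigma_log R w z)
      \<and> (\<lambda>z. \<Sum>w\<in>X. sigma_log R w z) holomorphic_on ball 0 R"
    by (intro always_eventually allI conjI holomorphic_on_imp_continuous_on hols
        holomorphic_on_subset[OF hols ball_subset_cball])
  from holomorphic_uniform_limit[OF this sigma_log_uniform_limit[OF assms]] show ?thesis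
    by simp
qed

lemma sigma_log_sum_tendsto:
  assumes "S \<subseteq> \<Omega>" "norm z \<le> R"
  shows "((\<lambda>X. \<Sum>w\<in>X. sigma_log R w z) \<longlongrightarrow> (\<Sum>\<^sub>\<infinity>w\<in>S. sigma_log R w z)) (finite_subsets_at_top S)"
  using tendsto_uniform_limitI[OF sigma_log_uniform_limit[OF assms(1), of R], of z] assms(2) by simp

definition near :: "real \<Rightarrow> complex set" where
  "near R = {w \<in> \<Omega>. norm w \<le> 2 * R}"

lemma finite_near: "finite (near R)"
  unfolding near_def by (rule bounded_finite)

text \<open>Once a finite set contains \<open>near R \<inter> S\<close>, its product is the finite
  part times the exponential of the sum of logarithms, so convergence reduces to that sum. The set
  \<open>S\<close> is free because the definition of \<sigma> runs over \<Omega> - {0}, while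
  symmetry arguments run over \<Omega>.\<close>

lemma sigma_factor_prod_tendsto:
  assumes "S \<subseteq> \<Omega>" "norm z \<le> R"
  shows "((\<lambda>X. \<Prod>w\<in>X. sigma_factor w z) \<longlongrightarrow>
           (\<Prod>w\<in>near R \<inter> S. sigma_factor w z) * exp (\<Sum>\<^sub>\<infinity>w\<in>S. sigma_log R w z))
         (finite_subsets_at_top S)"
proof -
  have "((\<lambda>X. (\<Prod>w\<in>near R \<inter> S. sigma_factor w z) * exp (\<Sum>w\<in>X. sigma_log R w z)) \<longlongrightarrow>
           (\<Prod>w\<in>near R \<inter> S. sigma_factor w z) * exp (\<Sum>\<^sub>\<infinity>w\<in>S. sigma_log R w z))
         (finite_subsets_at_top S)"
    by (intro tendsto_intros sigma_log_sum_tendsto assms)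
  moreover have "\<forall>\<^sub>F X in finite_subsets_at_top S.
     (\<Prod>w\<in>near R \<inter> S. sigma_factor w z) * exp (\<Sum>w\<in>X. sigma_log R w z) = (\<Prod>w\<in>X. sigma_factor w z)"
    unfolding eventually_finite_subsets_at_top
  proof (intro exI[of _ "near R \<inter> S"] conjI allI impI)
    fix X assume X: "finite X \<and> near R \<inter> S \<subseteq> X \<and> X \<subseteq> S"
    have "(\<Sum>w\<in>X. sigma_log R w z) = (\<Sum>w\<in>X - near R. sigma_log R w z)"
      using X assms by (intro sum.mono_neutral_right) (auto simp: near_def sigma_log_def)
    then have "exp (\<Sum>w\<in>X. sigma_log R w z) = (\<Prod>w\<in>X - near R. exp (sigma_log R w z))"
      using X by (simp add: exp_sum)
    also have "\<dots> = (\<Prod>w\<in>X - near R. sigma_factor w z)"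
      using X assms by (intro prod.cong refl sigma_log_exp) (auto simp: near_def not_le)
    finally have *: "exp (\<Sum>w\<in>X. sigma_log R w z) = (\<Prod>w\<in>X - near R. sigma_factor w z)" .
    have "X = (near R \<inter> S) \<union> (X - near R)" using X by auto
    then show "(\<Prod>w\<in>near R \<inter> S. sigma_factor w z) * exp (\<Sum>w\<in>X. sigma_log R w z)
        = (\<Prod>w\<in>X. sigma_factor w z)"
      unfolding * using X finite_near
      by (metis (no_types, lifting) Diff_disjoint Int_Diff inf_commute finite_Diff finite_Int
          inf_assoc inf_bot_right prod.union_disjoint)
  qed (use finite_near assms in auto)
  ultimately show ?thesis by (rule Lim_transform_eventually)
qed

abbreviation \<sigma> where "\<sigma> \<equiv> weierstrass_sigma \<Omega>"

lemma sigma_eq_mult: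
  assumes "norm z \<le> R"
  shows "\<sigma> z = z * ((\<Prod>w\<in>near R - {0}. sigma_factor w z) * exp (\<Sum>\<^sub>\<infinity>w\<in>\<Omega>. sigma_log R w z))"
proof -
  have R: "R \<ge> 0" using assms norm_ge_zero[of z] by linarith
  have "\<forall>\<^sub>F X in finite_subsets_at_top (\<Omega> - {0}). (\<Prod>w\<in>X. sigma_factor w z) =
     (\<Prod>\<omega>\<in>X. (1 - z / \<omega>) * exp (z / \<omega> + z\<^sup>2 / (2 * \<omega>\<^sup>2)))"
    unfolding eventually_finite_subsets_at_top
    by (intro exI[of _ "{}"]) (auto simp: sigma_factor_def intro!: prod.cong)
  with sigma_factor_prod_tendsto[of "\<Omega> - {0}" z R] assms
  have "((\<lambda>X. \<Prod>\<omega>\<in>X. (1 - z / \<omega>) * exp (z / \<omega> + z\<^sup>2 / (2 * \<omega>\<^sup>2))) \<longlongrightarrow>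
          (\<Prod>w\<in>near R \<inter> (\<Omega> - {0}). sigma_factor w z) * exp (\<Sum>\<^sub>\<infinity>w\<in>\<Omega> - {0}. sigma_log R w z))
     (finite_subsets_at_top (\<Omega> - {0}))"
    by (auto intro: Lim_transform_eventually)
  from tendsto_Lim[OF _ this] have "\<sigma> z = z *
      ((\<Prod>w\<in>near R \<inter> (\<Omega> - {0}). sigma_factor w z) * exp (\<Sum>\<^sub>\<infinity>w\<in>\<Omega> - {0}. sigma_log R w z))"
    by (simp add: weierstrass_sigma_def)
  also have "near R \<inter> (\<Omega> - {0}) = near R - {0}" by (auto simp: near_def)
  \<comment> \<open>The index 0 lies below the cutoff, so its logarithm is 0 and may be
    added.\<close>
  also have "(\<Sum>\<^sub>\<infinity>w\<in>\<Omega> - {0}. sigma_log R w z) = (\<Sum>\<^sub>\<infinity>w\<in>\<Omega>. sigma_log R w z)"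
    by (rule infsum_cong_neutral) (use R in \<open>auto simp: sigma_log_def\<close>)
  finally show ?thesis .
qed

lemma sigma_eq:
  assumes "norm z \<le> R"
  shows "\<sigma> z = (\<Prod>w\<in>near R. sigma_factor w z) * exp (\<Sum>\<^sub>\<infinity>w\<in>\<Omega>. sigma_log R w z)"
proof -
  have "0 \<le> R" using assms norm_ge_zero[of z] by linarith
  then have "0 \<in> near R" by (simp add: near_def)
  then have "(\<Prod>w\<in>near R. sigma_factor w z) = z * (\<Prod>w\<in>near R - {0}. sigma_factor w z)"
    using prod.remove[OF finite_near, of 0 R "\<lambda>w. sigma_factor w z"] by (simp add: sigma_factor_def)
  then show ?thesis using sigma_eq_mult[OF assms] by simp
qed

text \<open>An unconditional limit over the finite subsets of \<Omega> is unchanged when the subsets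
  are moved by a bijection of \<Omega>; oddness and quasi-periodicity both come from this.\<close>

lemma sigma_tendsto: "((\<lambda>X. \<Prod>w\<in>X. sigma_factor w z) \<longlongrightarrow> \<sigma> z) (finite_subsets_at_top \<Omega>)"
proof -
  have "near (norm z) \<inter> \<Omega> = near (norm z)" by (auto simp: near_def)
  then show ?thesis
    using sigma_factor_prod_tendsto[of \<Omega> z "norm z"] sigma_eq[of z "norm z"] by simp
qed

lemma sigma_eq_0_iff [simp]: "\<sigma> z = 0 \<longleftrightarrow> z \<in> \<Omega>"
  using sigma_eq[of z "norm z"] finite_near by (auto simp: near_def)

lemma sigma_holomorphic [holomorphic_intros]: "\<sigma> holomorphic_on A"
proof -
  have "\<sigma> field_differentiable (at z)" for z
  proof -
    define R where "R = norm z + 1"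
    have "(\<lambda>z. (\<Prod>w\<in>near R. sigma_factor w z) * exp (\<Sum>\<^sub>\<infinity>w\<in>\<Omega>. sigma_log R w z)) holomorphic_on ball 0 R"
      by (intro holomorphic_intros sigma_log_suminf_holomorphic) auto
    then have "\<sigma> holomorphic_on ball 0 R"
      by (rule holomorphic_transform) (use sigma_eq[of _ R] in auto)
    then show ?thesis
      by (rule holomorphic_on_imp_differentiable_at) (auto simp: R_def)
  qed
  then show ?thesis unfolding holomorphic_on_def using field_differentiable_at_within by blast
qed

lemma sigma_holomorphic_compose [holomorphic_intros]:
  "f holomorphic_on A \<Longrightarrow> (\<lambda>z. \<sigma> (f z)) holomorphic_on A"
  using holomorphic_on_compose[OF _ sigma_holomorphic, of f A] by (simp add: o_def)

text \<open>The zero at the origin is simple because \<sigma> is \<open>z\<close> times a function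
  that does not vanish there. Hence a vanishing numerator cancels \<sigma> in a denominator.\<close>

lemma deriv_sigma_0: "deriv \<sigma> 0 \<noteq> 0"
proof -
  define g where "g = (\<lambda>z. (\<Prod>w\<in>near 1 - {0}. sigma_factor w z) * exp (\<Sum>\<^sub>\<infinity>w\<in>\<Omega>. sigma_log 1 w z))"
  have "g holomorphic_on ball 0 1"
    unfolding g_def by (intro holomorphic_intros sigma_log_suminf_holomorphic) auto
  then obtain g' where "(g has_field_derivative g') (at 0)"
    using holomorphic_on_imp_differentiable_at[of g "ball 0 1" 0]
    by (auto simp: field_differentiable_def)
  then have "((\<lambda>z. z * g z) has_field_derivative g 0) (at 0)"
    by (auto intro!: derivative_eq_intros)
  moreover have "\<forall>\<^sub>F z in nhds 0. z * g z = \<sigma> z"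
  proof -
    have "\<forall>\<^sub>F z in nhds (0::complex). z \<in> ball 0 1" by (intro eventually_nhds_in_open) auto
    then show ?thesis by eventually_elim (use sigma_eq_mult[of _ 1] in \<open>auto simp: g_def\<close>)
  qed
  ultimately have "(\<sigma> has_field_derivative g 0) (at 0)"
    using DERIV_cong_ev[of 0 0 "\<lambda>z. z * g z" \<sigma> "g 0" "g 0"] by simp
  then have "deriv \<sigma> 0 = g 0" by (rule DERIV_imp_deriv)
  also have "g 0 \<noteq> 0" using finite_near by (auto simp: g_def)
  finally show ?thesis .
qed

text \<open>Changing the signs of both \<open>w\<close> and \<open>z\<close> leaves every factor
  with \<open>w \<noteq> 0\<close> unchanged and negates the factor at 0.\<close>

lemma sigma_minus: "\<sigma> (- z) = - \<sigma> z"
proof -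
  have "x \<in> uminus ` \<Omega>" if "x \<in> \<Omega>" for x
    by (rule image_eqI[of _ _ "- x"]) (use that in auto)
  then have im: "uminus ` \<Omega> = \<Omega>" by auto
  have "filterlim ((`) uminus) (finite_subsets_at_top \<Omega>) (finite_subsets_at_top \<Omega>)"
    unfolding filterlim_def using filtermap_image_finite_subsets_at_top[of uminus \<Omega>]
    by (simp add: im)
  from filterlim_compose[OF sigma_tendsto this, of "- z"]
  have "((\<lambda>X. \<Prod>w\<in>uminus ` X. sigma_factor w (- z)) \<longlongrightarrow> \<sigma> (- z)) (finite_subsets_at_top \<Omega>)" .
  moreover have "\<forall>\<^sub>F X in finite_subsets_at_top \<Omega>. (\<Prod>w\<in>uminus ` X. sigma_factor w (- z)) =
      - (\<Prod>w\<in>X. sigma_factor w z)"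
    unfolding eventually_finite_subsets_at_top
  \<comment> \<open>Only sets containing 0 are considered, so that exactly one factor changes
    sign.\<close>
  proof (intro exI[of _ "{0}"] conjI allI impI)
    fix X assume X: "finite X \<and> {0} \<subseteq> X \<and> X \<subseteq> \<Omega>"
    have "(\<Prod>w\<in>uminus ` X. sigma_factor w (- z)) = (\<Prod>w\<in>X. sigma_factor (- w) (- z))"
      by (subst prod.reindex) auto
    also have "\<dots> = sigma_factor 0 (- z) * (\<Prod>w\<in>X - {0}. sigma_factor (- w) (- z))"
      using X by (subst prod.remove[of _ 0]) auto
    also have "\<dots> = - (sigma_factor 0 z * (\<Prod>w\<in>X - {0}. sigma_factor w z))"
      by (simp add: sigma_factor_def)
    also have "sigma_factor 0 z * (\<Prod>w\<in>X - {0}. sigma_factor w z) = (\<Prod>w\<in>X. sigma_factor w z)"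
      using X by (subst (2) prod.remove[of _ 0]) auto
    finally show "(\<Prod>w\<in>uminus ` X. sigma_factor w (- z)) = - (\<Prod>w\<in>X. sigma_factor w z)" .
  qed auto
  ultimately have "((\<lambda>X. - (\<Prod>w\<in>X. sigma_factor w z)) \<longlongrightarrow> \<sigma> (- z)) (finite_subsets_at_top \<Omega>)"
    by (rule Lim_transform_eventually)
  moreover have "((\<lambda>X. - (\<Prod>w\<in>X. sigma_factor w z)) \<longlongrightarrow> - \<sigma> z) (finite_subsets_at_top \<Omega>)"
    by (intro tendsto_intros sigma_tendsto)
  ultimately show ?thesis
    using tendsto_unique[of "finite_subsets_at_top \<Omega>"] by auto
qed

end

section \<open>Quasi-periodicity\<close>

lemma constant_if_deriv_0:
  fixes f :: "complex \<Rightarrow> complex"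
  assumes "open U" "connected U" "\<And>z. z \<in> U \<Longrightarrow> (f has_field_derivative 0) (at z)"
  shows "\<exists>c. \<forall>z\<in>U. f z = c"
proof -
  have "continuous_on U f"
    using assms(3) DERIV_isCont by (intro continuous_at_imp_continuous_on) blast
  then show ?thesis
    using DERIV_zero_connected_constant[OF assms(2,1) finite.emptyI] assms(3) by (metis Diff_iff)
qed

lemma sigma_factor_normal_form:
  "\<exists>k a b. k \<noteq> 0 \<and> (\<forall>z. sigma_factor w z = (z - w) * (k * exp (a * z + b * z\<^sup>2)))"
proof (cases "w = 0")
  case True
  then show ?thesis by (intro exI[of _ 1] exI[of _ 0]) (simp add: sigma_factor_def)
next
  case False
  then show ?thesis
    by (intro exI[of _ "- 1 / w"] exI[of _ "1 / w"] exI[of _ "1 / (2 * w\<^sup>2)"])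
       (simp add: sigma_factor_def field_simps)
qed

text \<open>Both factors have their only zero at \<open>z = w\<close>, so what remains of the
  quotient is again the exponential of a quadratic.\<close>

lemma sigma_factor_shift:
  "\<exists>c a b. \<forall>z. sigma_factor (w + w0) (z + w0) = sigma_factor w z * (c * exp (a * z + b * z\<^sup>2))"
proof -
  obtain k a b where 1: "k \<noteq> 0" "\<And>z. sigma_factor w z = (z - w) * (k * exp (a * z + b * z\<^sup>2))"
    using sigma_factor_normal_form[of w] by blast
  obtain k' a' b' where 2: "\<And>z. sigma_factor (w + w0) z = (z - (w + w0)) * (k' * exp (a' * z + b' * z\<^sup>2))"
    using sigma_factor_normal_form[of "w + w0"] by blast
  show ?thesis
  proof (intro exI allI)
    fix z
    have e: "exp (a' * (z + w0) + b' * (z + w0)\<^sup>2) = exp (a * z + b * z\<^sup>2) * exp (a' * w0 + b' * w0\<^sup>2) *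
        exp ((a' + 2 * b' * w0 - a) * z + (b' - b) * z\<^sup>2)"
      unfolding exp_add[symmetric] by (rule arg_cong[where f = exp]) (simp add: algebra_simps power2_eq_square)
    show "sigma_factor (w + w0) (z + w0) = sigma_factor w z *
        ((k' / k * exp (a' * w0 + b' * w0\<^sup>2)) * exp ((a' + 2 * b' * w0 - a) * z + (b' - b) * z\<^sup>2))"
    proof -
      have "(z + w0 - (w + w0)) * (k' * (P * Q * R)) = (z - w) * (k * P) * ((k' / k * Q) * R)" for P Q R
        using 1(1) by simp
      then show ?thesis unfolding 1(2) 2 e by blast
    qed
  qed
qed

context weierstrass_lattice
begin

abbreviation \<zeta> where "\<zeta> \<equiv> weierstrass_zeta \<Omega>"
abbreviation wp where "wp \<equiv> weierstrass_wp \<Omega>"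

lemma connected_compl: "connected (- \<Omega>)"
  by (intro path_connected_imp_connected path_connected_complement_countable countable_lattice) auto

lemma open_compl: "open (- \<Omega>)"
  using closed_lattice by auto

lemma mem_coords_iff:
  "of_real a * \<omega>1 + of_real b * \<omega>2 \<in> \<Omega> \<longleftrightarrow> a \<in> \<int> \<and> b \<in> \<int>"
proof
  assume "of_real a * \<omega>1 + of_real b * \<omega>2 \<in> \<Omega>"
  then obtain m n where "of_real a * \<omega>1 + of_real b * \<omega>2 = of_int m * \<omega>1 + of_int n * \<omega>2"
    by (auto simp: mem_iff)
  then have "of_real (a - of_int m) * \<omega>1 + of_real (b - of_int n) * \<omega>2 = 0" by (simp add: algebra_simps)
  from real_indep[OF this] have "a = of_int m" "b = of_int n" by auto
  then show "a \<in> \<int> \<and> b \<in> \<int>" by simp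
next
  assume "a \<in> \<int> \<and> b \<in> \<int>"
  then obtain m n where "a = of_int m" "b = of_int n" by (auto elim!: Ints_cases)
  then show "of_real a * \<omega>1 + of_real b * \<omega>2 \<in> \<Omega>"
    unfolding mem_iff by (intro exI[of _ m] exI[of _ n]) simp
qed

lemma half_not_int: "(1 / 2 :: real) \<notin> \<int>"
  by (simp add: fraction_not_in_Ints[of 2 1, simplified])

lemma half_periods:
  "\<omega>1 / 2 \<notin> \<Omega>" "\<omega>2 / 2 \<notin> \<Omega>" "(\<omega>1 + \<omega>2) / 2 \<notin> \<Omega>"
  using mem_coords_iff[of "1/2" 0] mem_coords_iff[of 0 "1/2"] mem_coords_iff[of "1/2" "1/2"] half_not_int
  by (auto simp: add_divide_distrib)

text \<open>The products over X and over X + w0 differ by c exp(a z + b z^2) with coefficients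
  depending on X. Convergence is established for the values at each point and not for the
  coefficients; the next lemma therefore extracts an identity that survives pointwise
  limits.\<close>

lemma sigma_shift_ratio_tendsto:
  assumes "w0 \<in> \<Omega>"
  shows "\<exists>c a b. \<forall>z. z \<notin> \<Omega> \<longrightarrow>
    ((\<lambda>X. c X * exp (a X * z + b X * z\<^sup>2)) \<longlongrightarrow> \<sigma> (z + w0) / \<sigma> z) (finite_subsets_at_top \<Omega>)"
proof -
  obtain c a b where cab: "\<And>w z. sigma_factor (w + w0) (z + w0) =
      sigma_factor w z * (c w * exp (a w * z + b w * z\<^sup>2))"
    using sigma_factor_shift[of _ w0] by metis
  have im: "(\<lambda>w. w + w0) ` \<Omega> = \<Omega>"
  proof -
    have "x \<in> (\<lambda>w. w + w0) ` \<Omega>" if "x \<in> \<Omega>" for x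
      by (rule image_eqI[of _ _ "x - w0"]) (use that assms diff_mem in auto)
    then show ?thesis using assms add_mem by auto
  qed
  have filt: "filterlim ((`) (\<lambda>w. w + w0)) (finite_subsets_at_top \<Omega>) (finite_subsets_at_top \<Omega>)"
    unfolding filterlim_def using filtermap_image_finite_subsets_at_top[of "\<lambda>w. w + w0" \<Omega>]
    by (simp add: im)
  have eq: "(\<Prod>w\<in>(\<lambda>w. w + w0) ` X. sigma_factor w (z + w0)) =
      (\<Prod>w\<in>X. sigma_factor w z) * ((\<Prod>w\<in>X. c w) * exp ((\<Sum>w\<in>X. a w) * z + (\<Sum>w\<in>X. b w) * z\<^sup>2))"
    if "finite X" for X z
  proof -
    have "(\<Prod>w\<in>(\<lambda>w. w + w0) ` X. sigma_factor w (z + w0)) =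
        (\<Prod>w\<in>X. sigma_factor w z * (c w * exp (a w * z + b w * z\<^sup>2)))"
      by (subst prod.reindex) (auto simp: cab)
    also have "\<dots> = (\<Prod>w\<in>X. sigma_factor w z) * ((\<Prod>w\<in>X. c w) * exp (\<Sum>w\<in>X. a w * z + b w * z\<^sup>2))"
      using that by (simp add: prod.distrib exp_sum)
    finally show ?thesis by (simp add: sum.distrib sum_distrib_right)
  qed
  have "((\<lambda>X. (\<Prod>w\<in>X. c w) * exp ((\<Sum>w\<in>X. a w) * z + (\<Sum>w\<in>X. b w) * z\<^sup>2)) \<longlongrightarrow>
      \<sigma> (z + w0) / \<sigma> z) (finite_subsets_at_top \<Omega>)" if z: "z \<notin> \<Omega>" for z
  proof (rule Lim_transform_eventually)
    show "((\<lambda>X. (\<Prod>w\<in>(\<lambda>w. w + w0) ` X. sigma_factor w (z + w0)) / (\<Prod>w\<in>X. sigma_factor w z)) \<longlongrightarrow>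
      \<sigma> (z + w0) / \<sigma> z) (finite_subsets_at_top \<Omega>)"
      using filterlim_compose[OF sigma_tendsto filt, of "z + w0"] z
      by (intro tendsto_divide sigma_tendsto) auto
    show "\<forall>\<^sub>F X in finite_subsets_at_top \<Omega>.
        (\<Prod>w\<in>(\<lambda>w. w + w0) ` X. sigma_factor w (z + w0)) / (\<Prod>w\<in>X. sigma_factor w z) =
        (\<Prod>w\<in>X. c w) * exp ((\<Sum>w\<in>X. a w) * z + (\<Sum>w\<in>X. b w) * z\<^sup>2)"
      unfolding eventually_finite_subsets_at_top
    proof (intro exI[of _ "{}"] conjI allI impI)
      fix X assume X: "finite X \<and> {} \<subseteq> X \<and> X \<subseteq> \<Omega>"
      then have "(\<Prod>w\<in>X. sigma_factor w z) \<noteq> 0" using z by (auto simp: prod_zero_iff)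
      then show "(\<Prod>w\<in>(\<lambda>w. w + w0) ` X. sigma_factor w (z + w0)) / (\<Prod>w\<in>X. sigma_factor w z) =
        (\<Prod>w\<in>X. c w) * exp ((\<Sum>w\<in>X. a w) * z + (\<Sum>w\<in>X. b w) * z\<^sup>2)"
        using X by (simp add: eq)
    qed auto
  qed
  then show ?thesis by blast
qed

text \<open>The third difference of a quadratic polynomial vanishes; exponentiated, this is an
  identity satisfied by every approximant. Written with products instead of quotients, it passes to
  the limit.\<close>

lemma sigma_shift_ratio_third_difference:
  fixes E w0
  defines "E \<equiv> \<lambda>z. \<sigma> (z + w0) / \<sigma> z"
  assumes "w0 \<in> \<Omega>" and z: "z \<notin> \<Omega>" "z + h \<notin> \<Omega>" "z + 2 * h \<notin> \<Omega>" "z + 3 * h \<notin> \<Omega>"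
  shows "E (z + 3 * h) * E (z + h) ^ 3 = E (z + 2 * h) ^ 3 * E z"
proof -
  obtain c a b where lim: "\<And>z. z \<notin> \<Omega> \<Longrightarrow>
    ((\<lambda>X. c X * exp (a X * z + b X * z\<^sup>2)) \<longlongrightarrow> E z) (finite_subsets_at_top \<Omega>)"
    using sigma_shift_ratio_tendsto[OF assms(2)] unfolding E_def by blast
  define e where "e = (\<lambda>X z. c X * exp (a X * z + b X * z\<^sup>2))"
  have lim': "((\<lambda>X. e X z) \<longlongrightarrow> E z) (finite_subsets_at_top \<Omega>)" if "z \<notin> \<Omega>" for z
    using lim[OF that] by (simp add: e_def)
  have eq: "e X (z + 3 * h) * e X (z + h) ^ 3 = e X (z + 2 * h) ^ 3 * e X z" for X
    by (simp add: e_def power_mult_distrib flip: exp_add exp_of_nat_mult)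
       (simp add: algebra_simps power2_eq_square numeral_eq_Suc)
  have "((\<lambda>X. e X (z + 3 * h) * e X (z + h) ^ 3) \<longlongrightarrow> E (z + 3 * h) * E (z + h) ^ 3) (finite_subsets_at_top \<Omega>)"
    by (intro tendsto_intros lim' z)
  then have "((\<lambda>X. e X (z + 2 * h) ^ 3 * e X z) \<longlongrightarrow> E (z + 3 * h) * E (z + h) ^ 3) (finite_subsets_at_top \<Omega>)"
    unfolding eq .
  moreover have "((\<lambda>X. e X (z + 2 * h) ^ 3 * e X z) \<longlongrightarrow> E (z + 2 * h) ^ 3 * E z) (finite_subsets_at_top \<Omega>)"
    by (intro tendsto_intros lim' z)
  ultimately show ?thesis using tendsto_unique[of "finite_subsets_at_top \<Omega>"] by auto
qed

end

text \<open>Differentiating the identity in \<open>h\<close> turns it into one for the logarithmic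
  derivative \<open>L\<close>, and two further derivatives give L'' = 0 at h = 0. Working with
  \<open>L\<close> avoids a logarithm of \<open>E\<close>, since the complement of a lattice is not
  simply connected.\<close>

lemma exp_quadratic_if_third_difference:
  fixes E :: "complex \<Rightarrow> complex"
  assumes U: "open U" "connected U" and hol: "E holomorphic_on U" and nz: "\<And>z. z \<in> U \<Longrightarrow> E z \<noteq> 0"
    and diff: "\<And>z h. \<lbrakk>z \<in> U; z + h \<in> U; z + 2 * h \<in> U; z + 3 * h \<in> U\<rbrakk> \<Longrightarrow>
      E (z + 3 * h) * E (z + h) ^ 3 = E (z + 2 * h) ^ 3 * E z"
  shows "\<exists>A B C. \<forall>z\<in>U. E z = C * exp (A * z\<^sup>2 + B * z)"
proof -
  define L where "L = (\<lambda>z. deriv E z / E z)"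
  have holL: "L holomorphic_on U" unfolding L_def using nz by (intro holomorphic_intros hol U) auto
  have dE: "(E has_field_derivative L x * E x) (at x)" if "x \<in> U" for x
    using holomorphic_derivI[OF hol U(1) that] nz[OF that] by (simp add: L_def)
  have dlin: "((\<lambda>h. z + k * h) has_field_derivative k) (at h)" for z k h :: complex
    by (auto intro!: derivative_eq_intros)
  have dE': "((\<lambda>h. E (z + k * h)) has_field_derivative k * (L (z + k * h) * E (z + k * h))) (at h)"
    if "z + k * h \<in> U" for z k h
    using DERIV_chain'[OF dlin dE[OF that]] by (simp add: mult.commute)
  have dL: "((\<lambda>h. f (z + k * h)) has_field_derivative k * deriv f (z + k * h)) (at h)"
    if "z + k * h \<in> U" "f holomorphic_on U" for z k h f
    using DERIV_chain'[OF dlin holomorphic_derivI[OF that(2) U(1) that(1)]] by (simp add: mult.commute)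
  have LL0: "deriv (deriv L) z = 0" if z: "z \<in> U" for z
  proof -
    obtain r where r: "r > 0" "ball z r \<subseteq> U" using z U(1) openE by blast
    \<comment> \<open>The radius r / 3 keeps z + 3h inside the ball around \<open>z\<close>.\<close>
    define V where "V = ball (0::complex) (r / 3)"
    have V: "open V" "0 \<in> V" using r by (auto simp: V_def)
    have inU: "z + h \<in> U" "z + 2 * h \<in> U" "z + 3 * h \<in> U" if "h \<in> V" for h
    proof -
      have "3 * norm h < r" using that by (simp add: V_def)
      then have "norm h < r" "norm (2 * h) < r" "norm (3 * h) < r"
        using norm_ge_zero[of h] norm_mult[of 2 h] norm_mult[of 3 h] by (simp_all del: norm_ge_zero)
      then show "z + h \<in> U" "z + 2 * h \<in> U" "z + 3 * h \<in> U"
        by (auto simp: dist_norm norm_minus_commute intro!: subsetD[OF r(2)])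
    qed
    have 1: "L (z + 3 * h) + L (z + 1 * h) = 2 * L (z + 2 * h)" if h: "h \<in> V" for h
    proof -
      have i: "z + 3 * h \<in> U" "z + 1 * h \<in> U" "z + 2 * h \<in> U" using inU[OF h] by auto
      note [derivative_intros] = dE'[OF i(1)] dE'[OF i(2)] dE'[OF i(3)]
      have "((\<lambda>h. E (z + 3 * h) * E (z + 1 * h) ^ 3) has_field_derivative
          3 * (L (z + 3 * h) + L (z + 1 * h)) * (E (z + 3 * h) * E (z + 1 * h) ^ 3)) (at h)"
        by (rule derivative_eq_intros refl)+
           (simp add: algebra_simps power2_eq_square power3_eq_cube)
      moreover have "((\<lambda>h. E (z + 2 * h) ^ 3 * E z) has_field_derivative
          6 * L (z + 2 * h) * (E (z + 2 * h) ^ 3 * E z)) (at h)"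
        by (rule derivative_eq_intros refl)+
           (simp add: algebra_simps power2_eq_square power3_eq_cube)
      then have "((\<lambda>h. E (z + 3 * h) * E (z + 1 * h) ^ 3) has_field_derivative
          6 * L (z + 2 * h) * (E (z + 2 * h) ^ 3 * E z)) (at h)"
        by (rule has_field_derivative_transform_within_open[OF _ V(1) h]) (use diff[OF z] inU in auto)
      ultimately have "3 * (L (z + 3 * h) + L (z + 1 * h)) * (E (z + 3 * h) * E (z + 1 * h) ^ 3) =
          6 * L (z + 2 * h) * (E (z + 2 * h) ^ 3 * E z)" by (rule DERIV_unique)
      moreover have "E (z + 3 * h) * E (z + 1 * h) ^ 3 = E (z + 2 * h) ^ 3 * E z"
        using diff[OF z inU[OF h]] by simp
      moreover have "E (z + 2 * h) ^ 3 * E z \<noteq> 0" using nz[OF z] nz[OF i(3)] by simp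
      ultimately have "3 * (L (z + 3 * h) + L (z + 1 * h)) = 3 * (2 * L (z + 2 * h))" by simp
      then show ?thesis unfolding mult_cancel_left by simp
    qed
    have 2: "3 * deriv L (z + 3 * h) + deriv L (z + 1 * h) = 4 * deriv L (z + 2 * h)" if h: "h \<in> V" for h
    proof -
      have i: "z + 3 * h \<in> U" "z + 1 * h \<in> U" "z + 2 * h \<in> U" using inU[OF h] by auto
      have "((\<lambda>h. L (z + 3 * h) + L (z + 1 * h)) has_field_derivative
          3 * deriv L (z + 3 * h) + 1 * deriv L (z + 1 * h)) (at h)"
        by (intro DERIV_add dL i holL)
      moreover have "((\<lambda>h. 2 * L (z + 2 * h)) has_field_derivative 2 * (2 * deriv L (z + 2 * h))) (at h)"
        by (intro DERIV_cmult dL i holL)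
      then have "((\<lambda>h. L (z + 3 * h) + L (z + 1 * h)) has_field_derivative 2 * (2 * deriv L (z + 2 * h))) (at h)"
        by (rule has_field_derivative_transform_within_open[OF _ V(1) h]) (use 1 in auto)
      ultimately show ?thesis using DERIV_unique by fastforce
    qed
    have holdL: "deriv L holomorphic_on U" by (intro holomorphic_intros holL U)
    have i: "z + 3 * 0 \<in> U" "z + 1 * 0 \<in> U" "z + 2 * 0 \<in> U" using z by auto
    have "((\<lambda>h. 3 * deriv L (z + 3 * h) + deriv L (z + 1 * h)) has_field_derivative
        3 * (3 * deriv (deriv L) (z + 3 * 0)) + 1 * deriv (deriv L) (z + 1 * 0)) (at 0)"
      by (intro DERIV_add DERIV_cmult dL i holdL)
    moreover have "((\<lambda>h. 4 * deriv L (z + 2 * h)) has_field_derivative 4 * (2 * deriv (deriv L) (z + 2 * 0))) (at 0)"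
      by (intro DERIV_cmult dL i holdL)
    then have "((\<lambda>h. 3 * deriv L (z + 3 * h) + deriv L (z + 1 * h)) has_field_derivative
        4 * (2 * deriv (deriv L) (z + 2 * 0))) (at 0)"
      by (rule has_field_derivative_transform_within_open[OF _ V]) (use 2 in auto)
    ultimately have "3 * (3 * deriv (deriv L) (z + 3 * 0)) + 1 * deriv (deriv L) (z + 1 * 0) =
      4 * (2 * deriv (deriv L) (z + 2 * 0))" by (rule DERIV_unique)
    \<comment> \<open>At h = 0 the identity reads 10 L'' = 8 L''.\<close>
    then show ?thesis by simp
  qed
  obtain a where a: "\<And>z. z \<in> U \<Longrightarrow> deriv L z = a"
  proof -
    have "(deriv L has_field_derivative 0) (at z)" if "z \<in> U" for z
      using holomorphic_derivI[of "deriv L" U z] LL0[OF that] that U holL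
      by (auto intro!: holomorphic_intros)
    then show ?thesis using constant_if_deriv_0[OF U] that by blast
  qed
  obtain B where B: "\<And>z. z \<in> U \<Longrightarrow> L z - a * z = B"
  proof -
    have "((\<lambda>z. L z - a * z) has_field_derivative 0) (at z)" if "z \<in> U" for z
      using holomorphic_derivI[OF holL U(1) that] a[OF that]
      by (auto intro!: derivative_eq_intros)
    then show ?thesis using constant_if_deriv_0[OF U] that by blast
  qed
  obtain C where C: "\<And>z. z \<in> U \<Longrightarrow> E z * exp (- (a / 2 * z\<^sup>2 + B * z)) = C"
  proof -
    have "((\<lambda>z. E z * exp (- (a / 2 * z\<^sup>2 + B * z))) has_field_derivative 0) (at z)" if "z \<in> U" for z
    proof -
      have L: "L z = a * z + B" using B[OF that] by (simp add: algebra_simps)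
      show ?thesis
        by (rule derivative_eq_intros dE[OF that] refl)+ (simp add: L algebra_simps)
    qed
    then show ?thesis using constant_if_deriv_0[OF U] that by blast
  qed
  have "E z = C * exp (a / 2 * z\<^sup>2 + B * z)" if "z \<in> U" for z
    using C[OF that] by (auto simp: exp_minus field_simps)
  then show ?thesis by blast
qed

section \<open>Quasi-periods of sigma, zeta and wp\<close>

context weierstrass_lattice
begin

text \<open>Off \<Omega> the ratio is C exp(A z^2 + B z). Translating -(z + w) by \<open>w\<close>
  gives -z, and oddness turns this into C^2 exp(g z) = 1 on an open set; so the derivative of
  \<open>g\<close> vanishes there, and with it 4A.\<close>

lemma sigma_quasi_periodic:
  assumes w: "w \<in> \<Omega>"
  shows "\<exists>e c. \<forall>z. \<sigma> (z + w) = \<sigma> z * exp (e * z + c)"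
proof -
  define E where "E = (\<lambda>z. \<sigma> (z + w) / \<sigma> z)"
  have "\<exists>A B C. \<forall>z\<in>- \<Omega>. E z = C * exp (A * z\<^sup>2 + B * z)"
  proof (rule exp_quadratic_if_third_difference[OF open_compl connected_compl])
    show "E holomorphic_on - \<Omega>" unfolding E_def by (intro holomorphic_intros) auto
    show "E z \<noteq> 0" if "z \<in> - \<Omega>" for z
      using that w by (auto simp: E_def add_mem_iff)
    show "E (z + 3 * h) * E (z + h) ^ 3 = E (z + 2 * h) ^ 3 * E z"
      if "z \<in> - \<Omega>" "z + h \<in> - \<Omega>" "z + 2 * h \<in> - \<Omega>" "z + 3 * h \<in> - \<Omega>" for z h
      using sigma_shift_ratio_third_difference[OF w, of z h] that unfolding E_def by simp
  qed
  then obtain A B C where ABC: "\<And>z. z \<notin> \<Omega> \<Longrightarrow> E z = C * exp (A * z\<^sup>2 + B * z)" by auto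
  have shift: "\<sigma> (z + w) = \<sigma> z * (C * exp (A * z\<^sup>2 + B * z))" for z
  proof (cases "z \<in> \<Omega>")
    case True
    \<comment> \<open>At a lattice point both sides vanish, whatever the exponential.\<close>
    then have "\<sigma> z = 0" "\<sigma> (z + w) = 0" using w by (simp_all add: add_mem)
    then show ?thesis by (simp only: mult_zero_left)
  next
    case False
    then show ?thesis using ABC[OF False] by (simp add: E_def field_simps)
  qed
  have "C \<noteq> 0" using ABC[of "\<omega>1 / 2"] half_periods w add_mem_iff[of w "\<omega>1 / 2"] by (auto simp: E_def)
  define g where "g = (\<lambda>z. A * z\<^sup>2 + A * (z + w)\<^sup>2 - B * w)"
  have one: "C\<^sup>2 * exp (g z) = 1" if z: "z \<notin> \<Omega>" for z
  proof -
    have "- \<sigma> z = \<sigma> (- (z + w) + w)" by (simp add: sigma_minus)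
    also have "\<dots> = \<sigma> (- (z + w)) * (C * exp (A * (z + w)\<^sup>2 - B * (z + w)))"
      unfolding shift[of "- (z + w)"]
      by (simp only: power2_minus mult_minus_right diff_conv_add_uminus)
    also have "\<dots> = - (\<sigma> z * (C\<^sup>2 * exp (g z)))"
      unfolding sigma_minus shift g_def
      by (simp add: power2_eq_square algebra_simps flip: exp_add)
    finally show ?thesis using z by simp
  qed
  have g': "2 * A * z + 2 * A * (z + w) = 0" if z: "z \<in> - \<Omega>" for z
  proof -
    have "((\<lambda>z. C\<^sup>2 * exp (g z)) has_field_derivative C\<^sup>2 * exp (g z) * (2 * A * z + 2 * A * (z + w))) (at z)"
      unfolding g_def by (rule derivative_eq_intros refl)+ (simp add: algebra_simps)
    moreover have "((\<lambda>z. C\<^sup>2 * exp (g z)) has_field_derivative 0) (at z)"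
      by (rule has_field_derivative_transform_within_open[OF DERIV_const open_compl z, of 1]) (simp add: one)
    ultimately have "C\<^sup>2 * exp (g z) * (2 * A * z + 2 * A * (z + w)) = 0" by (rule DERIV_unique)
    then show ?thesis using \<open>C \<noteq> 0\<close> by simp
  qed
  have h: "\<omega>1 / 2 \<in> - \<Omega>" using half_periods by auto
  have "((\<lambda>z. 2 * A * z + 2 * A * (z + w)) has_field_derivative 4 * A) (at (\<omega>1 / 2))"
    by (rule derivative_eq_intros refl)+ simp
  moreover have "((\<lambda>z. 2 * A * z + 2 * A * (z + w)) has_field_derivative 0) (at (\<omega>1 / 2))"
    by (rule has_field_derivative_transform_within_open[OF DERIV_const open_compl h, of 0]) (simp add: g')
  ultimately have "4 * A = 0" by (rule DERIV_unique)
  then have "\<sigma> (z + w) = \<sigma> z * exp (B * z + Ln C)" for z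
    using shift[of z] \<open>C \<noteq> 0\<close> by (simp add: exp_add)
  then show ?thesis by blast
qed

text \<open>The quasi-period of \<zeta>. The choice alone does not make it additive;
  \<open>zeta_plus\<close> identifies it as a difference of values of \<zeta>, from which additivity
  follows.\<close>

definition eta :: "complex \<Rightarrow> complex" where
  "eta w = (SOME e. \<exists>c. \<forall>z. \<sigma> (z + w) = \<sigma> z * exp (e * z + c))"

lemma sigma_plus:
  assumes "w \<in> \<Omega>"
  shows "\<exists>c. \<forall>z. \<sigma> (z + w) = \<sigma> z * exp (eta w * z + c)"
  unfolding eta_def using sigma_quasi_periodic[OF assms] by (rule someI_ex)

lemma zeta_holomorphic: "A \<inter> \<Omega> = {} \<Longrightarrow> \<zeta> holomorphic_on A"
proof -
  assume A: "A \<inter> \<Omega> = {}"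
  have "deriv \<sigma> holomorphic_on UNIV" by (intro holomorphic_intros) auto
  then have "deriv \<sigma> holomorphic_on A" by (rule holomorphic_on_subset) auto
  then show ?thesis unfolding weierstrass_zeta_def
    using A by (intro holomorphic_on_divide sigma_holomorphic) auto
qed

lemma wp_holomorphic: "A \<inter> \<Omega> = {} \<Longrightarrow> wp holomorphic_on A"
proof -
  assume A: "A \<inter> \<Omega> = {}"
  have "wp holomorphic_on - \<Omega>" unfolding weierstrass_wp_def
    by (intro holomorphic_intros zeta_holomorphic open_compl) auto
  then show ?thesis by (rule holomorphic_on_subset) (use A in auto)
qed

lemma zeta_plus:
  assumes w: "w \<in> \<Omega>" and z: "z \<notin> \<Omega>"
  shows "\<zeta> (z + w) = \<zeta> z + eta w"
proof -
  obtain c where c: "\<And>z. \<sigma> (z + w) = \<sigma> z * exp (eta w * z + c)" using sigma_plus[OF w] by blast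
  have d: "(\<sigma> has_field_derivative deriv \<sigma> x) (at x)" for x
    by (rule holomorphic_derivI[of _ UNIV]) (auto intro!: holomorphic_intros)
  have "((\<lambda>z. \<sigma> (z + w)) has_field_derivative deriv \<sigma> (z + w)) (at z)"
    using d[of "z + w"] by (simp add: DERIV_shift)
  moreover have "((\<lambda>z. \<sigma> z * exp (eta w * z + c)) has_field_derivative
      (deriv \<sigma> z + eta w * \<sigma> z) * exp (eta w * z + c)) (at z)"
    by (rule derivative_eq_intros d refl)+ (simp add: algebra_simps)
  ultimately have "deriv \<sigma> (z + w) = (deriv \<sigma> z + eta w * \<sigma> z) * exp (eta w * z + c)"
    unfolding c[symmetric] by (rule DERIV_unique)
  then have "\<zeta> (z + w) = ((deriv \<sigma> z + eta w * \<sigma> z) * exp (eta w * z + c)) / (\<sigma> z * exp (eta w * z + c))"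
    by (simp only: weierstrass_zeta_def c)
  also have "\<dots> = \<zeta> z + eta w" using z by (simp add: weierstrass_zeta_def add_divide_distrib)
  finally show ?thesis .
qed

lemma wp_plus:
  assumes w: "w \<in> \<Omega>" and z: "z \<notin> \<Omega>"
  shows "wp (z + w) = wp z"
proof -
  have z': "z + w \<notin> \<Omega>" using w z by (simp add: add_mem_iff)
  have d: "(\<zeta> has_field_derivative deriv \<zeta> x) (at x)" if "x \<notin> \<Omega>" for x
    by (rule holomorphic_derivI[OF zeta_holomorphic open_compl]) (use that in auto)
  have "((\<lambda>z. \<zeta> (z + w)) has_field_derivative deriv \<zeta> (z + w)) (at z)"
    using d[OF z'] by (simp add: DERIV_shift)
  moreover have "((\<lambda>z. \<zeta> z + eta w) has_field_derivative deriv \<zeta> z + 0) (at z)"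
    by (intro DERIV_add d[OF z] DERIV_const)
  then have "((\<lambda>z. \<zeta> (z + w)) has_field_derivative deriv \<zeta> z + 0) (at z)"
    by (rule has_field_derivative_transform_within_open[OF _ open_compl])
       (use z w zeta_plus in auto)
  ultimately have "deriv \<zeta> (z + w) = deriv \<zeta> z + 0" by (rule DERIV_unique)
  then show ?thesis by (simp add: weierstrass_wp_def)
qed

lemma eta_add:
  assumes "v \<in> \<Omega>" "w \<in> \<Omega>"
  shows "eta (v + w) = eta v + eta w"
proof -
  let ?z = "\<omega>1 / 2"
  have "?z \<notin> \<Omega>" "?z + v \<notin> \<Omega>" using half_periods assms by (auto simp: add_mem_iff)
  then have "\<zeta> ?z + eta (v + w) = \<zeta> ?z + eta v + eta w"
    using zeta_plus[of "v + w" ?z] zeta_plus[of v ?z] zeta_plus[of w "?z + v"] assms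
    by (simp add: add_mem add.assoc)
  then show ?thesis by simp
qed

lemma eta_of_int:
  assumes "w \<in> \<Omega>"
  shows "eta (of_int k * w) = of_int k * eta w"
proof -
  have e0: "eta 0 = 0" using eta_add[of 0 0] by simp
  have em: "eta (- v) = - eta v" if "v \<in> \<Omega>" for v
    using eta_add[of v "- v"] that e0 by (simp add: eq_neg_iff_add_eq_0 add.commute)
  have nat: "eta (of_nat n * w) = of_nat n * eta w" for n
  proof (induction n)
    case (Suc n)
    have "of_nat n * w \<in> \<Omega>" using of_int_mult_mem[OF assms, of "int n"] by simp
    then have "eta (of_nat n * w + w) = of_nat n * eta w + eta w" using assms Suc by (simp add: eta_add)
    then show ?case by (simp add: algebra_simps)
  qed (simp add: e0)
  show ?thesis
  proof (cases k rule: int_cases2)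
    case (nonneg n)
    then show ?thesis using nat by simp
  next
    case (nonpos n)
    have "of_nat n * w \<in> \<Omega>" using of_int_mult_mem[OF assms, of "int n"] by simp
    then show ?thesis using nat[of n] em[of "of_nat n * w"] nonpos by simp
  qed
qed

lemma eta_lattice: "eta (of_int m * \<omega>1 + of_int n * \<omega>2) = of_int m * eta \<omega>1 + of_int n * eta \<omega>2"
  by (simp add: eta_add eta_of_int of_int_mult_mem)

end

section \<open>Elliptic functions\<close>

text \<open>Riemann's removable singularity theorem applies in each ball \<open>ball p d\<close>,
  which meets \<open>S\<close> only in its centre; the local extensions agree with \<open>f\<close>
  elsewhere and hence glue.\<close>

lemma extend_over_separated_set:
  fixes f :: "complex \<Rightarrow> complex"
  assumes d: "d > 0" "\<And>x y. x \<in> S \<Longrightarrow> y \<in> S \<Longrightarrow> dist x y < d \<Longrightarrow> x = y"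
    and hol: "f holomorphic_on - S"
    and bdd: "\<And>p. p \<in> S \<Longrightarrow> \<exists>B. \<forall>\<^sub>F z in at p. norm (f z) \<le> B"
  shows "\<exists>g. g holomorphic_on UNIV \<and> (\<forall>z. z \<notin> S \<longrightarrow> g z = f z)"
proof -
  have op: "open (- S)"
    using discrete_imp_closed[OF d(1), of S] d(2) by (auto simp: dist_commute)
  have ex: "\<exists>g. g holomorphic_on ball p d \<and> (\<forall>z\<in>ball p d - {p}. g z = f z)" if "p \<in> S" for p
  proof (subst holomorphic_on_extend_bounded)
    show "f holomorphic_on ball p d - {p}"
      by (rule holomorphic_on_subset[OF hol]) (use d(2)[OF that] in force)
  qed (use d(1) bdd[OF that] in auto)
  then obtain G where G: "\<And>p. p \<in> S \<Longrightarrow> G p holomorphic_on ball p d"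
    "\<And>p z. p \<in> S \<Longrightarrow> z \<in> ball p d \<Longrightarrow> z \<noteq> p \<Longrightarrow> G p z = f z" by (metis DiffI singletonD)
  define g where "g z = (if z \<in> S then G z z else f z)" for z
  have "g field_differentiable (at z)" for z
  proof (cases "z \<in> S")
    case True
    have "g holomorphic_on ball z d"
      by (rule holomorphic_transform[OF G(1)[OF True]])
         (use True G(2)[OF True] d(2)[OF True] in \<open>force simp: g_def\<close>)
    then show ?thesis using d(1) by (intro holomorphic_on_imp_differentiable_at[of g "ball z d"]) auto
  next
    case False
    have "g holomorphic_on - S" by (rule holomorphic_transform[OF hol]) (auto simp: g_def)
    then show ?thesis using False op by (intro holomorphic_on_imp_differentiable_at[of g "- S"]) auto
  qed
  then have "g holomorphic_on UNIV"
    unfolding holomorphic_on_def using field_differentiable_at_within by blast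
  then show ?thesis by (intro exI[of _ g]) (auto simp: g_def)
qed

section \<open>Elliptic functions without poles or with one simple pole\<close>

context weierstrass_lattice
begin

lemma real_coordinates: "\<exists>x y. z = of_real x * \<omega>1 + of_real y * \<omega>2"
proof -
  define D where "D = Im (\<omega>2 * cnj \<omega>1)"
  have D: "D \<noteq> 0" using Im_nonzero by (simp add: D_def)
  have eq: "of_real D * z = of_real (- Im (z * cnj \<omega>2)) * \<omega>1 + of_real (Im (z * cnj \<omega>1)) * \<omega>2"
    by (simp add: D_def complex_eq_iff algebra_simps)
  have "z = (of_real D * z) / of_real D" using D by simp
  also have "\<dots> = of_real (- Im (z * cnj \<omega>2) / D) * \<omega>1 + of_real (Im (z * cnj \<omega>1) / D) * \<omega>2"
    unfolding eq add_divide_distrib of_real_divide by simp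
  finally have "z = of_real (- Im (z * cnj \<omega>2) / D) * \<omega>1 + of_real (Im (z * cnj \<omega>1) / D) * \<omega>2" .
  then show ?thesis by blast
qed

text \<open>The exceptional set \<open>S\<close>, where values are arbitrary, is stable under
  periods, so walking along periods stays outside it. A negative multiple is handled by walking back
  up from the translated point.\<close>

lemma periodic_lattice:
  assumes p: "\<And>z. z \<notin> S \<Longrightarrow> f (z + \<omega>1) = f z" "\<And>z. z \<notin> S \<Longrightarrow> f (z + \<omega>2) = f z"
    and S: "\<And>z w. w \<in> \<Omega> \<Longrightarrow> z + w \<in> S \<longleftrightarrow> z \<in> S"
    and "w \<in> \<Omega>" "z \<notin> S"
  shows "f (z + w) = f z"
proof -
  have nat: "f (z + of_nat n * v) = f z" if "z \<notin> S" "v \<in> \<Omega>" "\<And>z. z \<notin> S \<Longrightarrow> f (z + v) = f z" for n v z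
  proof (induction n)
    case (Suc n)
    have "z + of_nat n * v \<notin> S" using S[of "of_nat n * v" z] of_int_mult_mem[of v "int n"] that by simp
    from that(3)[OF this] show ?case using Suc by (simp add: algebra_simps)
  qed simp
  have int: "f (z + of_int n * v) = f z" if "z \<notin> S" "v \<in> \<Omega>" "\<And>z. z \<notin> S \<Longrightarrow> f (z + v) = f z" for n v z
  proof (cases n rule: int_cases2)
    case (nonneg k)
    then show ?thesis using nat[OF that] by simp
  next
    case (nonpos k)
    have "z - of_nat k * v \<notin> S" using S[of "- (of_nat k * v)" z] of_int_mult_mem[of v "- int k"] that by simp
    from nat[OF this that(2,3), of k] show ?thesis using nonpos by simp
  qed
  obtain m n where w: "w = of_int m * \<omega>1 + of_int n * \<omega>2" using assms by (auto simp: mem_iff)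
  have "z + of_int m * \<omega>1 \<notin> S" using S[of "of_int m * \<omega>1" z] assms by (simp add: of_int_mult_mem)
  then have "f (z + of_int m * \<omega>1 + of_int n * \<omega>2) = f (z + of_int m * \<omega>1)" by (intro int p) auto
  also have "\<dots> = f z" by (intro int p assms) auto
  finally show ?thesis by (simp add: w add.assoc)
qed

text \<open>A period parallelogram is compact and already yields all values, so Liouville's theorem
  applies.\<close>

lemma entire_elliptic_constant:
  assumes hol: "f holomorphic_on UNIV"
    and p: "\<And>z. f (z + \<omega>1) = f z" "\<And>z. f (z + \<omega>2) = f z"
  shows "\<exists>c. \<forall>z. f z = c"
proof -
  define K where "K = (\<lambda>(x, y). complex_of_real x * \<omega>1 + of_real y * \<omega>2) ` ({0..1} \<times> {0..1})"
  have "compact K" unfolding K_def split_beta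
    by (intro compact_continuous_image compact_Times continuous_intros) auto
  then have "compact (f ` K)"
    using hol by (intro compact_continuous_image holomorphic_on_imp_continuous_on)
      (auto intro: holomorphic_on_subset)
  moreover have "range f \<subseteq> f ` K"
  proof safe
    fix z
    obtain x y where z: "z = of_real x * \<omega>1 + of_real y * \<omega>2" using real_coordinates by blast
    define w where "w = of_int \<lfloor>x\<rfloor> * \<omega>1 + of_int \<lfloor>y\<rfloor> * \<omega>2"
    have "w \<in> \<Omega>" by (auto simp: w_def mem_iff)
    then have "f z = f (z - w)"
      using periodic_lattice[of "{}" f w "z - w"] p by simp
    moreover have "z - w = of_real (frac x) * \<omega>1 + of_real (frac y) * \<omega>2"
      by (simp add: z w_def frac_def algebra_simps)
    moreover have "(frac x, frac y) \<in> {0..1} \<times> {0..1}" using frac_lt_1[of x] frac_lt_1[of y] by simp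
    then have "of_real (frac x) * \<omega>1 + of_real (frac y) * \<omega>2 \<in> K" unfolding K_def by force
    ultimately have "f z = f (z - w)" "z - w \<in> K" by auto
    then show "f z \<in> f ` K" by blast
  qed
  ultimately have "bounded (range f)" using compact_imp_bounded bounded_subset by blast
  with hol have "f constant_on UNIV" by (rule Liouville_theorem)
  then show ?thesis by (simp add: constant_on_def)
qed

text \<open>Boundedness is checked near one representative \<open>q\<close> of each class of
  \<open>S\<close> modulo \<Omega>; periodicity carries the bound to the other points, and all
  singularities become removable.\<close>

lemma elliptic_bounded_constant:
  assumes d: "d > 0" "\<And>x y. x \<in> S \<Longrightarrow> y \<in> S \<Longrightarrow> dist x y < d \<Longrightarrow> x = y"
    and S: "\<And>z w. w \<in> \<Omega> \<Longrightarrow> z + w \<in> S \<longleftrightarrow> z \<in> S"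
    and hol: "f holomorphic_on - S"
    and p: "\<And>z. z \<notin> S \<Longrightarrow> f (z + \<omega>1) = f z" "\<And>z. z \<notin> S \<Longrightarrow> f (z + \<omega>2) = f z"
    and bdd: "\<And>p. p \<in> S \<Longrightarrow> \<exists>q w B. w \<in> \<Omega> \<and> p = q + w \<and> (\<forall>\<^sub>F z in at q. norm (f z) \<le> B)"
  shows "\<exists>c. \<forall>z. z \<notin> S \<longrightarrow> f z = c"
proof (cases "- S = {}")
  case True
  then show ?thesis by auto
next
  case False
  have op: "open (- S)"
    using discrete_imp_closed[OF d(1), of S] d(2) by (auto simp: dist_commute)
  have "\<exists>B. \<forall>\<^sub>F z in at p. norm (f z) \<le> B" if pS: "p \<in> S" for p
  proof -
    obtain q w B where q: "w \<in> \<Omega>" "p = q + w" "\<forall>\<^sub>F z in at q. norm (f z) \<le> B"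
      using bdd[OF pS] by blast
    have qS: "q \<in> S" using S[OF q(1), of q] pS q(2) by simp
    from q(3) obtain e where e: "e > 0" "\<And>z. z \<noteq> q \<Longrightarrow> dist z q < e \<Longrightarrow> norm (f z) \<le> B"
      unfolding eventually_at by blast
    \<comment> \<open>Closer than \<open>d\<close> to \<open>q\<close> there is no other point of
      \<open>S\<close>, so periodicity is available at z - w.\<close>
    have "norm (f z) \<le> B" if "z \<noteq> p" "dist z p < min d e" for z
    proof -
      have z: "z - w \<noteq> q" "dist (z - w) q < d" "dist (z - w) q < e"
        using that q(2) by (auto simp: dist_norm algebra_simps)
      then have "z - w \<notin> S" using d(2)[OF _ qS] by blast
      then have "f (z - w + w) = f (z - w)" by (intro periodic_lattice[OF p S] q)
      then show ?thesis using e(2)[OF z(1,3)] by simp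
    qed
    then have "\<forall>\<^sub>F z in at p. norm (f z) \<le> B"
      unfolding eventually_at using d(1) e(1) by (intro exI[of _ "min d e"]) auto
    then show ?thesis by blast
  qed
  from extend_over_separated_set[OF d hol this]
  obtain g where g: "g holomorphic_on UNIV" "\<And>z. z \<notin> S \<Longrightarrow> g z = f z" by auto
  have per: "g (z + w) = g z" if w: "w \<in> \<Omega>" "\<And>z. z \<notin> S \<Longrightarrow> f (z + w) = f z" for z w
  proof (rule analytic_continuation_open[of "- S" UNIV "\<lambda>z. g (z + w)" g])
    have "g \<circ> (\<lambda>z. z + w) holomorphic_on UNIV"
      by (rule holomorphic_on_compose) (auto intro!: holomorphic_intros holomorphic_on_subset[OF g(1)])
    then show "(\<lambda>z. g (z + w)) holomorphic_on UNIV" by (simp add: o_def)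
    show "g (z + w) = g z" if "z \<in> - S" for z
      using that g(2)[of z] g(2)[of "z + w"] S[OF w(1)] w(2) by simp
  qed (use op False g in auto)
  have "\<exists>c. \<forall>z. g z = c" by (rule entire_elliptic_constant[OF g(1)]) (auto intro!: per p)
  then show ?thesis using g(2) by metis
qed

lemma sigma_0 [simp]: "\<sigma> 0 = 0"
  by (subst sigma_eq_0_iff) simp

lemma deriv_sigma: "(\<sigma> has_field_derivative deriv \<sigma> x) (at x)"
  by (rule holomorphic_derivI[of _ UNIV]) (auto intro!: holomorphic_intros)

lemma tendsto_imp_bounded_at:
  fixes f :: "complex \<Rightarrow> complex"
  assumes "(f \<longlongrightarrow> c) (at p)"
  shows "\<exists>B. \<forall>\<^sub>F z in at p. norm (f z) \<le> B"
proof -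
  have "\<forall>\<^sub>F z in at p. norm (f z) < norm c + 1"
    using tendsto_norm[OF assms] by (rule order_tendstoD) simp
  then show ?thesis by (intro exI[of _ "norm c + 1"]) (auto elim: eventually_mono)
qed

lemma ratio_bounded_at:
  assumes "open U" "N holomorphic_on U" "p \<in> U" "N p = 0"
  shows "\<exists>B. \<forall>\<^sub>F z in at p. norm (N z / \<sigma> (z - p)) \<le> B"
proof (rule tendsto_imp_bounded_at)
  have "((\<lambda>z. z - p) has_field_derivative 1) (at p)" by (auto intro!: derivative_eq_intros)
  from DERIV_chain'[OF this deriv_sigma]
  have s: "((\<lambda>z. \<sigma> (z - p)) has_field_derivative deriv \<sigma> 0) (at p)" by simp
  show "((\<lambda>z. N z / \<sigma> (z - p)) \<longlongrightarrow> deriv N p / deriv \<sigma> 0) (at p)"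
    by (rule lhopital_complex_simple[OF holomorphic_derivI[OF assms(2,1,3)] s])
       (use assms deriv_sigma_0 in auto)
qed

text \<open>
  The even part of \<open>F\<close> has no pole, so one may assume that \<open>F\<close> is odd; then \<open>F\<close> vanishes at the half
  periods, and the product of \<open>F\<close> with its translate by \<open>\<omega>1 / 2\<close> has no poles and a zero. This replaces
  the residue theorem on a period parallelogram.
\<close>

lemma elliptic_simple_pole_constant:
  assumes H: "H holomorphic_on UNIV" and F: "\<And>z. z \<notin> \<Omega> \<Longrightarrow> F z = H z / \<sigma> z"
    and p: "\<And>z. z \<notin> \<Omega> \<Longrightarrow> F (z + \<omega>1) = F z" "\<And>z. z \<notin> \<Omega> \<Longrightarrow> F (z + \<omega>2) = F z"
  shows "\<exists>c. \<forall>z. z \<notin> \<Omega> \<longrightarrow> F z = c"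
proof -
  obtain d where d: "d > 0" "\<And>w. w \<in> \<Omega> \<Longrightarrow> w \<noteq> 0 \<Longrightarrow> d \<le> norm w" using separated by blast
  have sep: "x = y" if "x \<in> \<Omega>" "y \<in> \<Omega>" "dist x y < d" for x y
    using d(2)[of "x - y"] diff_mem[of x y] that by (force simp: dist_norm)
  have comp: "(\<lambda>z. H (g z)) holomorphic_on A" if "g holomorphic_on A" for g A
    using holomorphic_on_compose[OF that holomorphic_on_subset[OF H]] by (simp add: o_def)
  have pF: "F (z + w) = F z" if "w \<in> \<Omega>" "z \<notin> \<Omega>" for z w
    by (rule periodic_lattice[OF p]) (use that add_mem_iff in auto)
  \<comment> \<open>As \<sigma> is odd, this quotient is F(z) + F(-z); its numerator vanishes at 0,
    which removes the pole.\<close>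
  have "\<exists>c. \<forall>z. z \<notin> \<Omega> \<longrightarrow> (H z - H (- z)) / \<sigma> z = c"
  proof (rule elliptic_bounded_constant[OF d(1) sep])
    show "(\<lambda>z. (H z - H (- z)) / \<sigma> z) holomorphic_on - \<Omega>"
      by (intro holomorphic_intros comp) auto
    have eq: "(H z - H (- z)) / \<sigma> z = F z + F (- z)" if "z \<notin> \<Omega>" for z
      using F[of z] F[of "- z"] that by (simp add: sigma_minus diff_divide_distrib)
    have "F (- (z + w)) = F (- z)" if "w \<in> \<Omega>" "z \<notin> \<Omega>" for z w
      using pF[of "- w" "- z"] that by simp
    then show "(H (z + \<omega>1) - H (- (z + \<omega>1))) / \<sigma> (z + \<omega>1) = (H z - H (- z)) / \<sigma> z"
      "(H (z + \<omega>2) - H (- (z + \<omega>2))) / \<sigma> (z + \<omega>2) = (H z - H (- z)) / \<sigma> z" if "z \<notin> \<Omega>" for z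
      using that pF eq[of "z + \<omega>1"] eq[of "z + \<omega>2"] eq[of z] by (simp_all add: add_mem_iff)
    show "\<exists>q w B. w \<in> \<Omega> \<and> p = q + w \<and> (\<forall>\<^sub>F z in at q. norm ((H z - H (- z)) / \<sigma> z) \<le> B)"
      if "p \<in> \<Omega>" for p
    proof -
      have "(\<lambda>z. H z - H (- z)) holomorphic_on UNIV" by (intro holomorphic_intros comp)
      from ratio_bounded_at[OF open_UNIV this, of 0] obtain B where
        "\<forall>\<^sub>F z in at 0. norm ((H z - H (- z)) / \<sigma> z) \<le> B" by auto
      then show ?thesis using that by (intro exI[of _ 0] exI[of _ p] exI[of _ B]) simp
    qed
  qed (auto simp: add_mem_iff)
  then obtain c where "\<And>z. z \<notin> \<Omega> \<Longrightarrow> (H z - H (- z)) / \<sigma> z = c" by blast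
  \<comment> \<open>The constant is halved so that F - k becomes odd.\<close>
  then obtain k where k: "\<And>z. z \<notin> \<Omega> \<Longrightarrow> (H z - H (- z)) / \<sigma> z = 2 * k" using that[of "c / 2"] by simp
  define f where "f z = F z - k" for z
  define H' where "H' z = H z - k * \<sigma> z" for z
  have holH': "(\<lambda>z. H' (g z)) holomorphic_on A" if "g holomorphic_on A" for g A
    unfolding H'_def using that by (intro holomorphic_intros comp)
  have fH: "f z = H' z / \<sigma> z" if "z \<notin> \<Omega>" for z
    using F that by (simp add: f_def H'_def diff_divide_distrib)
  have holf: "f holomorphic_on - \<Omega>"
  proof (rule holomorphic_transform)
    show "(\<lambda>z. H' z / \<sigma> z) holomorphic_on - \<Omega>" by (intro holomorphic_intros holH') auto
  qed (use fH in auto)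
  have holf': "(\<lambda>z. f (z + v)) holomorphic_on A" if "(\<lambda>z. z + v) ` A \<subseteq> - \<Omega>" for A v
  proof -
    have "f \<circ> (\<lambda>z. z + v) holomorphic_on A"
      by (rule holomorphic_on_compose) (auto intro!: holomorphic_intros holomorphic_on_subset[OF holf that])
    then show ?thesis by (simp add: o_def)
  qed
  have odd: "f (- z) = - f z" if z: "z \<notin> \<Omega>" for z
  proof -
    have "F z + F (- z) = 2 * k"
      using k[OF z] F[of z] F[of "- z"] z by (simp add: sigma_minus diff_divide_distrib)
    then show ?thesis by (simp add: f_def algebra_simps eq_neg_iff_add_eq_0)
  qed
  have pf: "f (z + w) = f z" if "w \<in> \<Omega>" "z \<notin> \<Omega>" for z w using pF that by (simp add: f_def)
  \<comment> \<open>At a half period, periodicity gives f(w/2) = f(-w/2) and oddness gives the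
    opposite sign.\<close>
  have half: "f (w / 2) = 0" "f (- (w / 2)) = 0" if w: "w \<in> \<Omega>" "w / 2 \<notin> \<Omega>" for w
  proof -
    have "f (w / 2) = f (- (w / 2) + w)" by simp
    also have "\<dots> = f (- (w / 2))" by (rule pf) (use w uminus_mem_iff[of "w / 2"] in auto)
    also have "\<dots> = - f (w / 2)" using odd w by blast
    finally show "f (w / 2) = 0" by simp
    then show "f (- (w / 2)) = 0" using odd w by simp
  qed
  \<comment> \<open>The possible poles of f(z) f(z + \<omega>1/2).\<close>
  define S where "S = {z. z \<in> \<Omega> \<or> z + \<omega>1 / 2 \<in> \<Omega>}"
  have Sinv: "z + w \<in> S \<longleftrightarrow> z \<in> S" if "w \<in> \<Omega>" for z w
    using add_mem_iff[OF that, of z] add_mem_iff[OF that, of "z + \<omega>1 / 2"] by (auto simp: S_def algebra_simps)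
  \<comment> \<open>Doubling sends \<open>S\<close> into \<Omega>, so points of \<open>S\<close> are
    at least d / 2 apart.\<close>
  have Ssep: "x = y" if xy: "x \<in> S" "y \<in> S" "dist x y < d / 2" for x y
  proof -
    have "2 * x \<in> \<Omega>" "2 * y \<in> \<Omega>"
      using xy(1,2) add_mem[of x x] add_mem[of y y] add_mem[of "x + \<omega>1 / 2" "x + \<omega>1 / 2"]
        add_mem[of "y + \<omega>1 / 2" "y + \<omega>1 / 2"] add_mem_iff[of \<omega>1 "2 * x"] add_mem_iff[of \<omega>1 "2 * y"]
      by (auto simp: S_def algebra_simps)
    moreover have "dist (2 * x) (2 * y) < d"
      using xy(3) norm_mult[of 2 "x - y"] by (simp add: dist_norm algebra_simps)
    ultimately show ?thesis using sep[of "2 * x" "2 * y"] by simp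
  qed
  have Sop: "open (- S)"
    using discrete_imp_closed[of "d / 2" S] d(1) Ssep by (auto simp: dist_commute)
  have "\<exists>c. \<forall>z. z \<notin> S \<longrightarrow> f z * f (z + \<omega>1 / 2) = c"
  proof (rule elliptic_bounded_constant[where S = S and d = "d / 2"])
    show "(\<lambda>z. f z * f (z + \<omega>1 / 2)) holomorphic_on - S"
      by (intro holomorphic_intros holf' holomorphic_on_subset[OF holf]) (auto simp: S_def)
    show "f (z + \<omega>1) * f (z + \<omega>1 + \<omega>1 / 2) = f z * f (z + \<omega>1 / 2)"
      "f (z + \<omega>2) * f (z + \<omega>2 + \<omega>1 / 2) = f z * f (z + \<omega>1 / 2)" if "z \<notin> S" for z
      using pf[of \<omega>1 z] pf[of \<omega>1 "z + \<omega>1 / 2"] pf[of \<omega>2 z] pf[of \<omega>2 "z + \<omega>1 / 2"] that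
      by (auto simp: S_def add_ac)
    define U where "U = (\<lambda>z. z + \<omega>1 / 2) -` (- \<Omega>)"
    have U: "open U" unfolding U_def by (intro open_vimage open_compl continuous_intros)
    \<comment> \<open>At 0 the pole of the first factor meets the zero of the second, which is
      evaluated at \<omega>1/2; at -\<omega>1/2 the roles are exchanged.\<close>
    have "\<exists>B. \<forall>\<^sub>F z in at 0. norm (H' z * f (z + \<omega>1 / 2) / \<sigma> (z - 0)) \<le> B"
      by (rule ratio_bounded_at[OF U])
         (use half_periods half[of \<omega>1] in \<open>auto intro!: holomorphic_intros holH' holf' simp: U_def\<close>)
    then obtain B where B: "\<forall>\<^sub>F z in at 0. norm (H' z * f (z + \<omega>1 / 2) / \<sigma> (z - 0)) \<le> B" by blast
    have "\<exists>B. \<forall>\<^sub>F z in at (- (\<omega>1 / 2)). norm (H' (z + \<omega>1 / 2) * f z / \<sigma> (z - - (\<omega>1 / 2))) \<le> B"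
      by (rule ratio_bounded_at[OF open_compl])
         (use half_periods half[of \<omega>1] uminus_mem_iff[of "\<omega>1 / 2"] in
          \<open>auto intro!: holomorphic_intros holH' holf\<close>)
    then obtain B' where B':
      "\<forall>\<^sub>F z in at (- (\<omega>1 / 2)). norm (H' (z + \<omega>1 / 2) * f z / \<sigma> (z - - (\<omega>1 / 2))) \<le> B'" by blast
    have ev0: "\<forall>\<^sub>F z in at 0. z \<notin> \<Omega>"
      unfolding eventually_at by (intro exI[of _ d]) (use d in force)
    have "\<forall>\<^sub>F z in at (- (\<omega>1 / 2)). z + \<omega>1 / 2 \<notin> \<Omega>"
      unfolding eventually_at
    proof (intro exI[of _ d] conjI ballI impI d(1) notI)
      fix z assume "z \<noteq> - (\<omega>1 / 2) \<and> dist z (- (\<omega>1 / 2)) < d" "z + \<omega>1 / 2 \<in> \<Omega>"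
      then show False using d(2)[of "z + \<omega>1 / 2"] by (auto simp: dist_norm eq_neg_iff_add_eq_0)
    qed
    with B' have B': "\<forall>\<^sub>F z in at (- (\<omega>1 / 2)). norm (f z * f (z + \<omega>1 / 2)) \<le> B'"
      by eventually_elim (simp add: fH[of "_ + \<omega>1 / 2"] mult.commute)
    from B ev0 have B: "\<forall>\<^sub>F z in at 0. norm (f z * f (z + \<omega>1 / 2)) \<le> B"
      by eventually_elim (simp add: fH)
    show "\<exists>q w B. w \<in> \<Omega> \<and> p = q + w \<and> (\<forall>\<^sub>F z in at q. norm (f z * f (z + \<omega>1 / 2)) \<le> B)" if "p \<in> S" for p
      using that unfolding S_def
    proof (elim CollectE disjE)
      assume "p \<in> \<Omega>"
      then show ?thesis using B by (intro exI[of _ 0] exI[of _ p] exI[of _ B]) simp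
    next
      assume "p + \<omega>1 / 2 \<in> \<Omega>"
      then show ?thesis using B' by (intro exI[of _ "- (\<omega>1 / 2)"] exI[of _ "p + \<omega>1 / 2"] exI[of _ B']) simp
    qed
    show "x = y" if "x \<in> S" "y \<in> S" "dist x y < d / 2" for x y using Ssep that .
  qed (use d(1) Sinv in auto)
  then obtain c where c: "\<And>z. z \<notin> S \<Longrightarrow> f z * f (z + \<omega>1 / 2) = c" by blast
  \<comment> \<open>The point \<omega>2/2 is outside \<open>S\<close> and is a zero of
    \<open>f\<close>, so the constant is 0.\<close>
  have h2: "\<omega>2 / 2 \<notin> S" using half_periods by (auto simp: S_def add_divide_distrib add.commute)
  then have prod0: "f z * f (z + \<omega>1 / 2) = 0" if "z \<notin> S" for z
    using c[OF that] c[OF h2] half[of \<omega>2] half_periods by simp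
  have f0: "f z = 0" if V: "open V" "V \<noteq> {}" "V \<subseteq> - \<Omega>" "\<And>z. z \<in> V \<Longrightarrow> f z = 0" and z: "z \<notin> \<Omega>" for V z
    by (rule analytic_continuation_open[OF V(1) open_compl V(2) connected_compl V(3) holf, of "\<lambda>_. 0"])
       (use V z in auto)
  have "f z = 0" if z: "z \<notin> \<Omega>" for z
  proof (cases "\<forall>z\<in>- S. f z = 0")
    case True
    show ?thesis by (rule f0[of "- S"]) (use True Sop h2 z in \<open>auto simp: S_def\<close>)
  next
    case False
    \<comment> \<open>Where \<open>f\<close> is nonzero, its translate by \<omega>1/2 must vanish;
      this yields a nonempty open set of zeros of \<open>f\<close>.\<close>
    define V where "V = - S \<inter> f -` (- {0})"
    have "open V" unfolding V_def
      by (intro continuous_open_preimage holomorphic_on_imp_continuous_on holomorphic_on_subset[OF holf])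
         (use Sop in \<open>auto simp: S_def\<close>)
    then have "open ((+) (\<omega>1 / 2) ` V)" by (rule open_translation)
    then show ?thesis
    proof (rule f0)
      show "(+) (\<omega>1 / 2) ` V \<noteq> {}" using False by (auto simp: V_def)
      show "(+) (\<omega>1 / 2) ` V \<subseteq> - \<Omega>" by (auto simp: V_def S_def add.commute)
      show "f x = 0" if "x \<in> (+) (\<omega>1 / 2) ` V" for x
      proof -
        from that obtain y where y: "x = y + \<omega>1 / 2" "y \<notin> S" "f y \<noteq> 0"
          by (auto simp: V_def add.commute)
        then show ?thesis using prod0[of y] by simp
      qed
    qed (fact z)
  qed
  then show ?thesis by (auto simp: f_def)
qed

lemma entire_eq_if_eq_off_lattice:
  assumes "f holomorphic_on UNIV" "g holomorphic_on UNIV" "\<And>z. z \<notin> \<Omega> \<Longrightarrow> f z = g z"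
  shows "f z = g z"
  by (rule analytic_continuation_open[of "- \<Omega>" UNIV f g]) (use assms open_compl half_periods in auto)

text \<open>A qualitative form of Legendre's relation. If \<open>eta\<close> were multiplication by
  a constant \<open>c\<close> on the basis, \<zeta>(z) - c z would be elliptic with one simple pole
  modulo \<Omega>, hence constant, against the pole of \<zeta> at 0.\<close>

lemma eta_not_proportional: "\<omega>1 * eta \<omega>2 - \<omega>2 * eta \<omega>1 \<noteq> 0"
proof
  assume a: "\<omega>1 * eta \<omega>2 - \<omega>2 * eta \<omega>1 = 0"
  define c where "c = eta \<omega>1 / \<omega>1"
  have c: "eta \<omega>1 = c * \<omega>1" "eta \<omega>2 = c * \<omega>2"
    using a nonzero by (auto simp: c_def field_simps)
  define H where "H z = deriv \<sigma> z - c * z * \<sigma> z" for z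
  have H: "H holomorphic_on UNIV" unfolding H_def by (intro holomorphic_intros) auto
  have "\<exists>k. \<forall>z. z \<notin> \<Omega> \<longrightarrow> \<zeta> z - c * z = k"
  proof (rule elliptic_simple_pole_constant[OF H])
    show "\<zeta> z - c * z = H z / \<sigma> z" if "z \<notin> \<Omega>" for z
      using that by (simp add: H_def weierstrass_zeta_def diff_divide_distrib)
  qed (auto simp: zeta_plus c algebra_simps)
  then obtain k where k: "\<And>z. z \<notin> \<Omega> \<Longrightarrow> \<zeta> z - c * z = k" by blast
  \<comment> \<open>At 0 the left side is the nonzero derivative of \<sigma>, and the right side is
    0.\<close>
  have "H 0 = k * \<sigma> 0"
  proof (rule entire_eq_if_eq_off_lattice[OF H])
    show "H z = k * \<sigma> z" if "z \<notin> \<Omega>" for z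
      using k[OF that] that by (simp add: H_def weierstrass_zeta_def field_simps)
  qed (intro holomorphic_intros)
  then show False using deriv_sigma_0 by (simp add: H_def)
qed

lemma mem_if_character_trivial:
  assumes "exp (s * \<omega>1 + eta \<omega>1 * u) = 1" "exp (s * \<omega>2 + eta \<omega>2 * u) = 1"
  shows "u \<in> \<Omega>"
proof (rule ccontr)
  assume u: "u \<notin> \<Omega>"
  \<comment> \<open>Translation by \<open>w\<close> multiplies H / \<sigma> by exp(s w + eta(w) u),
    which is 1 for both basis periods.\<close>
  define H where "H z = \<sigma> (z + u) * exp (s * z)" for z
  have H: "H holomorphic_on UNIV" unfolding H_def by (intro holomorphic_intros)
  have "\<exists>k. \<forall>z. z \<notin> \<Omega> \<longrightarrow> H z / \<sigma> z = k"
  proof (rule elliptic_simple_pole_constant[OF H refl])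
    have "H (z + w) / \<sigma> (z + w) = H z / \<sigma> z"
      if w: "w \<in> \<Omega>" "exp (s * w + eta w * u) = 1" and z: "z \<notin> \<Omega>" for z w
    proof -
      obtain c where c: "\<And>z. \<sigma> (z + w) = \<sigma> z * exp (eta w * z + c)" using sigma_plus[OF w(1)] by blast
      have "H (z + w) = \<sigma> ((z + u) + w) * exp (s * (z + w))" by (simp add: H_def add_ac)
      also have "\<dots> = \<sigma> (z + u) * (exp (eta w * (z + u) + c) * exp (s * (z + w)))" unfolding c by simp
      also have "exp (eta w * (z + u) + c) * exp (s * (z + w)) =
          exp (s * w + eta w * u) * (exp (eta w * z + c) * exp (s * z))"
        unfolding exp_add[symmetric] by (simp add: algebra_simps)
      also have "\<dots> = exp (eta w * z + c) * exp (s * z)" using w(2) by simp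
      finally have "H (z + w) = H z * exp (eta w * z + c)" by (simp add: H_def)
      then show ?thesis by (simp add: c)
    qed
    then show "H (z + \<omega>1) / \<sigma> (z + \<omega>1) = H z / \<sigma> z" "H (z + \<omega>2) / \<sigma> (z + \<omega>2) = H z / \<sigma> z"
      if "z \<notin> \<Omega>" for z using that assms by auto
  qed
  then obtain k where k: "\<And>z. z \<notin> \<Omega> \<Longrightarrow> H z / \<sigma> z = k" by blast
  \<comment> \<open>The numerator vanishes at -u, which is off \<Omega>.\<close>
  have "k = 0" using k[of "- u"] u by (simp add: H_def)
  then have "H z = 0" if "z \<notin> \<Omega>" for z using k[OF that] that by simp
  from entire_eq_if_eq_off_lattice[OF H holomorphic_on_const this] have "H (\<omega>1 / 2 - u) = 0" .
  then show False using half_periods by (simp add: H_def)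
qed

end

section \<open>Functions with exponential multipliers\<close>

text \<open>Holomorphic functions on a connected open set have no zero divisors: \<open>f\<close>
  vanishes on the open set where \<open>g\<close> does not, and analytic continuation does the
  rest.\<close>

lemma holomorphic_mult_eq_0:
  fixes f g :: "complex \<Rightarrow> complex"
  assumes D: "open D" "connected D" and f: "f holomorphic_on D" and g: "g holomorphic_on D"
    and prod: "\<And>z. z \<in> D \<Longrightarrow> f z * g z = 0" and z0: "z0 \<in> D" "g z0 \<noteq> 0" and z: "z \<in> D"
  shows "f z = 0"
proof -
  define V where "V = D \<inter> g -` (- {0})"
  have "open V" unfolding V_def
    by (intro continuous_open_preimage holomorphic_on_imp_continuous_on g D) auto
  then show ?thesis
    by (rule analytic_continuation_open[of V D f "\<lambda>_. 0"])
       (use D f z z0 prod in \<open>auto simp: V_def\<close>)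
qed

text \<open>The quotient F / G is constant near \<open>z0\<close>; analytic continuation of F = k G
  then passes over the zeros of \<open>G\<close>.\<close>

lemma proportional_if_wronskian_0:
  fixes F G :: "complex \<Rightarrow> complex"
  assumes D: "open D" "connected D" and F: "F holomorphic_on D" and G: "G holomorphic_on D"
    and wr: "\<And>z. z \<in> D \<Longrightarrow> deriv F z * G z = F z * deriv G z" and z0: "z0 \<in> D" "G z0 \<noteq> 0"
  shows "\<exists>k. \<forall>z\<in>D. F z = k * G z"
proof -
  define V where "V = D \<inter> G -` (- {0})"
  have "open V" unfolding V_def
    by (intro continuous_open_preimage holomorphic_on_imp_continuous_on G D) auto
  then obtain r where r: "r > 0" "ball z0 r \<subseteq> V" using z0 openE[of V z0] by (auto simp: V_def)
  have "((\<lambda>z. F z / G z) has_field_derivative 0) (at z)" if "z \<in> ball z0 r" for z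
  proof -
    have z: "z \<in> D" "G z \<noteq> 0" using that r by (auto simp: V_def)
    have "((\<lambda>z. F z / G z) has_field_derivative (deriv F z * G z - F z * deriv G z) / (G z * G z)) (at z)"
      by (intro DERIV_divide holomorphic_derivI[OF F D(1)] holomorphic_derivI[OF G D(1)] z)
    then show ?thesis using wr[OF z(1)] by simp
  qed
  then obtain k where k: "\<And>z. z \<in> ball z0 r \<Longrightarrow> F z / G z = k"
    using constant_if_deriv_0[of "ball z0 r" "\<lambda>z. F z / G z"] by auto
  have "F z = k * G z" if "z \<in> D" for z
  proof (rule analytic_continuation_open[of "ball z0 r" D F "\<lambda>z. k * G z"])
    show "F z = k * G z" if "z \<in> ball z0 r" for z
    proof -
      have "z \<in> V" using that r by blast
      then show ?thesis using k[OF that] by (simp add: V_def field_simps)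
    qed
  qed (use D F G r that in \<open>auto intro!: holomorphic_intros simp: V_def\<close>)
  then show ?thesis by blast
qed

text \<open>A ring and not a field, since quotients would bring in poles; the elimination below is
  therefore arranged without division.\<close>

locale holomorphic_diff_ring =
  fixes D :: "complex set" and R :: "(complex \<Rightarrow> complex) set"
  assumes D: "open D" "connected D"
    and hol: "f \<in> R \<Longrightarrow> f holomorphic_on D"
    and const: "(\<lambda>_. k) \<in> R"
    and add: "f \<in> R \<Longrightarrow> g \<in> R \<Longrightarrow> (\<lambda>z. f z + g z) \<in> R"
    and diff: "f \<in> R \<Longrightarrow> g \<in> R \<Longrightarrow> (\<lambda>z. f z - g z) \<in> R"
    and mult: "f \<in> R \<Longrightarrow> g \<in> R \<Longrightarrow> (\<lambda>z. f z * g z) \<in> R"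
    and deriv: "f \<in> R \<Longrightarrow> deriv f \<in> R"
begin

text \<open>
  A shortest relation between functions with logarithmic derivatives in \<open>R\<close> has two terms: dividing
  a relation by one of its terms and differentiating gives a shorter one.
\<close>

lemma two_term_relation:
  assumes "finite I" "I \<noteq> {}"
    and g: "\<And>i. i \<in> I \<Longrightarrow> g i holomorphic_on D" "\<And>i z. i \<in> I \<Longrightarrow> z \<in> D \<Longrightarrow> g i z \<noteq> 0"
      "\<And>i. i \<in> I \<Longrightarrow> (\<lambda>z. deriv (g i) z / g i z) \<in> R"
    and c: "\<And>i. i \<in> I \<Longrightarrow> c i \<in> R" "\<And>i. i \<in> I \<Longrightarrow> \<exists>z\<in>D. c i z \<noteq> 0"
    and rel: "\<And>z. z \<in> D \<Longrightarrow> (\<Sum>i\<in>I. c i z * g i z) = 0"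
  shows "\<exists>i\<in>I. \<exists>j\<in>I. i \<noteq> j \<and> (\<exists>a\<in>R. \<exists>b\<in>R. (\<exists>z\<in>D. a z \<noteq> 0) \<and> (\<exists>z\<in>D. b z \<noteq> 0) \<and>
           (\<forall>z\<in>D. a z * g i z = b z * g j z))"
  using assms
proof (induction I arbitrary: c rule: finite_psubset_induct)
  case (psubset I c)
  note g = psubset.prems(2-4) and c = psubset.prems(5,6) and rel = psubset.prems(7)
  obtain i0 where i0: "i0 \<in> I" using psubset.prems(1) by blast
  define l where "l i z = deriv (g i) z / g i z" for i z
  have lR: "l i \<in> R" if "i \<in> I" for i using g(3)[OF that] unfolding l_def .
  have dg: "(g i has_field_derivative l i z * g i z) (at z)" if "i \<in> I" "z \<in> D" for i z
    using holomorphic_derivI[OF g(1)[OF that(1)] D(1) that(2)] g(2)[OF that] by (simp add: l_def)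
  have dc: "(c i has_field_derivative deriv (c i) z) (at z)" if "i \<in> I" "z \<in> D" for i z
    using holomorphic_derivI[OF hol[OF c(1)[OF that(1)]] D(1) that(2)] .
  have dcg: "((\<lambda>z. c i z * g i z) has_field_derivative (deriv (c i) z + c i z * l i z) * g i z) (at z)"
    if "i \<in> I" "z \<in> D" for i z
    using DERIV_mult[OF dc[OF that] dg[OF that]] by (simp add: algebra_simps)
  \<comment> \<open>d_i g_i g_i0 is the Wronskian of c_i g_i and c_i0 g_i0, the numerator of the
    derivative of their quotient. The factor d_i stays in \<open>R\<close> and vanishes for i =
    i0.\<close>
  define d where "d i z = deriv (c i) z * c i0 z - c i z * deriv (c i0) z + c i z * c i0 z * (l i z - l i0 z)" for i z
  have dR: "d i \<in> R" if "i \<in> I" for i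
    unfolding d_def using that i0 by (intro add diff mult deriv c lR)
  have drel: "(\<Sum>i\<in>I. d i z * g i z) = 0" if z: "z \<in> D" for z
  proof -
    have "((\<lambda>z. \<Sum>i\<in>I. c i z * g i z) has_field_derivative
        (\<Sum>i\<in>I. (deriv (c i) z + c i z * l i z) * g i z)) (at z)"
      by (intro DERIV_sum dcg z)
    moreover have "((\<lambda>z. \<Sum>i\<in>I. c i z * g i z) has_field_derivative 0) (at z)"
      by (rule has_field_derivative_transform_within_open[OF DERIV_const D(1) z, of 0]) (simp add: rel)
    ultimately have 0: "(\<Sum>i\<in>I. (deriv (c i) z + c i z * l i z) * g i z) = 0" by (rule DERIV_unique)
    have "(\<Sum>i\<in>I. d i z * g i z) = (\<Sum>i\<in>I. c i0 z * ((deriv (c i) z + c i z * l i z) * g i z) -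
        (deriv (c i0) z + c i0 z * l i0 z) * (c i z * g i z))"
      by (intro sum.cong refl) (simp add: d_def algebra_simps)
    also have "\<dots> = c i0 z * (\<Sum>i\<in>I. (deriv (c i) z + c i z * l i z) * g i z) -
        (deriv (c i0) z + c i0 z * l i0 z) * (\<Sum>i\<in>I. c i z * g i z)"
      by (simp only: sum_subtractf sum_distrib_left)
    finally show ?thesis using 0 rel[OF z] by simp
  qed
  \<comment> \<open>The terms that survive differentiation; \<open>i0\<close> is not among them, so
    the induction applies.\<close>
  define J where "J = {i \<in> I. \<exists>z\<in>D. d i z \<noteq> 0}"
  have "i0 \<notin> J" by (auto simp: J_def d_def)
  then have J: "J \<subset> I" using i0 by (auto simp: J_def)
  show ?case
  proof (cases "J = {}")
    case True
    obtain z1 where z1: "z1 \<in> D" "c i0 z1 \<noteq> 0" using c(2)[OF i0] by blast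
    have "I \<noteq> {i0}"
    proof
      assume "I = {i0}"
      then show False using rel[OF z1(1)] z1 g(2)[OF i0 z1(1)] by simp
    qed
    then obtain i where i: "i \<in> I" "i \<noteq> i0" using i0 by blast
    \<comment> \<open>All Wronskians with the term of \<open>i0\<close> vanish, so any second term
      is proportional to it.\<close>
    have "\<exists>k. \<forall>z\<in>D. c i z * g i z = k * (c i0 z * g i0 z)"
    proof (rule proportional_if_wronskian_0[OF D])
      show "(\<lambda>z. c i z * g i z) holomorphic_on D" "(\<lambda>z. c i0 z * g i0 z) holomorphic_on D"
        using i i0 by (intro holomorphic_intros hol c g; simp)+
      show "deriv (\<lambda>z. c i z * g i z) z * (c i0 z * g i0 z) = c i z * g i z * deriv (\<lambda>z. c i0 z * g i0 z) z"
        if z: "z \<in> D" for z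
      proof -
        have "d i z = 0" using True i z by (auto simp: J_def)
        then have "d i z * (g i z * g i0 z) = 0" by simp
        then show ?thesis
          unfolding DERIV_imp_deriv[OF dcg[OF i(1) z]] DERIV_imp_deriv[OF dcg[OF i0 z]] d_def
          by (simp add: algebra_simps)
      qed
      show "c i0 z1 * g i0 z1 \<noteq> 0" using z1 g(2)[OF i0 z1(1)] by simp
    qed (fact z1)
    then obtain k where k: "\<And>z. z \<in> D \<Longrightarrow> c i z * g i z = k * (c i0 z * g i0 z)" by blast
    obtain z2 where z2: "z2 \<in> D" "c i z2 \<noteq> 0" using c(2)[OF i(1)] by blast
    have "k \<noteq> 0" using k[OF z2(1)] z2 g(2)[OF i(1) z2(1)] by auto
    moreover have "(\<lambda>z. k * c i0 z) \<in> R" by (intro mult const c i0)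
    ultimately show ?thesis
      using i i0 k z1 z2 c(1)[OF i(1)]
      by (intro bexI[of _ i] bexI[of _ i0] conjI bexI[of _ "c i"] bexI[of _ "\<lambda>z. k * c i0 z"]) auto
  next
    case False
    have "\<exists>i\<in>J. \<exists>j\<in>J. i \<noteq> j \<and> (\<exists>a\<in>R. \<exists>b\<in>R. (\<exists>z\<in>D. a z \<noteq> 0) \<and> (\<exists>z\<in>D. b z \<noteq> 0) \<and>
           (\<forall>z\<in>D. a z * g i z = b z * g j z))"
    proof (rule psubset.IH[OF J False])
      show "(\<Sum>i\<in>J. d i z * g i z) = 0" if "z \<in> D" for z
      proof -
        have "(\<Sum>i\<in>J. d i z * g i z) = (\<Sum>i\<in>I. d i z * g i z)"
          using J psubset.hyps that by (intro sum.mono_neutral_left) (auto simp: J_def)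
        then show ?thesis using drel[OF that] by simp
      qed
    qed (use J g dR in \<open>auto simp: J_def\<close>)
    then show ?thesis using J by blast
  qed
qed

end

text \<open>
  The polynomials in \<open>z\<close> over the functions on \<open>D\<close> with period \<open>w\<close>.
\<close>

inductive_set quasi_periodic_ring :: "complex set \<Rightarrow> complex \<Rightarrow> (complex \<Rightarrow> complex) set"
  for D w where
  periodic: "h holomorphic_on D \<Longrightarrow> (\<And>z. z \<in> D \<Longrightarrow> h (z + w) = h z) \<Longrightarrow> h \<in> quasi_periodic_ring D w"
| ident: "(\<lambda>z. z) \<in> quasi_periodic_ring D w"
| add: "f \<in> quasi_periodic_ring D w \<Longrightarrow> g \<in> quasi_periodic_ring D w \<Longrightarrow> (\<lambda>z. f z + g z) \<in> quasi_periodic_ring D w"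
| mult: "f \<in> quasi_periodic_ring D w \<Longrightarrow> g \<in> quasi_periodic_ring D w \<Longrightarrow> (\<lambda>z. f z * g z) \<in> quasi_periodic_ring D w"
| cong: "f \<in> quasi_periodic_ring D w \<Longrightarrow> (\<And>z. z \<in> D \<Longrightarrow> g z = f z) \<Longrightarrow> g \<in> quasi_periodic_ring D w"

lemma quasi_periodic_ring_const: "(\<lambda>_. k) \<in> quasi_periodic_ring D w"
  by (rule quasi_periodic_ring.periodic) auto

lemma quasi_periodic_ring_diff:
  assumes "f \<in> quasi_periodic_ring D w" "g \<in> quasi_periodic_ring D w"
  shows "(\<lambda>z. f z - g z) \<in> quasi_periodic_ring D w"
proof -
  have "(\<lambda>z. f z + (- 1) * g z) \<in> quasi_periodic_ring D w"
    by (intro quasi_periodic_ring.add quasi_periodic_ring.mult quasi_periodic_ring_const assms)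
  then show ?thesis by simp
qed

lemma quasi_periodic_ring_holomorphic:
  "f \<in> quasi_periodic_ring D w \<Longrightarrow> f holomorphic_on D"
proof (induction rule: quasi_periodic_ring.induct)
  case (cong f g)
  show ?case by (rule holomorphic_transform[OF cong.IH]) (simp add: cong.hyps)
qed (auto intro!: holomorphic_intros)

text \<open>Along z, z + w, z + 2w, ... a periodic function is constant and the identity is linear,
  so every member of the ring is a polynomial in the step number.\<close>

lemma quasi_periodic_ring_poly:
  assumes "\<And>z. z \<in> D \<Longrightarrow> z + w \<in> D"
  shows "f \<in> quasi_periodic_ring D w \<Longrightarrow> z \<in> D \<Longrightarrow> \<exists>p. \<forall>n. f (z + of_nat n * w) = poly p (of_nat n)"
proof (induction arbitrary: z rule: quasi_periodic_ring.induct)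
  case (periodic h)
  have mem: "z + of_nat n * w \<in> D" for n
  proof (induction n)
    case (Suc n)
    then show ?case using assms[of "z + of_nat n * w"] by (simp add: algebra_simps)
  qed (use periodic.prems in simp)
  have "h (z + of_nat n * w) = h z" for n
  proof (induction n)
    case (Suc n)
    then show ?case using periodic.hyps(2)[OF mem[of n]] by (simp add: algebra_simps)
  qed simp
  then show ?case by (intro exI[of _ "[:h z:]"]) simp
next
  case ident
  show ?case by (intro exI[of _ "[:z, w:]"]) simp
next
  case (add f g)
  then obtain p q where "\<And>n. f (z + of_nat n * w) = poly p (of_nat n)" "\<And>n. g (z + of_nat n * w) = poly q (of_nat n)"
    by metis
  then show ?case by (intro exI[of _ "p + q"]) simp
next
  case (mult f g)
  then obtain p q where "\<And>n. f (z + of_nat n * w) = poly p (of_nat n)" "\<And>n. g (z + of_nat n * w) = poly q (of_nat n)"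
    by metis
  then show ?case by (intro exI[of _ "p * q"]) simp
next
  case (cong f g)
  have mem: "z + of_nat n * w \<in> D" for n
  proof (induction n)
    case (Suc n)
    then show ?case using assms[of "z + of_nat n * w"] by (simp add: algebra_simps)
  qed (use cong.prems in simp)
  then show ?case using cong by auto
qed

text \<open>Periodicity passes to the derivative, and the sum and product rules do the rest. They
  hold only on \<open>D\<close>, which is why the ring is closed under agreement on
  \<open>D\<close>.\<close>

lemma quasi_periodic_ring_deriv:
  assumes D: "open D" "\<And>z. z \<in> D \<Longrightarrow> z + w \<in> D"
  shows "f \<in> quasi_periodic_ring D w \<Longrightarrow> deriv f \<in> quasi_periodic_ring D w"
proof (induction rule: quasi_periodic_ring.induct)
  case (periodic h)
  have d: "(h has_field_derivative deriv h z) (at z)" if "z \<in> D" for z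
    using holomorphic_derivI[OF periodic.hyps(1) D(1) that] .
  show ?case
  proof (rule quasi_periodic_ring.periodic)
    show "deriv h holomorphic_on D" by (intro holomorphic_intros periodic.hyps D)
    fix z assume z: "z \<in> D"
    have "((\<lambda>z. h (z + w)) has_field_derivative deriv h (z + w)) (at z)"
      using d[OF D(2)[OF z]] by (simp add: DERIV_shift)
    moreover have "((\<lambda>z. h (z + w)) has_field_derivative deriv h z) (at z)"
      by (rule has_field_derivative_transform_within_open[OF d[OF z] D(1) z])
         (simp add: periodic.hyps(2))
    ultimately show "deriv h (z + w) = deriv h z" by (rule DERIV_unique)
  qed
next
  case ident
  show ?case using quasi_periodic_ring_const[of 1 D w] by (simp add: deriv_ident[abs_def])
next
  case (add f g)
  have "(\<lambda>z. deriv f z + deriv g z) \<in> quasi_periodic_ring D w"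
    by (intro quasi_periodic_ring.add add.IH)
  then show ?case
  proof (rule quasi_periodic_ring.cong)
    fix z assume z: "z \<in> D"
    show "deriv (\<lambda>z. f z + g z) z = deriv f z + deriv g z"
      by (intro DERIV_imp_deriv DERIV_add holomorphic_derivI[OF _ D(1) z] quasi_periodic_ring_holomorphic[where w = w] add.hyps)
  qed
next
  case (mult f g)
  have "(\<lambda>z. deriv f z * g z + deriv g z * f z) \<in> quasi_periodic_ring D w"
    by (intro quasi_periodic_ring.add quasi_periodic_ring.mult mult.IH mult.hyps)
  then show ?case
  proof (rule quasi_periodic_ring.cong)
    fix z assume z: "z \<in> D"
    show "deriv (\<lambda>z. f z * g z) z = deriv f z * g z + deriv g z * f z"
      by (intro DERIV_imp_deriv DERIV_mult holomorphic_derivI[OF _ D(1) z] quasi_periodic_ring_holomorphic[where w = w] mult.hyps)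
  qed
next
  case (cong f g)
  show ?case
  proof (rule quasi_periodic_ring.cong[OF cong.IH])
    fix z assume z: "z \<in> D"
    have "\<forall>\<^sub>F x in nhds z. x \<in> D" using D(1) z by (rule eventually_nhds_in_open)
    then show "deriv g z = deriv f z"
      by (intro deriv_cong_ev refl) (auto elim: eventually_mono simp: cong.hyps)
  qed
qed

text \<open>A function with constant increment differs from a linear function by a periodic one;
  \<zeta> and the logarithmic derivatives enter the ring this way.\<close>

lemma quasi_periodic_ring_additive:
  assumes "h holomorphic_on D" "\<And>z. z \<in> D \<Longrightarrow> h (z + w) = h z + e" "w \<noteq> 0"
  shows "h \<in> quasi_periodic_ring D w"
proof -
  have "(\<lambda>z. (h z - e / w * z) + e / w * z) \<in> quasi_periodic_ring D w"
  proof (intro quasi_periodic_ring.add quasi_periodic_ring.mult quasi_periodic_ring_const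
      quasi_periodic_ring.ident quasi_periodic_ring.periodic)
    show "(\<lambda>z. h z - e / w * z) holomorphic_on D" by (intro holomorphic_intros assms)
    show "h (z + w) - e / w * (z + w) = h z - e / w * z" if "z \<in> D" for z
      using assms(2)[OF that] assms(3) by (simp add: field_simps)
  qed
  then show ?thesis by simp
qed

lemma poly_shift_ratio_tendsto:
  fixes p :: "complex poly"
  assumes "p \<noteq> 0"
  shows "(\<lambda>n. poly p (of_nat (Suc n)) / poly p (of_nat n)) \<longlonglongrightarrow> 1"
proof -
  define A where "A n = poly p (of_nat n) / of_nat n ^ degree p" for n :: nat
  have lim: "A \<longlonglongrightarrow> lead_coeff p"
    unfolding A_def using poly_divide_tendsto_aux[of p] tendsto_of_nat
    by (rule filterlim_compose)
  have 1: "(\<lambda>n. A (Suc n) / A n) \<longlonglongrightarrow> lead_coeff p / lead_coeff p"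
    using assms by (intro tendsto_divide lim LIMSEQ_Suc[OF lim]) auto
  have "(\<lambda>n. 1 + 1 / (of_nat n :: complex)) \<longlonglongrightarrow> 1 + 0"
    by (intro tendsto_intros tendsto_divide_0[OF tendsto_const] tendsto_of_nat)
  then have 2: "(\<lambda>n. (1 + 1 / (of_nat n :: complex)) ^ degree p) \<longlonglongrightarrow> (1 + 0) ^ degree p"
    by (rule tendsto_power)
  have "(\<lambda>n. A (Suc n) / A n * (1 + 1 / of_nat n) ^ degree p) \<longlonglongrightarrow>
      lead_coeff p / lead_coeff p * (1 + 0) ^ degree p"
    by (rule tendsto_mult[OF 1 2])
  then have "(\<lambda>n. A (Suc n) / A n * (1 + 1 / of_nat n) ^ degree p) \<longlonglongrightarrow> 1" using assms by simp
  moreover have "\<forall>\<^sub>F n in sequentially. A (Suc n) / A n * (1 + 1 / of_nat n) ^ degree p =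
      poly p (of_nat (Suc n)) / poly p (of_nat n)"
  proof (rule eventually_sequentiallyI[of 1])
    fix n :: nat assume n: "1 \<le> n"
    have "(1 + 1 / of_nat n :: complex) = of_nat (Suc n) / of_nat n" using n by (simp add: field_simps)
    then show "A (Suc n) / A n * (1 + 1 / of_nat n) ^ degree p = poly p (of_nat (Suc n)) / poly p (of_nat n)"
      using n by (simp add: A_def power_divide del: of_nat_Suc)
  qed
  ultimately show ?thesis by (rule Lim_transform_eventually)
qed

lemma poly_eventually_nonzero:
  fixes p :: "complex poly"
  assumes "p \<noteq> 0"
  shows "\<forall>\<^sub>F n in sequentially. poly p (of_nat n) \<noteq> 0"
proof -
  have "finite ((of_nat :: nat \<Rightarrow> complex) -` {x. poly p x = 0})"
    using poly_roots_finite[OF assms] by (intro finite_vimageI) (auto simp: inj_on_def)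
  then have "\<forall>\<^sub>F n in cofinite. poly p (of_nat n) \<noteq> 0" by (simp add: eventually_cofinite vimage_def)
  then show ?thesis by (simp add: cofinite_eq_sequentially)
qed

text \<open>Consecutive quotients of the rational sequence q(n) / p(n) tend to 1, so v^n u tends to
  1. Comparing this limit with that of the sequence shifted by one gives v = 1, with no case
  distinction on |v|, and then u = 1.\<close>

lemma multipliers_trivial_if_rational:
  fixes p q :: "complex poly" and r :: "nat \<Rightarrow> complex"
  assumes "p \<noteq> 0" "q \<noteq> 0" and rat: "\<And>n. poly p (of_nat n) * r n = poly q (of_nat n)"
    and step: "\<And>n. r (Suc n) = r n * (v ^ n * u)"
  shows "v = 1" "u = 1"
proof -
  have "(\<lambda>n. (poly q (of_nat (Suc n)) / poly q (of_nat n)) / (poly p (of_nat (Suc n)) / poly p (of_nat n))) \<longlonglongrightarrow> 1 / 1"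
    by (intro tendsto_divide poly_shift_ratio_tendsto assms) auto
  moreover have "\<forall>\<^sub>F n in sequentially.
      (poly q (of_nat (Suc n)) / poly q (of_nat n)) / (poly p (of_nat (Suc n)) / poly p (of_nat n)) = v ^ n * u"
    using poly_eventually_nonzero[OF assms(1)] poly_eventually_nonzero[OF assms(2)]
      eventually_sequentially_Suc[THEN iffD2, OF poly_eventually_nonzero[OF assms(1)]]
  proof eventually_elim
    case (elim n)
    have "r n \<noteq> 0" using elim rat[of n] by auto
    with elim show ?case
      unfolding rat[symmetric] step by (simp add: field_simps del: of_nat_Suc)
  qed
  ultimately have lim: "(\<lambda>n. v ^ n * u) \<longlonglongrightarrow> 1"
    by (simp add: Lim_transform_eventually del: of_nat_Suc)
  then have "(\<lambda>n. v ^ Suc n * u) \<longlonglongrightarrow> 1" by (rule LIMSEQ_Suc)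
  moreover have "(\<lambda>n. v * (v ^ n * u)) \<longlonglongrightarrow> v * 1" by (intro tendsto_intros lim)
  ultimately show v: "v = 1" using LIMSEQ_unique by (fastforce simp: mult.assoc)
  show "u = 1" using lim unfolding v by (simp add: LIMSEQ_const_iff)
qed

section \<open>Comparison of multipliers under two translations\<close>

locale translation_domain =
  fixes D :: "complex set" and w1 w2 :: complex
  assumes D: "open D" "connected D"
    and shift: "z \<in> D \<Longrightarrow> z + w1 \<in> D" "z \<in> D \<Longrightarrow> z + w2 \<in> D"
    and w: "w1 \<noteq> 0" "w2 \<noteq> 0"
begin

text \<open>Membership in both rings records polynomial growth along each period separately; this
  suffices because multipliers are compared one period at a time.\<close>

definition R where "R = quasi_periodic_ring D w1 \<inter> quasi_periodic_ring D w2"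

sublocale holomorphic_diff_ring D R
proof unfold_locales
  show "deriv f \<in> R" if "f \<in> R" for f
    using that quasi_periodic_ring_deriv[OF D(1) shift(1)] quasi_periodic_ring_deriv[OF D(1) shift(2)]
    by (auto simp: R_def)
qed (use D quasi_periodic_ring_holomorphic in \<open>auto simp: R_def quasi_periodic_ring_const
      intro: quasi_periodic_ring.add quasi_periodic_ring.mult quasi_periodic_ring_diff\<close>)

lemma additive_mem_R:
  assumes "h holomorphic_on D" "\<And>z. z \<in> D \<Longrightarrow> h (z + w1) = h z + e1" "\<And>z. z \<in> D \<Longrightarrow> h (z + w2) = h z + e2"
  shows "h \<in> R"
  unfolding R_def using assms w by (auto intro: quasi_periodic_ring_additive)

text \<open>A multiplier exp(a z + b) adds the constant \<open>a\<close> to the logarithmic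
  derivative, which is the increment condition of \<open>additive_mem_R\<close>.\<close>

lemma log_deriv_shift:
  assumes g: "g holomorphic_on D" "\<And>z. z \<in> D \<Longrightarrow> g z \<noteq> 0"
    and z: "z \<in> D" and v: "\<And>z. z \<in> D \<Longrightarrow> z + v \<in> D" "\<And>z. z \<in> D \<Longrightarrow> g (z + v) = g z * exp (a * z + b)"
  shows "deriv g (z + v) / g (z + v) = deriv g z / g z + a"
proof -
  have d: "(g has_field_derivative deriv g z) (at z)" if "z \<in> D" for z
    using holomorphic_derivI[OF g(1) D(1) that] .
  have "((\<lambda>z. g (z + v)) has_field_derivative deriv g (z + v)) (at z)"
    using d[OF v(1)[OF z]] by (simp add: DERIV_shift)
  moreover have "((\<lambda>z. g z * exp (a * z + b)) has_field_derivative (deriv g z + a * g z) * exp (a * z + b)) (at z)"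
    by (rule derivative_eq_intros d[OF z] refl)+ (simp add: algebra_simps)
  then have "((\<lambda>z. g (z + v)) has_field_derivative (deriv g z + a * g z) * exp (a * z + b)) (at z)"
    by (rule has_field_derivative_transform_within_open[OF _ D(1) z]) (simp add: v(2))
  ultimately have "deriv g (z + v) = (deriv g z + a * g z) * exp (a * z + b)" by (rule DERIV_unique)
  then have "deriv g (z + v) / g (z + v) = ((deriv g z + a * g z) * exp (a * z + b)) / (g z * exp (a * z + b))"
    using v(2)[OF z] by simp
  also have "\<dots> = deriv g z / g z + a" using g(2)[OF z] by (simp add: add_divide_distrib)
  finally show ?thesis .
qed

text \<open>Along z + n v the relation makes g / h a rational function of \<open>n\<close>, while
  its consecutive quotients are exp((A - A') v)^n exp((A - A') z + (B - B')). The second factor is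
  thus 1 for all \<open>z\<close> in an open set, which forces A = A'.\<close>

lemma equal_multipliers:
  assumes g: "g holomorphic_on D" "\<And>z. z \<in> D \<Longrightarrow> g z \<noteq> 0" and h: "\<And>z. z \<in> D \<Longrightarrow> h z \<noteq> 0"
    and a: "a \<in> quasi_periodic_ring D v" and b: "b \<in> quasi_periodic_ring D v"
    and ab: "za \<in> D" "a za \<noteq> 0" "zb \<in> D" "b zb \<noteq> 0"
    and rel: "\<And>z. z \<in> D \<Longrightarrow> a z * g z = b z * h z"
    and v: "\<And>z. z \<in> D \<Longrightarrow> z + v \<in> D"
    and gv: "\<And>z. z \<in> D \<Longrightarrow> g (z + v) = g z * exp (A * z + B)"
    and hv: "\<And>z. z \<in> D \<Longrightarrow> h (z + v) = h z * exp (A' * z + B')"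
  shows "A = A' \<and> exp B = exp B'"
proof -
  have hol: "a holomorphic_on D" "b holomorphic_on D"
    using a b by (auto intro: quasi_periodic_ring_holomorphic)
  \<comment> \<open>Starting where \<open>a\<close> and \<open>b\<close> are both nonzero, the
    polynomials along the progression are nonzero.\<close>
  define W where "W = D \<inter> (\<lambda>z. a z * b z) -` (- {0})"
  have W: "open W" unfolding W_def
    by (intro continuous_open_preimage holomorphic_on_imp_continuous_on holomorphic_intros hol D) auto
  have "W \<noteq> {}"
  proof
    assume "W = {}"
    then have "a z * b z = 0" if "z \<in> D" for z using that by (auto simp: W_def)
    from holomorphic_mult_eq_0[OF D hol this ab(3,4,1)] ab(2) show False by simp
  qed
  then obtain z0 where z0: "z0 \<in> W" by blast
  have one: "exp ((A - A') * z + (B - B')) = 1" if z: "z \<in> W" for z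
  proof -
    have zD: "z \<in> D" and nz: "a z \<noteq> 0" "b z \<noteq> 0" using z by (auto simp: W_def)
    have mem: "z + of_nat n * v \<in> D" for n
    proof (induction n)
      case (Suc n)
      then show ?case using v[of "z + of_nat n * v"] by (simp add: algebra_simps)
    qed (use zD in simp)
    obtain p where p: "\<And>n. a (z + of_nat n * v) = poly p (of_nat n)"
      using quasi_periodic_ring_poly[OF v a zD] by blast
    obtain q where q: "\<And>n. b (z + of_nat n * v) = poly q (of_nat n)"
      using quasi_periodic_ring_poly[OF v b zD] by blast
    define r where "r n = g (z + of_nat n * v) / h (z + of_nat n * v)" for n
    have step: "r (Suc n) = r n * (exp ((A - A') * v) ^ n * exp ((A - A') * z + (B - B')))" for n
    proof -
      let ?z = "z + of_nat n * v"
      have e: "exp (A * ?z + B) / exp (A' * ?z + B') = exp ((A - A') * v) ^ n * exp ((A - A') * z + (B - B'))"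
        unfolding exp_diff[symmetric] exp_of_nat_mult[symmetric] exp_add[symmetric]
        by (rule arg_cong[where f = exp]) (simp add: algebra_simps)
      have "r (Suc n) = g (?z + v) / h (?z + v)" by (simp add: r_def algebra_simps)
      also have "\<dots> = r n * (exp (A * ?z + B) / exp (A' * ?z + B'))"
        unfolding gv[OF mem] hv[OF mem] r_def by simp
      finally show ?thesis unfolding e .
    qed
    have rat: "poly p (of_nat n) * r n = poly q (of_nat n)" for n
      using rel[OF mem[of n]] h[OF mem[of n]] unfolding p[symmetric] q[symmetric] r_def
      by (simp add: field_simps)
    have "p \<noteq> 0" "q \<noteq> 0" using p[of 0] q[of 0] nz by auto
    from multipliers_trivial_if_rational(2)[OF this rat step] show ?thesis .
  qed
  have "((\<lambda>z. exp ((A - A') * z + (B - B'))) has_field_derivative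
      exp ((A - A') * z0 + (B - B')) * (A - A')) (at z0)"
    by (rule derivative_eq_intros refl)+ simp
  moreover have "((\<lambda>z. exp ((A - A') * z + (B - B'))) has_field_derivative 0) (at z0)"
    by (rule has_field_derivative_transform_within_open[OF DERIV_const W z0, of 1]) (simp add: one)
  ultimately have "exp ((A - A') * z0 + (B - B')) * (A - A') = 0" by (rule DERIV_unique)
  then have A: "A = A'" by simp
  with one[OF z0] have "exp (B - B') = 1" by simp
  then show ?thesis using A by (simp add: exp_diff)
qed

lemma relation_imp_equal_multipliers:
  assumes "finite I" "I \<noteq> {}"
    and g: "\<And>i. i \<in> I \<Longrightarrow> g i holomorphic_on D" "\<And>i z. i \<in> I \<Longrightarrow> z \<in> D \<Longrightarrow> g i z \<noteq> 0"
    and g1: "\<And>i z. i \<in> I \<Longrightarrow> z \<in> D \<Longrightarrow> g i (z + w1) = g i z * exp (A1 i * z + B1 i)"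
    and g2: "\<And>i z. i \<in> I \<Longrightarrow> z \<in> D \<Longrightarrow> g i (z + w2) = g i z * exp (A2 i * z + B2 i)"
    and c: "\<And>i. i \<in> I \<Longrightarrow> c i \<in> R" "\<And>i. i \<in> I \<Longrightarrow> \<exists>z\<in>D. c i z \<noteq> 0"
    and rel: "\<And>z. z \<in> D \<Longrightarrow> (\<Sum>i\<in>I. c i z * g i z) = 0"
  shows "\<exists>i\<in>I. \<exists>j\<in>I. i \<noteq> j \<and> A1 i = A1 j \<and> exp (B1 i) = exp (B1 j) \<and> A2 i = A2 j \<and> exp (B2 i) = exp (B2 j)"
proof -
  have l: "(\<lambda>z. deriv (g i) z / g i z) \<in> R" if i: "i \<in> I" for i
  proof (rule additive_mem_R)
    show "(\<lambda>z. deriv (g i) z / g i z) holomorphic_on D" by (intro holomorphic_intros g i D)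
    show "deriv (g i) (z + w1) / g i (z + w1) = deriv (g i) z / g i z + A1 i"
      "deriv (g i) (z + w2) / g i (z + w2) = deriv (g i) z / g i z + A2 i" if "z \<in> D" for z
      by (rule log_deriv_shift[OF g(1)[OF i] g(2)[OF i] that]; use shift g1[OF i] g2[OF i] in blast)+
  qed
  from two_term_relation[OF assms(1,2) g l c rel]
  obtain i j a b where ij: "i \<in> I" "j \<in> I" "i \<noteq> j" and ab: "a \<in> R" "b \<in> R"
    "\<exists>z\<in>D. a z \<noteq> 0" "\<exists>z\<in>D. b z \<noteq> 0" "\<And>z. z \<in> D \<Longrightarrow> a z * g i z = b z * g j z" by blast
  obtain za zb where z: "za \<in> D" "a za \<noteq> 0" "zb \<in> D" "b zb \<noteq> 0" using ab by blast
  have "A1 i = A1 j \<and> exp (B1 i) = exp (B1 j)"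
    by (rule equal_multipliers[OF g(1)[OF ij(1)] g(2)[OF ij(1)] g(2)[OF ij(2)] _ _ z ab(5) shift(1) g1[OF ij(1)] g1[OF ij(2)]])
       (use ab in \<open>auto simp: R_def\<close>)
  moreover have "A2 i = A2 j \<and> exp (B2 i) = exp (B2 j)"
    by (rule equal_multipliers[OF g(1)[OF ij(1)] g(2)[OF ij(1)] g(2)[OF ij(2)] _ _ z ab(5) shift(2) g2[OF ij(1)] g2[OF ij(2)]])
       (use ab in \<open>auto simp: R_def\<close>)
  ultimately show ?thesis using ij by blast
qed

end

section \<open>Independence of the system\<close>

lemma lin_indep_overD:
  assumes "lin_indep_over K vs" "\<And>i. i < length vs \<Longrightarrow> c i \<in> K" "(\<Sum>i<length vs. c i * vs ! i) = 0"
    "i < length vs"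
  shows "c i = 0"
  using assms unfolding lin_indep_over_def by blast

lemma sum_lessThan_add:
  fixes f :: "nat \<Rightarrow> complex"
  shows "(\<Sum>j<m + n. f j) = (\<Sum>j<m. f j) + (\<Sum>j<n. f (m + j))"
  by (induction n) (auto simp: add.assoc)

text \<open>Picks out the coefficient of x^k in a polynomial with infinitely many zeros. Several
  indices may share an exponent, so variables can be eliminated one after another.\<close>

lemma power_sum_coeff_0:
  fixes c :: "'m \<Rightarrow> complex"
  assumes "finite S" "infinite X" and "\<And>x. x \<in> X \<Longrightarrow> (\<Sum>m\<in>S. c m * x ^ e m) = 0"
  shows "(\<Sum>m\<in>{m \<in> S. e m = k}. c m) = 0"
proof -
  define p where "p = (\<Sum>m\<in>S. monom (c m) (e m))"
  have "poly p x = 0" if "x \<in> X" for x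
    using assms(3)[OF that] by (simp add: p_def poly_sum poly_monom)
  then have "X \<subseteq> {x. poly p x = 0}" by blast
  then have "p = 0" using assms(2) poly_roots_finite finite_subset by blast
  then have "0 = coeff p k" by simp
  also have "\<dots> = (\<Sum>m\<in>S. if e m = k then c m else 0)" by (simp add: p_def coeff_sum)
  also have "\<dots> = (\<Sum>m\<in>{m \<in> S. e m = k}. c m)" using assms(1) by (simp add: sum.inter_filter)
  finally show ?thesis by simp
qed

text \<open>The sum is a polynomial in the step number and vanishes at all natural numbers; discrete
  translations thus turn into a complex parameter.\<close>

lemma affine_power_sum_eq_0:
  fixes c :: "'m \<Rightarrow> complex"
  assumes "\<And>n::nat. (\<Sum>m\<in>S. c m * (a + of_nat n * b) ^ e m * (a' + of_nat n * b') ^ f m) = 0"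
  shows "(\<Sum>m\<in>S. c m * (a + x * b) ^ e m * (a' + x * b') ^ f m) = 0"
proof -
  define p where "p = (\<Sum>m\<in>S. smult (c m) ([:a, b:] ^ e m * [:a', b':] ^ f m))"
  have p: "poly p x = (\<Sum>m\<in>S. c m * (a + x * b) ^ e m * (a' + x * b') ^ f m)" for x
    by (simp add: p_def poly_sum mult.assoc)
  have "range (of_nat :: nat \<Rightarrow> complex) \<subseteq> {x. poly p x = 0}" using assms by (auto simp: p)
  moreover have "infinite (range (of_nat :: nat \<Rightarrow> complex))"
    by (rule range_inj_infinite) (auto simp: inj_on_def)
  ultimately have "p = 0" using poly_roots_finite finite_subset by blast
  then show ?thesis using p[of x] by simp
qed

section \<open>Independence of z, wp and zeta; explicit multipliers\<close>

context weierstrass_lattice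
begin

text \<open>With finitely many values wp would be a constant \<open>k\<close>; then \<zeta>(z) + k z
  would be constant and \<open>eta w = - k * w\<close>, against
  \<open>eta_not_proportional\<close>.\<close>

lemma infinite_range_wp:
  assumes D: "open D" "connected D" "D \<noteq> {}" "D \<subseteq> - \<Omega>"
  shows "infinite (wp ` D)"
proof
  assume fin: "finite (wp ` D)"
  have "wp constant_on D"
    by (rule continuous_finite_range_constant[OF D(2) _ fin])
       (intro holomorphic_on_imp_continuous_on wp_holomorphic, use D in auto)
  then obtain k where k: "\<And>z. z \<in> D \<Longrightarrow> wp z = k" by (auto simp: constant_on_def)
  have wp: "wp z = k" if "z \<in> - \<Omega>" for z
    by (rule analytic_continuation_open[of D "- \<Omega>" wp "\<lambda>_. k"])
       (use D k that open_compl connected_compl in \<open>auto intro: wp_holomorphic\<close>)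
  have "((\<lambda>z. \<zeta> z + k * z) has_field_derivative 0) (at z)" if "z \<in> - \<Omega>" for z
  proof -
    have "((\<lambda>z. \<zeta> z + k * z) has_field_derivative deriv \<zeta> z + k * 1) (at z)"
      by (intro DERIV_add DERIV_cmult DERIV_ident holomorphic_derivI[OF zeta_holomorphic open_compl that]) auto
    moreover have "deriv \<zeta> z + k * 1 = 0" using wp[OF that, symmetric] by (simp add: weierstrass_wp_def)
    ultimately show ?thesis by simp
  qed
  from constant_if_deriv_0[OF open_compl connected_compl this]
  obtain c where c: "\<And>z. z \<in> - \<Omega> \<Longrightarrow> \<zeta> z + k * z = c" by blast
  have "eta w = - k * w" if w: "w \<in> \<Omega>" for w
  proof -
    let ?z = "\<omega>1 / 2"
    have "\<zeta> (?z + w) = \<zeta> ?z + eta w" using zeta_plus w half_periods by blast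
    moreover have "\<zeta> ?z + k * ?z = c" "\<zeta> (?z + w) + k * (?z + w) = c"
      using c[of ?z] c[of "?z + w"] half_periods w by (auto simp: add_mem_iff)
    ultimately have "eta w + k * w = 0" by (simp add: algebra_simps)
    then show ?thesis by (simp add: eq_neg_iff_add_eq_0)
  qed
  then show False using eta_not_proportional by simp
qed

lemma z_wp_zeta_independent:
  assumes D: "open D" "connected D" "D \<noteq> {}" "D \<subseteq> - \<Omega>" and "finite S"
    and rel: "\<And>z. z \<in> D \<Longrightarrow> (\<Sum>m\<in>S. c m * (z ^ e0 m * wp z ^ e1 m * \<zeta> z ^ e2 m)) = 0"
    and shift: "\<And>z w. z \<in> D \<Longrightarrow> w \<in> \<Omega> \<Longrightarrow> z + w \<in> D"
    and inj: "\<And>m m'. \<lbrakk>m \<in> S; m' \<in> S; e0 m = e0 m'; e1 m = e1 m'; e2 m = e2 m'\<rbrakk> \<Longrightarrow> m = m'"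
    and m: "m \<in> S"
  shows "c m = 0"
proof -
  have 1: "(\<Sum>m\<in>S. (c m * wp z ^ e1 m) * X ^ e0 m * Y ^ e2 m) = 0" if z: "z \<in> D" for z X Y
  proof -
    have z': "z \<notin> \<Omega>" using z D by auto
    \<comment> \<open>The relation at z + n \<omega>1 + l \<omega>2; first \<open>l\<close> and then
      \<open>n\<close> is replaced by a complex parameter.\<close>
    have "(\<Sum>m\<in>S. (c m * wp z ^ e1 m) * (z + of_nat n * \<omega>1 + of_nat l * \<omega>2) ^ e0 m *
        (\<zeta> z + of_nat n * eta \<omega>1 + of_nat l * eta \<omega>2) ^ e2 m) = 0" for n l
    proof -
      define w where "w = of_int (int n) * \<omega>1 + of_int (int l) * \<omega>2"
      have w: "w \<in> \<Omega>" unfolding w_def mem_iff by blast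
      have "eta w = of_nat n * eta \<omega>1 + of_nat l * eta \<omega>2" unfolding w_def eta_lattice by simp
      then show ?thesis
        using rel[OF shift[OF z w]] zeta_plus[OF w z'] wp_plus[OF w z']
        by (simp add: w_def mult_ac add_ac)
    qed
    then have "(\<Sum>m\<in>S. (c m * wp z ^ e1 m) * (z + of_nat n * \<omega>1 + y * \<omega>2) ^ e0 m *
        (\<zeta> z + of_nat n * eta \<omega>1 + y * eta \<omega>2) ^ e2 m) = 0" for n y
      by (rule affine_power_sum_eq_0)
    then have "(\<Sum>m\<in>S. (c m * wp z ^ e1 m) * ((z + y * \<omega>2) + of_nat n * \<omega>1) ^ e0 m *
        ((\<zeta> z + y * eta \<omega>2) + of_nat n * eta \<omega>1) ^ e2 m) = 0" for n y
      by (simp add: add_ac)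
    then have 2: "(\<Sum>m\<in>S. (c m * wp z ^ e1 m) * ((z + y * \<omega>2) + x * \<omega>1) ^ e0 m *
        ((\<zeta> z + y * eta \<omega>2) + x * eta \<omega>1) ^ e2 m) = 0" for x y
      by (rule affine_power_sum_eq_0)
    define d where "d = \<omega>1 * eta \<omega>2 - \<omega>2 * eta \<omega>1"
    have d: "d \<noteq> 0" unfolding d_def by (rule eta_not_proportional)
    \<comment> \<open>Cramer's rule for the parameters that move (z, \<zeta>(z)) to the prescribed
      point (X, Y).\<close>
    define x where "x = ((X - z) * eta \<omega>2 - \<omega>2 * (Y - \<zeta> z)) / d"
    define y where "y = (\<omega>1 * (Y - \<zeta> z) - (X - z) * eta \<omega>1) / d"
    have xd: "x * d = (X - z) * eta \<omega>2 - \<omega>2 * (Y - \<zeta> z)" using d by (simp add: x_def)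
    have yd: "y * d = \<omega>1 * (Y - \<zeta> z) - (X - z) * eta \<omega>1" using d by (simp add: y_def)
    have "(z + y * \<omega>2 + x * \<omega>1) * d = z * d + (y * d) * \<omega>2 + (x * d) * \<omega>1" by (simp add: algebra_simps)
    also have "\<dots> = X * d" unfolding xd yd by (simp add: d_def algebra_simps)
    finally have X: "z + y * \<omega>2 + x * \<omega>1 = X" using d by simp
    have "(\<zeta> z + y * eta \<omega>2 + x * eta \<omega>1) * d = \<zeta> z * d + (y * d) * eta \<omega>2 + (x * d) * eta \<omega>1"
      by (simp add: algebra_simps)
    also have "\<dots> = Y * d" unfolding xd yd by (simp add: d_def algebra_simps)
    finally have Y: "\<zeta> z + y * eta \<omega>2 + x * eta \<omega>1 = Y" using d by simp
    show ?thesis using 2[of y x] unfolding X Y .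
  qed
  have inf: "infinite (UNIV :: complex set)" by (rule infinite_UNIV_char_0)
  \<comment> \<open>X and Y are now free variables: the exponent of X is fixed first, then that of
    Y, and last that of wp, which takes infinitely many values.\<close>
  define S1 where "S1 = {k \<in> S. e0 k = e0 m}"
  have "(\<Sum>k\<in>S. (c k * wp z ^ e1 k * Y ^ e2 k) * X ^ e0 k) = 0" if "z \<in> D" for z X Y
    using 1[OF that, where X = X and Y = Y] by (simp add: mult_ac)
  from power_sum_coeff_0[OF \<open>finite S\<close> inf this]
  have 2: "(\<Sum>k\<in>S1. (c k * wp z ^ e1 k) * Y ^ e2 k) = 0" if "z \<in> D" for z Y
    using that by (simp add: S1_def)
  define S2 where "S2 = {k \<in> S1. e2 k = e2 m}"
  have fin1: "finite S1" using \<open>finite S\<close> by (simp add: S1_def)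
  from power_sum_coeff_0[OF fin1 inf 2]
  have 3: "(\<Sum>k\<in>S2. c k * wp z ^ e1 k) = 0" if "z \<in> D" for z
    using that by (simp add: S2_def)
  have fin2: "finite S2" using fin1 by (simp add: S2_def)
  have "(\<Sum>k\<in>{k \<in> S2. e1 k = e1 m}. c k) = 0"
    by (rule power_sum_coeff_0[OF fin2 infinite_range_wp[OF D]]) (use 3 in auto)
  moreover have "{k \<in> S2. e1 k = e1 m} = {m}"
    using m by (auto simp: S1_def S2_def intro: inj)
  ultimately show ?thesis by simp
qed

text \<open>A homomorphism on a lattice extends to a real-linear map of the plane, and every such
  map has the form a w + b cnj(w); Cramer's rule on the basis yields \<open>a\<close> and
  \<open>b\<close>.\<close>

lemma eta_real_linear: "\<exists>a b. \<forall>w\<in>\<Omega>. eta w = a * w + b * cnj w"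
proof -
  define d where "d = \<omega>1 * cnj \<omega>2 - \<omega>2 * cnj \<omega>1"
  have d: "d \<noteq> 0"
  proof
    assume "d = 0"
    then have "Im d = 0" by simp
    then show False using Im_nonzero by (simp add: d_def algebra_simps)
  qed
  define a where "a = (eta \<omega>1 * cnj \<omega>2 - eta \<omega>2 * cnj \<omega>1) / d"
  define b where "b = (\<omega>1 * eta \<omega>2 - \<omega>2 * eta \<omega>1) / d"
  have ad: "a * d = eta \<omega>1 * cnj \<omega>2 - eta \<omega>2 * cnj \<omega>1" and bd: "b * d = \<omega>1 * eta \<omega>2 - \<omega>2 * eta \<omega>1"
    using d by (simp_all add: a_def b_def)
  have "(a * w + b * cnj w) * d = (a * d) * w + (b * d) * cnj w" for w by (simp add: algebra_simps)
  note eq = this[unfolded ad bd]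
  have "(a * \<omega>1 + b * cnj \<omega>1) * d = eta \<omega>1 * d" unfolding eq by (simp add: d_def algebra_simps)
  then have 1: "a * \<omega>1 + b * cnj \<omega>1 = eta \<omega>1" using d by simp
  have "(a * \<omega>2 + b * cnj \<omega>2) * d = eta \<omega>2 * d" unfolding eq by (simp add: d_def algebra_simps)
  then have 2: "a * \<omega>2 + b * cnj \<omega>2 = eta \<omega>2" using d by simp
  have "eta w = a * w + b * cnj w" if w: "w \<in> \<Omega>" for w
  proof -
    obtain m n where w: "w = of_int m * \<omega>1 + of_int n * \<omega>2" using w by (auto simp: mem_iff)
    show ?thesis unfolding w eta_lattice 1[symmetric] 2[symmetric] by (simp add: algebra_simps)
  qed
  then show ?thesis by blast
qed

text \<open>If t \<omega>1 = 2 pi i m and t \<omega>2 = 2 pi i n, then t (n \<omega>1 - m \<omega>2)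
  = 0; for nonzero \<open>t\<close> independence of the periods gives m = 0, hence t \<omega>1 =
  0.\<close>

lemma eq_0_if_exp_periods_1:
  assumes "exp (t * \<omega>1) = 1" "exp (t * \<omega>2) = 1"
  shows "t = 0"
proof (rule ccontr)
  assume t: "t \<noteq> 0"
  obtain m :: int where m: "t * \<omega>1 = of_real (of_int (2 * m) * pi) * \<i>"
    using iffD1[OF exp_eq_1 assms(1)] by (auto simp: complex_eq_iff)
  obtain n :: int where n: "t * \<omega>2 = of_real (of_int (2 * n) * pi) * \<i>"
    using iffD1[OF exp_eq_1 assms(2)] by (auto simp: complex_eq_iff)
  have "t * (of_real (of_int n) * \<omega>1 + of_real (of_int (- m)) * \<omega>2) =
      of_int n * (t * \<omega>1) - of_int m * (t * \<omega>2)" by (simp add: algebra_simps)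
  also have "\<dots> = 0" unfolding m n by (simp add: algebra_simps)
  finally have "of_real (of_int n) * \<omega>1 + of_real (of_int (- m)) * \<omega>2 = 0" using t by simp
  from real_indep[OF this] have "m = 0" by simp
  then show False using m t nonzero by simp
qed

text \<open>Determined only modulo 2 pi i; fixing one value lets the exponents of products be
  added.\<close>

definition sigma_const :: "complex \<Rightarrow> complex" where
  "sigma_const w = (SOME c. \<forall>z. \<sigma> (z + w) = \<sigma> z * exp (eta w * z + c))"

lemma sigma_plus': "w \<in> \<Omega> \<Longrightarrow> \<sigma> (z + w) = \<sigma> z * exp (eta w * z + sigma_const w)"
  using someI_ex[OF sigma_plus] unfolding sigma_const_def by blast

text \<open>In \<sigma>(z + u) / \<sigma>(z) the part of the multiplier depending on
  \<open>z\<close> cancels together with \<open>sigma_const w\<close>, so a constant remains. At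
  poles both sides are 0 by the convention for division.\<close>

lemma serre_fun_plus:
  assumes "w \<in> \<Omega>"
  shows "serre_fun \<Omega> u (z + w) = serre_fun \<Omega> u z * exp (eta w * u - \<zeta> u * w)"
proof -
  have "\<sigma> (z + w + u) = \<sigma> (z + u) * exp (eta w * (z + u) + sigma_const w)"
    using sigma_plus'[OF assms, of "z + u"] by (simp add: add_ac)
  also have "exp (eta w * (z + u) + sigma_const w) = exp (eta w * z + sigma_const w) * exp (eta w * u)"
    unfolding exp_add[symmetric] by (simp add: algebra_simps)
  finally have 1: "\<sigma> (z + w + u) = \<sigma> (z + u) * (exp (eta w * z + sigma_const w) * exp (eta w * u))" .
  have 2: "exp (- \<zeta> u * (z + w)) = exp (- \<zeta> u * z) * exp (- (\<zeta> u * w))"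
    unfolding exp_add[symmetric] by (simp add: algebra_simps)
  have 3: "exp (eta w * u - \<zeta> u * w) = exp (eta w * u) * exp (- (\<zeta> u * w))"
    unfolding exp_add[symmetric] by simp
  show ?thesis unfolding serre_fun_def 1 2 3 sigma_plus'[OF assms] by simp
qed

end

text \<open>A pair \<open>(u, \<alpha>)\<close> stands for the function f_u(\<alpha> z). The
  coefficients in \<open>indep\<close> are integers because they will be differences of exponents of
  two monomials.\<close>

locale serre_system = weierstrass_lattice +
  fixes ts :: "complex list" and ps :: "(complex \<times> complex) list"
  assumes ts: "lin_indep_over \<rat> ts"
    and ps: "\<And>u \<alpha>. (u, \<alpha>) \<in> set ps \<Longrightarrow> u \<notin> \<Omega> \<and> \<alpha> \<noteq> 0 \<and> \<alpha> \<in> End_ring \<Omega>"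
    and indep: "\<And>n :: nat \<Rightarrow> int. (\<Sum>j<length ps. of_int (n j) * (cnj (snd (ps ! j)) * fst (ps ! j))) \<in> \<Omega>
      \<Longrightarrow> \<forall>j<length ps. n j = 0"
begin

text \<open>Zeros are removed as well as poles, so that every function from index 3 on has a
  holomorphic logarithmic derivative. Only a countable closed set is removed, which keeps the domain
  open and connected.\<close>

definition domain :: "complex set" where
  "domain = {z. z \<notin> \<Omega> \<and> (\<forall>(u, \<alpha>)\<in>set ps. \<alpha> * z \<notin> \<Omega> \<and> \<alpha> * z + u \<notin> \<Omega>)}"

definition F :: "nat \<Rightarrow> complex \<Rightarrow> complex" where
  "F i = ([\<lambda>z. z, wp, \<zeta>, \<sigma>] @ map (\<lambda>t z. exp (t * z)) ts @
     map (\<lambda>(u, \<alpha>) z. serre_fun \<Omega> u (\<alpha> * z)) ps) ! i"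

definition N where "N = 4 + length ts + length ps"

text \<open>\<open>exp (A w i * z + B w i)\<close> is the multiplier of \<open>F i\<close> for i at
  least 3; among these only \<sigma> has one that varies with \<open>z\<close>.\<close>

definition A :: "complex \<Rightarrow> nat \<Rightarrow> complex" where
  "A w i = (if i = 3 then eta w else 0)"

definition B :: "complex \<Rightarrow> nat \<Rightarrow> complex" where
  "B w i = (if i = 3 then sigma_const w
     else if i < 4 + length ts then ts ! (i - 4) * w
     else eta (snd (ps ! (i - 4 - length ts)) * w) * fst (ps ! (i - 4 - length ts)) -
          \<zeta> (fst (ps ! (i - 4 - length ts))) * (snd (ps ! (i - 4 - length ts)) * w))"

lemma F_simps:
  "F 0 = (\<lambda>z. z)" "F 1 = wp" "F 2 = \<zeta>" "F 3 = \<sigma>"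
  "j < length ts \<Longrightarrow> F (4 + j) = (\<lambda>z. exp (ts ! j * z))"
  "j < length ps \<Longrightarrow> F (4 + length ts + j) = (\<lambda>z. serre_fun \<Omega> (fst (ps ! j)) (snd (ps ! j) * z))"
  by (auto simp: F_def nth_append split_beta numeral_eq_Suc)

lemma index_cases:
  assumes "i \<in> {3..<N}"
  obtains "i = 3" | j where "j < length ts" "i = 4 + j" | j where "j < length ps" "i = 4 + length ts + j"
proof -
  consider "i = 3" | "4 \<le> i" "i < 4 + length ts" | "4 + length ts \<le> i" using assms by force
  then show ?thesis
  proof cases
    case 2
    then show ?thesis using that(2)[of "i - 4"] by simp
  next
    case 3
    then show ?thesis using that(3)[of "i - 4 - length ts"] assms by (simp add: N_def)
  qed (use that in auto)
qed

lemma ps_nth: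
  assumes "j < length ps"
  shows "fst (ps ! j) \<notin> \<Omega>" "snd (ps ! j) \<noteq> 0" "\<And>w. w \<in> \<Omega> \<Longrightarrow> snd (ps ! j) * w \<in> \<Omega>"
    "\<And>z. z \<in> domain \<Longrightarrow> snd (ps ! j) * z \<notin> \<Omega>" "\<And>z. z \<in> domain \<Longrightarrow> snd (ps ! j) * z + fst (ps ! j) \<notin> \<Omega>"
  using ps[of "fst (ps ! j)" "snd (ps ! j)"] nth_mem[OF assms]
  by (auto simp: domain_def End_ring_def)

lemma domain_subset: "domain \<subseteq> - \<Omega>"
  by (auto simp: domain_def)

lemma domain_eq:
  "domain = - (\<Omega> \<union> (\<Union>p\<in>set ps. (\<lambda>z. snd p * z) -` \<Omega> \<union> (\<lambda>z. snd p * z + fst p) -` \<Omega>))"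
  by (force simp: domain_def)

lemma open_domain: "open domain"
proof -
  have "closed ((\<lambda>z. snd p * z) -` \<Omega>)" "closed ((\<lambda>z. snd p * z + fst p) -` \<Omega>)" for p :: "complex \<times> complex"
    by (intro closed_vimage closed_lattice continuous_intros)+
  then show ?thesis unfolding domain_eq by (intro open_Compl closed_Un closed_UN closed_lattice) auto
qed

lemma countable_compl_domain: "countable (- domain)"
proof -
  have "countable ((\<lambda>z. snd p * z) -` \<Omega>)" "countable ((\<lambda>z. snd p * z + fst p) -` \<Omega>)" if "p \<in> set ps" for p
  proof -
    have "snd p \<noteq> 0" using ps[of "fst p" "snd p"] that by simp
    then show "countable ((\<lambda>z. snd p * z) -` \<Omega>)" "countable ((\<lambda>z. snd p * z + fst p) -` \<Omega>)"
      by (auto intro!: countable_image_inj_on[OF countable_subset[OF image_vimage_subset countable_lattice]]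
          simp: inj_on_def)
  qed
  then show ?thesis unfolding domain_eq
    by (auto intro!: countable_Un countable_UN countable_lattice intro: countable_finite)
qed

lemma connected_domain: "connected domain"
  using path_connected_complement_countable[OF _ countable_compl_domain]
  by (auto intro: path_connected_imp_connected)

lemma domain_nonempty: "domain \<noteq> {}"
  using countable_compl_domain uncountable_UNIV_complex by auto

lemma domain_shift:
  assumes z: "z \<in> domain" and w: "w \<in> \<Omega>"
  shows "z + w \<in> domain"
proof -
  have "\<alpha> * (z + w) \<notin> \<Omega> \<and> \<alpha> * (z + w) + u \<notin> \<Omega>" if p: "(u, \<alpha>) \<in> set ps" for u \<alpha>
  proof -
    have "\<alpha> * w \<in> \<Omega>" using ps[OF p] w by (auto simp: End_ring_def)
    moreover have "\<alpha> * z \<notin> \<Omega>" "\<alpha> * z + u \<notin> \<Omega>" using p z by (auto simp: domain_def)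
    ultimately show ?thesis
      using add_mem_iff[of "\<alpha> * w" "\<alpha> * z"] add_mem_iff[of "\<alpha> * w" "\<alpha> * z + u"]
      by (simp add: algebra_simps)
  qed
  then show ?thesis using z w by (auto simp: domain_def add_mem_iff)
qed

sublocale translation_domain domain \<omega>1 \<omega>2
  by unfold_locales (use open_domain connected_domain domain_shift nonzero in auto)

lemma F_holomorphic:
  assumes "i \<in> {3..<N}"
  shows "F i holomorphic_on domain"
  using assms
proof (cases rule: index_cases)
  case (3 j)
  show ?thesis unfolding 3 F_simps(6)[OF 3(1)] serre_fun_def
    by (intro holomorphic_intros) (use ps_nth[OF 3(1)] in auto)
qed (auto simp: F_simps intro!: holomorphic_intros)

lemma F_nonzero:
  assumes "i \<in> {3..<N}" and z: "z \<in> domain"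
  shows "F i z \<noteq> 0"
  using assms(1)
proof (cases rule: index_cases)
  case 1
  then show ?thesis using z domain_subset by (auto simp: F_simps)
next
  case (3 j)
  show ?thesis unfolding 3 F_simps(6)[OF 3(1)] serre_fun_def
    using ps_nth[OF 3(1)] z by auto
qed (auto simp: F_simps)

lemma F_plus:
  assumes "i \<in> {3..<N}" and w: "w \<in> \<Omega>"
  shows "F i (z + w) = F i z * exp (A w i * z + B w i)"
  using assms(1)
proof (cases rule: index_cases)
  case 1
  then show ?thesis using sigma_plus'[OF w] by (simp add: F_simps A_def B_def)
next
  case (2 j)
  show ?thesis unfolding 2(2) F_simps(5)[OF 2(1)] using 2(1)
    by (simp add: A_def B_def algebra_simps flip: exp_add)
next
  case (3 j)
  have "F i (z + w) = serre_fun \<Omega> (fst (ps ! j)) (snd (ps ! j) * z + snd (ps ! j) * w)"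
    unfolding 3 F_simps(6)[OF 3(1)] by (simp add: algebra_simps)
  then show ?thesis
    unfolding 3 F_simps(6)[OF 3(1)] using serre_fun_plus[OF ps_nth(3)[OF 3(1) w]] by (simp add: A_def B_def)
qed

definition G :: "(nat \<Rightarrow> nat) \<Rightarrow> complex \<Rightarrow> complex" where
  "G \<mu> z = (\<Prod>i\<in>{3..<N}. F i z ^ \<mu> i)"

lemma G_holomorphic: "G \<mu> holomorphic_on domain"
  unfolding G_def by (intro holomorphic_intros F_holomorphic)

lemma G_nonzero: "z \<in> domain \<Longrightarrow> G \<mu> z \<noteq> 0"
  unfolding G_def by (auto simp: F_nonzero)

lemma G_plus:
  assumes w: "w \<in> \<Omega>"
  shows "G \<mu> (z + w) = G \<mu> z * exp ((\<Sum>i\<in>{3..<N}. of_nat (\<mu> i) * A w i) * z + (\<Sum>i\<in>{3..<N}. of_nat (\<mu> i) * B w i))"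
proof -
  have "G \<mu> (z + w) = (\<Prod>i\<in>{3..<N}. F i z ^ \<mu> i * exp (of_nat (\<mu> i) * (A w i * z + B w i)))"
    unfolding G_def
  proof (rule prod.cong[OF refl])
    fix i assume i: "i \<in> {3..<N}"
    show "F i (z + w) ^ \<mu> i = F i z ^ \<mu> i * exp (of_nat (\<mu> i) * (A w i * z + B w i))"
      unfolding F_plus[OF i w] exp_of_nat_mult by (rule power_mult_distrib)
  qed
  also have "\<dots> = G \<mu> z * exp (\<Sum>i\<in>{3..<N}. of_nat (\<mu> i) * (A w i * z + B w i))"
    by (simp add: G_def prod.distrib exp_sum)
  also have "(\<Sum>i\<in>{3..<N}. of_nat (\<mu> i) * (A w i * z + B w i)) =
      (\<Sum>i\<in>{3..<N}. of_nat (\<mu> i) * A w i) * z + (\<Sum>i\<in>{3..<N}. of_nat (\<mu> i) * B w i)"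
    by (simp add: sum_distrib_right flip: sum.distrib) (simp add: algebra_simps)
  finally show ?thesis .
qed

text \<open>
  By the \<open>\<real>\<close>-linearity of \<open>eta\<close>, the multiplier of \<open>f\<^sub>u(\<alpha> z)\<close> is that of \<open>f\<^sub>v(z)\<close> with
  \<open>v = cnj \<alpha> * u\<close>, up to an exponential.
\<close>

lemma trivial_multipliers:
  fixes n :: "nat \<Rightarrow> int"
  assumes "\<And>w. w \<in> {\<omega>1, \<omega>2} \<Longrightarrow> (\<Sum>i\<in>{3..<N}. of_int (n i) * A w i) = 0"
    and "\<And>w. w \<in> {\<omega>1, \<omega>2} \<Longrightarrow> exp (\<Sum>i\<in>{3..<N}. of_int (n i) * B w i) = 1"
  shows "\<forall>i\<in>{3..<N}. n i = 0"
proof -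
  have split: "(\<Sum>i\<in>{3..<N}. f i) = f 3 + (\<Sum>j<length ts. f (4 + j)) + (\<Sum>j<length ps. f (4 + length ts + j))"
    for f :: "nat \<Rightarrow> complex"
  proof -
    have e: "{3..<N} = {3} \<union> ((\<lambda>j. 4 + j) ` {..<length ts}) \<union> ((\<lambda>j. 4 + length ts + j) ` {..<length ps})"
      (is "?L = ?R")
    proof
      show "?L \<subseteq> ?R"
      proof
        fix i assume "i \<in> {3..<N}"
        then show "i \<in> ?R" by (cases rule: index_cases) auto
      qed
    qed (auto simp: N_def)
    show ?thesis unfolding e
      by (subst sum.union_disjoint, simp, simp, force, subst sum.union_disjoint, simp, simp, force)
         (simp add: sum.reindex inj_on_def o_def)
  qed
  have "of_int (n 3) * eta w = 0" if "w \<in> {\<omega>1, \<omega>2}" for w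
    using assms(1)[OF that] by (simp add: split A_def)
  \<comment> \<open>One of the two quasi-periods is nonzero, by
    \<open>eta_not_proportional\<close>.\<close>
  from this[of \<omega>1] this[of \<omega>2] have n3: "n 3 = 0" using eta_not_proportional by auto
  obtain a b where ab: "\<And>w. w \<in> \<Omega> \<Longrightarrow> eta w = a * w + b * cnj w" using eta_real_linear by blast
  define u where "u j = fst (ps ! j)" for j
  define \<alpha> where "\<alpha> j = snd (ps ! j)" for j
  define T where "T = (\<Sum>j<length ts. of_int (n (4 + j)) * ts ! j)"
  define k where "k j = n (4 + length ts + j)" for j
  define U where "U = (\<Sum>j<length ps. of_int (k j) * (cnj (\<alpha> j) * u j))"
  \<comment> \<open>Writing \<open>b * cnj w * U\<close> as \<open>eta w * U - a * w * U\<close>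
    brings the exponent into the form s w + eta(w) U of \<open>mem_if_character_trivial\<close>;
    hence the term \<open>- a * U\<close>.\<close>
  define s where "s = T + (\<Sum>j<length ps. of_int (k j) * ((a * u j - \<zeta> (u j)) * \<alpha> j)) - a * U"
  have char: "(\<Sum>i\<in>{3..<N}. of_int (n i) * B w i) = s * w + eta w * U" if w: "w \<in> \<Omega>" for w
  proof -
    have "of_int (k j) * (eta (\<alpha> j * w) * u j - \<zeta> (u j) * (\<alpha> j * w)) =
        of_int (k j) * ((a * u j - \<zeta> (u j)) * \<alpha> j) * w + b * cnj w * (of_int (k j) * (cnj (\<alpha> j) * u j))"
      if "j < length ps" for j
      using ps_nth(3)[OF that w] by (simp add: \<alpha>_def ab algebra_simps)
    then have "(\<Sum>j<length ps. of_int (k j) * (eta (\<alpha> j * w) * u j - \<zeta> (u j) * (\<alpha> j * w))) =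
        (\<Sum>j<length ps. of_int (k j) * ((a * u j - \<zeta> (u j)) * \<alpha> j)) * w + b * cnj w * U"
      by (simp add: sum.distrib U_def sum_distrib_left sum_distrib_right)
    moreover have "(\<Sum>i\<in>{3..<N}. of_int (n i) * B w i) = T * w +
        (\<Sum>j<length ps. of_int (k j) * (eta (\<alpha> j * w) * u j - \<zeta> (u j) * (\<alpha> j * w)))"
      by (simp add: split B_def n3 T_def sum_distrib_right k_def u_def \<alpha>_def mult.assoc)
    ultimately show ?thesis using ab[OF w] by (simp add: s_def algebra_simps)
  qed
  have "U \<in> \<Omega>"
    using assms(2)[of \<omega>1] assms(2)[of \<omega>2] by (intro mem_if_character_trivial[of s]) (simp_all add: char)
  then have k0: "\<forall>j<length ps. k j = 0" using indep[of k] by (simp add: U_def \<alpha>_def u_def)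
  \<comment> \<open>Only the ordinary exponentials are left.\<close>
  then have "U = 0" "s = T" by (simp_all add: U_def s_def)
  then have "exp (T * \<omega>1) = 1" "exp (T * \<omega>2) = 1"
    using assms(2)[of \<omega>1] assms(2)[of \<omega>2] by (simp_all add: char)
  then have "T = 0" by (rule eq_0_if_exp_periods_1)
  then have t0: "complex_of_int (n (4 + j)) = 0" if "j < length ts" for j
    using lin_indep_overD[OF ts, of "\<lambda>j. complex_of_int (n (4 + j))", OF _ _ that] by (simp add: T_def)
  show ?thesis
  proof
    fix i assume "i \<in> {3..<N}"
    then show "n i = 0" by (cases rule: index_cases) (use n3 k0 t0 in \<open>auto simp: k_def\<close>)
  qed
qed

section \<open>Polynomial relations as linear relations over the coefficient ring\<close>

lemma R_power: "f \<in> R \<Longrightarrow> (\<lambda>z. f z ^ n) \<in> R"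
  by (induction n) (auto intro: const mult)

lemma R_sum: "(\<And>m. m \<in> S \<Longrightarrow> f m \<in> R) \<Longrightarrow> (\<lambda>z. \<Sum>m\<in>S. f m z) \<in> R"
  by (induction S rule: infinite_finite_induct) (auto intro: const add)

lemma z_wp_zeta_mem_R: "(\<lambda>z. z) \<in> R" "wp \<in> R" "\<zeta> \<in> R"
proof -
  show "(\<lambda>z. z) \<in> R" by (rule additive_mem_R) auto
  show "wp \<in> R"
    by (rule additive_mem_R[of wp 0 0]) (use domain_subset wp_plus in \<open>auto intro!: wp_holomorphic\<close>)
  show "\<zeta> \<in> R"
    by (rule additive_mem_R) (use domain_subset zeta_plus in \<open>auto intro!: zeta_holomorphic\<close>)
qed

text \<open>Forgetting the exponents of z, wp and \<zeta> groups the monomials by their part with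
  multipliers; each group contributes one coefficient in \<open>R\<close>.\<close>

definition tail :: "(nat \<Rightarrow>\<^sub>0 nat) \<Rightarrow> nat \<Rightarrow> nat" where
  "tail m i = (if i < 3 then 0 else Poly_Mapping.lookup m i)"

definition coefficient :: "cmpoly \<Rightarrow> (nat \<Rightarrow> nat) \<Rightarrow> complex \<Rightarrow> complex" where
  "coefficient P \<mu> z = (\<Sum>m\<in>{m \<in> Poly_Mapping.keys P. tail m = \<mu>}. Poly_Mapping.lookup P m *
     (z ^ Poly_Mapping.lookup m 0 * wp z ^ Poly_Mapping.lookup m 1 * \<zeta> z ^ Poly_Mapping.lookup m 2))"

lemma coefficient_mem_R: "coefficient P \<mu> \<in> R"
  unfolding coefficient_def by (intro R_sum mult const R_power z_wp_zeta_mem_R)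

lemma lookup_out_of_range:
  assumes "cmpoly_vars P \<subseteq> {..<N}" "m \<in> Poly_Mapping.keys P" "i \<ge> N"
  shows "Poly_Mapping.lookup m i = 0"
proof (rule ccontr)
  assume "Poly_Mapping.lookup m i \<noteq> 0"
  then have "i \<in> cmpoly_vars P" using assms(2) by (auto simp: cmpoly_vars_def in_keys_iff)
  then show False using assms by auto
qed

lemma cmpoly_eval_eq:
  assumes P: "cmpoly_vars P \<subseteq> {..<N}"
  shows "cmpoly_eval P (\<lambda>i. F i z) = (\<Sum>\<mu>\<in>tail ` Poly_Mapping.keys P. coefficient P \<mu> z * G \<mu> z)"
proof -
  have mon: "(\<Prod>i\<in>Poly_Mapping.keys m. F i z ^ Poly_Mapping.lookup m i) =
      (z ^ Poly_Mapping.lookup m 0 * wp z ^ Poly_Mapping.lookup m 1 * \<zeta> z ^ Poly_Mapping.lookup m 2) * G (tail m) z"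
    if m: "m \<in> Poly_Mapping.keys P" for m
  proof -
    have "Poly_Mapping.keys m \<subseteq> {..<N}"
    proof
      fix i assume "i \<in> Poly_Mapping.keys m"
      then show "i \<in> {..<N}" using lookup_out_of_range[OF P m, of i] by (cases "i < N") (auto simp: in_keys_iff)
    qed
    then have "(\<Prod>i\<in>Poly_Mapping.keys m. F i z ^ Poly_Mapping.lookup m i) = (\<Prod>i<N. F i z ^ Poly_Mapping.lookup m i)"
      by (intro prod.mono_neutral_left) (auto simp: in_keys_iff)
    also have "{..<N} = {0, 1, 2} \<union> {3..<N}" by (auto simp: N_def)
    also have "(\<Prod>i\<in>{0, 1, 2} \<union> {3..<N}. F i z ^ Poly_Mapping.lookup m i) =
        (\<Prod>i\<in>{0, 1, 2}. F i z ^ Poly_Mapping.lookup m i) * (\<Prod>i\<in>{3..<N}. F i z ^ Poly_Mapping.lookup m i)"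
      by (rule prod.union_disjoint) auto
    also have "(\<Prod>i\<in>{3..<N}. F i z ^ Poly_Mapping.lookup m i) = G (tail m) z"
      unfolding G_def by (intro prod.cong) (auto simp: tail_def)
    also have "(\<Prod>i\<in>{0, 1, 2}. F i z ^ Poly_Mapping.lookup m i) =
        z ^ Poly_Mapping.lookup m 0 * wp z ^ Poly_Mapping.lookup m 1 * \<zeta> z ^ Poly_Mapping.lookup m 2"
      using F_simps(1-3) by (simp add: mult.assoc del: One_nat_def)
    finally show ?thesis .
  qed
  have "cmpoly_eval P (\<lambda>i. F i z) = (\<Sum>\<mu>\<in>tail ` Poly_Mapping.keys P.
      \<Sum>m\<in>{m \<in> Poly_Mapping.keys P. tail m = \<mu>}. Poly_Mapping.lookup P m *
        (\<Prod>i\<in>Poly_Mapping.keys m. F i z ^ Poly_Mapping.lookup m i))"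
    unfolding cmpoly_eval_def by (rule sum.image_gen) simp
  also have "\<dots> = (\<Sum>\<mu>\<in>tail ` Poly_Mapping.keys P. coefficient P \<mu> z * G \<mu> z)"
    unfolding coefficient_def sum_distrib_right
    by (intro sum.cong refl) (auto simp: mon)
  finally show ?thesis .
qed

text \<open>Monomials with the same tail are distinguished by their first three exponents, so the
  coefficient is a nontrivial polynomial in z, wp and \<zeta>.\<close>

lemma coefficient_nonzero:
  assumes P: "cmpoly_vars P \<subseteq> {..<N}" and \<mu>: "\<mu> \<in> tail ` Poly_Mapping.keys P"
  shows "\<exists>z\<in>domain. coefficient P \<mu> z \<noteq> 0"
proof (rule ccontr)
  assume "\<not> ?thesis"
  then have 0: "coefficient P \<mu> z = 0" if "z \<in> domain" for z using that by blast
  obtain m where m: "m \<in> Poly_Mapping.keys P" "tail m = \<mu>" using \<mu> by blast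
  have "Poly_Mapping.lookup P m = 0"
  proof (rule z_wp_zeta_independent[OF open_domain connected_domain domain_nonempty domain_subset,
        where S = "{m \<in> Poly_Mapping.keys P. tail m = \<mu>}" and ?e0.0 = "\<lambda>m. Poly_Mapping.lookup m 0"
          and c = "Poly_Mapping.lookup P" and ?e1.0 = "\<lambda>m. Poly_Mapping.lookup m 1"
          and ?e2.0 = "\<lambda>m. Poly_Mapping.lookup m 2"])
    show "(\<Sum>m\<in>{m \<in> Poly_Mapping.keys P. tail m = \<mu>}. Poly_Mapping.lookup P m *
     (z ^ Poly_Mapping.lookup m 0 * wp z ^ Poly_Mapping.lookup m 1 * \<zeta> z ^ Poly_Mapping.lookup m 2)) = 0"
      if "z \<in> domain" for z using 0[OF that] unfolding coefficient_def .
    show "m = m'" if "m \<in> {m \<in> Poly_Mapping.keys P. tail m = \<mu>}" "m' \<in> {m \<in> Poly_Mapping.keys P. tail m = \<mu>}"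
      and e: "Poly_Mapping.lookup m 0 = Poly_Mapping.lookup m' 0" "Poly_Mapping.lookup m 1 = Poly_Mapping.lookup m' 1"
      "Poly_Mapping.lookup m 2 = Poly_Mapping.lookup m' 2" for m m'
    proof (rule poly_mapping_eqI)
      fix i
      have "tail m i = tail m' i" using that by simp
      moreover have "i < 3 \<Longrightarrow> i = 0 \<or> i = 1 \<or> i = 2" by auto
      ultimately show "Poly_Mapping.lookup m i = Poly_Mapping.lookup m' i"
        using e by (auto simp: tail_def split: if_splits)
    qed
  qed (use m domain_shift in auto)
  then show False using m(1) by (simp add: in_keys_iff)
qed

lemma alg_indep_serre_system:
  "alg_indep_mero ([\<lambda>z. z, wp, \<zeta>, \<sigma>] @ map (\<lambda>t z. exp (t * z)) ts @
     map (\<lambda>(u, \<alpha>) z. serre_fun \<Omega> u (\<alpha> * z)) ps)"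
proof -
  have "P = 0" if P: "cmpoly_vars P \<subseteq> {..<N}" and ev: "\<forall>\<^sub>\<approx>z. cmpoly_eval P (\<lambda>i. F i z) = 0" for P
  proof (rule ccontr)
    assume "P \<noteq> 0"
    define I where "I = tail ` Poly_Mapping.keys P"
    define f where "f z = (\<Sum>\<mu>\<in>I. coefficient P \<mu> z * G \<mu> z)" for z
    have f: "f holomorphic_on domain"
      unfolding f_def by (intro holomorphic_intros hol coefficient_mem_R G_holomorphic)
    \<comment> \<open>The relation is given off a sparse set; by continuity it holds on the whole
      domain.\<close>
    have rel: "f z = 0" if z: "z \<in> domain" for z
    proof -
      have "\<forall>\<^sub>F x in at z. f x = 0"
        using eventually_cosparse_imp_eventually_at[OF ev, of z UNIV]
        by (simp add: cmpoly_eval_eq[OF P] f_def I_def)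
      then have "(f \<longlongrightarrow> 0) (at z)" by (rule tendsto_eventually)
      moreover have "(f \<longlongrightarrow> f z) (at z)"
        using holomorphic_on_imp_continuous_on[OF f] z open_domain
        by (simp add: continuous_on_eq_continuous_at isCont_def)
      ultimately show "f z = 0" using tendsto_unique[of "at z"] by auto
    qed
    have "I \<noteq> {}" using \<open>P \<noteq> 0\<close> by (simp add: I_def)
    have "\<exists>\<mu>\<in>I. \<exists>\<nu>\<in>I. \<mu> \<noteq> \<nu> \<and>
        (\<Sum>i\<in>{3..<N}. of_nat (\<mu> i) * A \<omega>1 i) = (\<Sum>i\<in>{3..<N}. of_nat (\<nu> i) * A \<omega>1 i) \<and>
        exp (\<Sum>i\<in>{3..<N}. of_nat (\<mu> i) * B \<omega>1 i) = exp (\<Sum>i\<in>{3..<N}. of_nat (\<nu> i) * B \<omega>1 i) \<and>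
        (\<Sum>i\<in>{3..<N}. of_nat (\<mu> i) * A \<omega>2 i) = (\<Sum>i\<in>{3..<N}. of_nat (\<nu> i) * A \<omega>2 i) \<and>
        exp (\<Sum>i\<in>{3..<N}. of_nat (\<mu> i) * B \<omega>2 i) = exp (\<Sum>i\<in>{3..<N}. of_nat (\<nu> i) * B \<omega>2 i)"
    proof (rule relation_imp_equal_multipliers[OF _ \<open>I \<noteq> {}\<close>])
      show "finite I" by (simp add: I_def)
      show "\<exists>z\<in>domain. coefficient P \<mu> z \<noteq> 0" if "\<mu> \<in> I" for \<mu>
        using coefficient_nonzero[OF P] that by (simp add: I_def)
      show "(\<Sum>\<mu>\<in>I. coefficient P \<mu> z * G \<mu> z) = 0" if "z \<in> domain" for z
        using rel[OF that] by (simp add: f_def)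
    qed (auto intro: G_holomorphic G_plus coefficient_mem_R dest: G_nonzero)
    then obtain \<mu> \<nu> where \<mu>\<nu>: "\<mu> \<in> I" "\<nu> \<in> I" "\<mu> \<noteq> \<nu>" and eqs:
        "(\<Sum>i\<in>{3..<N}. of_nat (\<mu> i) * A \<omega>1 i) = (\<Sum>i\<in>{3..<N}. of_nat (\<nu> i) * A \<omega>1 i)"
        "exp (\<Sum>i\<in>{3..<N}. of_nat (\<mu> i) * B \<omega>1 i) = exp (\<Sum>i\<in>{3..<N}. of_nat (\<nu> i) * B \<omega>1 i)"
        "(\<Sum>i\<in>{3..<N}. of_nat (\<mu> i) * A \<omega>2 i) = (\<Sum>i\<in>{3..<N}. of_nat (\<nu> i) * A \<omega>2 i)"
        "exp (\<Sum>i\<in>{3..<N}. of_nat (\<mu> i) * B \<omega>2 i) = exp (\<Sum>i\<in>{3..<N}. of_nat (\<nu> i) * B \<omega>2 i)"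
      by (elim bexE conjE)
    have eq: "(\<Sum>i\<in>{3..<N}. of_nat (\<mu> i) * A w i) = (\<Sum>i\<in>{3..<N}. of_nat (\<nu> i) * A w i) \<and>
        exp (\<Sum>i\<in>{3..<N}. of_nat (\<mu> i) * B w i) = exp (\<Sum>i\<in>{3..<N}. of_nat (\<nu> i) * B w i)"
      if "w \<in> {\<omega>1, \<omega>2}" for w
      using that by (elim insertE emptyE) (simp_all only: eqs simp_thms)
    define n where "n i = int (\<mu> i) - int (\<nu> i)" for i
    have sub: "(\<Sum>i\<in>{3..<N}. of_int (n i) * X i) =
        (\<Sum>i\<in>{3..<N}. of_nat (\<mu> i) * X i) - (\<Sum>i\<in>{3..<N}. of_nat (\<nu> i) * X i)" for X :: "nat \<Rightarrow> complex"
      by (simp add: n_def algebra_simps sum_subtractf)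
    have "\<forall>i\<in>{3..<N}. n i = 0"
      by (rule trivial_multipliers) (use eq in \<open>auto simp: sub exp_diff\<close>)
    \<comment> \<open>Tails vanish below 3 by definition, and from \<open>N\<close> on because the
      polynomial has no such variables.\<close>
    moreover have "\<mu> i = 0" "\<nu> i = 0" if "i \<notin> {3..<N}" for i
      using \<mu>\<nu>(1,2) that lookup_out_of_range[OF P, of _ i] by (auto simp: I_def tail_def)
    ultimately have "\<mu> i = \<nu> i" for i by (cases "i \<in> {3..<N}") (auto simp: n_def)
    then show False using \<mu>\<nu>(3) by auto
  qed
  note * = this[unfolded F_def]
  have len: "length ([\<lambda>z. z, wp, \<zeta>, \<sigma>] @ map (\<lambda>t z. exp (t * z)) ts @
      map (\<lambda>(u, \<alpha>) z. serre_fun \<Omega> u (\<alpha> * z)) ps) = N" by (simp add: N_def)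
  show ?thesis unfolding alg_indep_mero_def len
    by (intro allI impI, elim conjE, rule *)
qed

end

section \<open>Complex multiplication\<close>

context weierstrass_lattice
begin

lemma End_ring_of_int: "of_int k \<in> End_ring \<Omega>"
  by (simp add: End_ring_def of_int_mult_mem)

lemma End_ring_add: "\<alpha> \<in> End_ring \<Omega> \<Longrightarrow> \<beta> \<in> End_ring \<Omega> \<Longrightarrow> \<alpha> + \<beta> \<in> End_ring \<Omega>"
  by (simp add: End_ring_def add_mem distrib_right)

lemma End_ring_mult: "\<alpha> \<in> End_ring \<Omega> \<Longrightarrow> \<beta> \<in> End_ring \<Omega> \<Longrightarrow> \<alpha> * \<beta> \<in> End_ring \<Omega>"
  by (simp add: End_ring_def mult.assoc)

lemma End_field_quotient: "\<alpha> \<in> End_ring \<Omega> \<Longrightarrow> \<beta> \<in> End_ring \<Omega> \<Longrightarrow> \<beta> \<noteq> 0 \<Longrightarrow> \<alpha> / \<beta> \<in> End_field \<Omega>"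
  by (auto simp: End_field_def)

text \<open>A real multiplier \<open>r\<close> sends \<omega>1 to r \<omega>1, which is a period
  only for an integer \<open>r\<close>.\<close>

lemma End_ring_not_real:
  assumes \<alpha>: "\<alpha> \<in> End_ring \<Omega>" "\<alpha> \<notin> \<int>"
  shows "Im \<alpha> \<noteq> 0"
proof
  assume "Im \<alpha> = 0"
  then have r: "\<alpha> = of_real (Re \<alpha>)" by (simp add: complex_eq_iff)
  have "of_real (Re \<alpha>) * \<omega>1 + of_real 0 * \<omega>2 \<in> \<Omega>"
    using \<alpha>(1) r by (simp add: End_ring_def)
  then have "Re \<alpha> \<in> \<int>" unfolding mem_coords_iff by simp
  then show False using \<alpha>(2) r by (metis Ints_cases Ints_of_int of_real_of_int_eq)
qed

text \<open>On the basis, \<alpha> acts by an integer matrix with characteristic equation (\<alpha>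
  - p)(\<alpha> - s) = q r. For nonreal \<alpha> the imaginary part of this equation identifies 2 Re
  \<alpha> with the trace p + s, so the conjugate is p + s - \<alpha>.\<close>

lemma End_ring_cnj:
  assumes \<alpha>: "\<alpha> \<in> End_ring \<Omega>"
  shows "cnj \<alpha> \<in> End_ring \<Omega>"
proof (cases "Im \<alpha> = 0")
  case True
  then have "cnj \<alpha> = \<alpha>" by (simp add: complex_eq_iff)
  then show ?thesis using \<alpha> by simp
next
  case False
  have "\<alpha> * \<omega>1 \<in> \<Omega>" "\<alpha> * \<omega>2 \<in> \<Omega>" using \<alpha> by (auto simp: End_ring_def)
  then obtain p q r s where pq: "\<alpha> * \<omega>1 = of_int p * \<omega>1 + of_int q * \<omega>2"
    and rs: "\<alpha> * \<omega>2 = of_int r * \<omega>1 + of_int s * \<omega>2" unfolding mem_iff by blast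
  have "(\<alpha> - of_int p) * \<omega>1 = of_int q * \<omega>2" "(\<alpha> - of_int s) * \<omega>2 = of_int r * \<omega>1"
    using pq rs by (simp_all add: algebra_simps)
  then have "((\<alpha> - of_int p) * \<omega>1) * ((\<alpha> - of_int s) * \<omega>2) = (of_int q * \<omega>2) * (of_int r * \<omega>1)" by simp
  then have "((\<alpha> - of_int p) * (\<alpha> - of_int s)) * (\<omega>1 * \<omega>2) = (of_int q * of_int r) * (\<omega>1 * \<omega>2)"
    by (simp add: mult_ac)
  then have "(\<alpha> - of_int p) * (\<alpha> - of_int s) = of_int q * of_int r" using nonzero by simp
  then have "Im ((\<alpha> - of_int p) * (\<alpha> - of_int s)) = 0" by simp
  then have "Im \<alpha> * (2 * Re \<alpha> - of_int (p + s)) = 0" by (simp add: algebra_simps)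
  then have "2 * Re \<alpha> = of_int (p + s)" using False by simp
  then have "cnj \<alpha> = of_int (p + s) + of_int (- 1) * \<alpha>" by (simp add: complex_eq_iff)
  then show ?thesis by (simp only:) (intro End_ring_add End_ring_mult End_ring_of_int \<alpha>)
qed

text \<open>With complex multiplication the lattice lies in one line over the field of
  endomorphisms, spanned by \<omega>1. The sign makes \<kappa> the coefficient of \<omega>1 in a
  vanishing combination.\<close>

lemma CM_lattice_subset:
  assumes "has_CM \<Omega>" "w \<in> \<Omega>"
  obtains \<kappa> where "\<kappa> \<in> End_field \<Omega>" "w = - \<kappa> * \<omega>1"
proof -
  have "\<int> \<subseteq> End_ring \<Omega>" using End_ring_of_int by (auto elim!: Ints_cases)
  then obtain \<alpha> where \<alpha>: "\<alpha> \<in> End_ring \<Omega>" "\<alpha> \<notin> \<int>" using assms(1) by (auto simp: has_CM_def)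
  have "\<alpha> * \<omega>1 \<in> \<Omega>" using \<alpha>(1) by (simp add: End_ring_def)
  then obtain p q where pq: "\<alpha> * \<omega>1 = of_int p * \<omega>1 + of_int q * \<omega>2"
    unfolding mem_iff by blast
  have q: "q \<noteq> 0"
  proof
    assume "q = 0"
    then have "\<alpha> = of_int p" using pq nonzero by simp
    then show False using \<alpha>(2) by simp
  qed
  obtain m n where w: "w = of_int m * \<omega>1 + of_int n * \<omega>2" using assms(2) unfolding mem_iff by blast
  \<comment> \<open>From q \<omega>2 = (\<alpha> - p) \<omega>1 one gets q w = (m q - n p + n
    \<alpha>) \<omega>1.\<close>
  define \<kappa> where "\<kappa> = (of_int (n * p - m * q) + of_int (- n) * \<alpha>) / of_int q"
  have "\<kappa> \<in> End_field \<Omega>" unfolding \<kappa>_def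
    using q by (intro End_field_quotient End_ring_add End_ring_mult End_ring_of_int \<alpha>) simp
  moreover have "of_int q * (- \<kappa> * \<omega>1) = of_int q * w"
  proof -
    have "of_int q * (- \<kappa> * \<omega>1) = - (of_int q * \<kappa>) * \<omega>1" by simp
    also have "of_int q * \<kappa> = of_int (n * p - m * q) + of_int (- n) * \<alpha>" using q by (simp add: \<kappa>_def)
    also have "- (of_int (n * p - m * q) + of_int (- n) * \<alpha>) * \<omega>1 =
        of_int n * (\<alpha> * \<omega>1) - of_int (n * p - m * q) * \<omega>1" by (simp add: algebra_simps)
    also have "\<dots> = of_int q * w" unfolding pq w by (simp add: algebra_simps)
    finally show ?thesis .
  qed
  then have "- \<kappa> * \<omega>1 = w" using q by (simp only: mult_cancel_left of_int_eq_0_iff) simp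
  ultimately show ?thesis using that[of \<kappa>] by simp
qed

end

theorem theorem2p2:
  fixes \<omega>1 \<omega>2 :: complex and \<Omega> :: "complex set" and ts us :: "complex list"
  assumes basis: "is_lattice_basis \<omega>1 \<omega>2"
    and lattice: "\<Omega> = period_lattice \<omega>1 \<omega>2"
    and ts: "lin_indep_over \<rat> ts"
  shows
    "(lin_indep_over \<rat> (\<omega>1 # \<omega>2 # us) \<longrightarrow>
        alg_indep_mero
          ([\<lambda>z. z, weierstrass_wp \<Omega>, weierstrass_zeta \<Omega>, weierstrass_sigma \<Omega>]
           @ map (\<lambda>t z. exp (t * z)) ts
           @ map (\<lambda>u z. serre_fun \<Omega> u z) us))
     \<and>
     (\<forall>\<alpha>s. has_CM \<Omega> \<and> length \<alpha>s = length us \<and> set \<alpha>s \<subseteq> End_ring \<Omega> - \<int>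
           \<and> lin_indep_over (End_field \<Omega>) (\<omega>1 # us) \<longrightarrow>
        alg_indep_mero
          ([\<lambda>z. z, weierstrass_wp \<Omega>, weierstrass_zeta \<Omega>, weierstrass_sigma \<Omega>]
           @ map (\<lambda>t z. exp (t * z)) ts
           @ map (\<lambda>u z. serre_fun \<Omega> u z) us
           @ map2 (\<lambda>u \<alpha> z. serre_fun \<Omega> u (\<alpha> * z)) us \<alpha>s))"
proof -
  interpret weierstrass_lattice \<omega>1 \<omega>2 \<Omega> using basis lattice by unfold_locales
  \<comment> \<open>A unit coefficient vector shows that no \<open>u\<close> is a period, as the
    Serre functions require.\<close>
  have unit_sum: "u \<notin> \<Omega>"
    if u_mem: "u \<in> set us" and us: "\<And>n :: nat \<Rightarrow> int. (\<Sum>j<length us. of_int (n j) * us ! j) \<in> \<Omega> \<Longrightarrow>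
      \<forall>j<length us. n j = 0" for u
  proof
    assume u: "u \<in> \<Omega>"
    obtain i where i: "i < length us" "us ! i = u" using u_mem by (auto simp: in_set_conv_nth)
    define n :: "nat \<Rightarrow> int" where "n j = (if j = i then 1 else 0)" for j
    have "(\<Sum>j<length us. of_int (n j) * us ! j) = (\<Sum>j<length us. if j = i then us ! i else 0)"
      by (intro sum.cong) (auto simp: n_def)
    also have "\<dots> = u" using i by simp
    finally have "n i = 0" using us[of n] u i by simp
    then show False by (simp add: n_def)
  qed
  have "alg_indep_mero ([\<lambda>z. z, wp, \<zeta>, \<sigma>] @ map (\<lambda>t z. exp (t * z)) ts @ map (\<lambda>u z. serre_fun \<Omega> u z) us)"
    if li: "lin_indep_over \<rat> (\<omega>1 # \<omega>2 # us)"
  proof -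
    have us: "\<forall>j<length us. n j = 0" if mem: "(\<Sum>j<length us. of_int (n j) * us ! j) \<in> \<Omega>" for n :: "nat \<Rightarrow> int"
    proof -
      obtain k l where kl: "(\<Sum>j<length us. of_int (n j) * us ! j) = of_int k * \<omega>1 + of_int l * \<omega>2"
        using mem unfolding mem_iff by blast
      \<comment> \<open>The period is moved to the other side, hence the signs; the shift by 2 skips
        \<omega>1 and \<omega>2 in the list.\<close>
      define c :: "nat \<Rightarrow> complex" where
        "c i = of_int (if i = 0 then - k else if i = 1 then - l else n (i - 2))" for i
      have sum0: "(\<Sum>i<length (\<omega>1 # \<omega>2 # us). c i * (\<omega>1 # \<omega>2 # us) ! i) = 0"
        using kl by (simp add: sum.lessThan_Suc_shift c_def del: sum.lessThan_Suc)
      have "c (Suc (Suc j)) = 0" if "j < length us" for j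
        by (rule lin_indep_overD[OF li _ sum0]) (use that in \<open>simp_all add: c_def\<close>)
      then show ?thesis by (simp add: c_def)
    qed
    interpret serre_system \<omega>1 \<omega>2 \<Omega> ts "map (\<lambda>u. (u, 1)) us"
      by unfold_locales (use ts us unit_sum[OF _ us] in \<open>auto simp: End_ring_def\<close>)
    show ?thesis using alg_indep_serre_system by (simp add: o_def)
  qed
  moreover have "alg_indep_mero ([\<lambda>z. z, wp, \<zeta>, \<sigma>] @ map (\<lambda>t z. exp (t * z)) ts
      @ map (\<lambda>u z. serre_fun \<Omega> u z) us @ map2 (\<lambda>u \<alpha> z. serre_fun \<Omega> u (\<alpha> * z)) us \<alpha>s)"
    if CM: "has_CM \<Omega>" and len: "length \<alpha>s = length us" and \<alpha>s: "set \<alpha>s \<subseteq> End_ring \<Omega> - \<int>"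
      and li: "lin_indep_over (End_field \<Omega>) (\<omega>1 # us)" for \<alpha>s
  proof -
    have \<alpha>: "\<alpha>s ! j \<in> End_ring \<Omega>" "\<alpha>s ! j \<notin> \<int>" if "j < length us" for j
      using subsetD[OF \<alpha>s nth_mem[of j \<alpha>s]] that len by simp_all
    have us: "\<forall>j<length us. n j = 0 \<and> m j = 0"
      if mem: "(\<Sum>j<length us. (of_int (n j) + of_int (m j) * cnj (\<alpha>s ! j)) * us ! j) \<in> \<Omega>"
      for n m :: "nat \<Rightarrow> int"
    proof -
      \<comment> \<open>These coefficients lie in the endomorphism ring, so independence over its
        fraction field applies to them.\<close>
      define d where "d j = of_int (n j) + of_int (m j) * cnj (\<alpha>s ! j)" for j
      obtain \<kappa> where \<kappa>: "\<kappa> \<in> End_field \<Omega>" "(\<Sum>j<length us. d j * us ! j) = - \<kappa> * \<omega>1"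
        using CM_lattice_subset[OF CM mem] unfolding d_def by blast
      define c where "c i = (if i = 0 then \<kappa> else d (i - 1))" for i
      have dk: "d j \<in> End_field \<Omega>" if "j < length us" for j
      proof -
        have "d j \<in> End_ring \<Omega>" unfolding d_def
          by (intro End_ring_add End_ring_mult End_ring_of_int End_ring_cnj \<alpha> that)
        then show ?thesis using End_field_quotient[of "d j" 1] End_ring_of_int[of 1] by simp
      qed
      have sum0: "(\<Sum>i<length (\<omega>1 # us). c i * (\<omega>1 # us) ! i) = 0"
        using \<kappa>(2) by (simp add: sum.lessThan_Suc_shift c_def del: sum.lessThan_Suc)
      have "c i \<in> End_field \<Omega>" if "i < length (\<omega>1 # us)" for i
        using that dk[of "i - 1"] \<kappa>(1) by (cases i) (simp_all add: c_def)
      from lin_indep_overD[OF li this sum0] have "c (Suc j) = 0" if "j < length us" for j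
        using that by simp
      then have d0: "d j = 0" if "j < length us" for j using that by (simp add: c_def)
      show ?thesis
      proof (intro allI impI)
        fix j assume j: "j < length us"
        \<comment> \<open>This imaginary part is -m_j Im \<alpha>_j, and \<alpha>_j is not
          real.\<close>
        have "Im (d j) = 0" using d0[OF j] by simp
        then have "m j = 0" using End_ring_not_real[OF \<alpha>[OF j]] by (simp add: d_def)
        then show "n j = 0 \<and> m j = 0" using d0[OF j] by (simp add: d_def)
      qed
    qed
    \<comment> \<open>Every \<open>u\<close> occurs twice, first with multiplier 1 and then with its
      own \<alpha>.\<close>
    define ps where "ps = map (\<lambda>u. (u, 1)) us @ zip us \<alpha>s"
    have lps: "length ps = length us + length us" by (simp add: ps_def len)
    have notin: "u \<notin> \<Omega>" if "u \<in> set us" for u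
      using that by (rule unit_sum) (use us[of _ "\<lambda>_. 0"] in auto)
    interpret serre_system \<omega>1 \<omega>2 \<Omega> ts ps
    proof unfold_locales
      show "u \<notin> \<Omega> \<and> \<alpha> \<noteq> 0 \<and> \<alpha> \<in> End_ring \<Omega>" if "(u, \<alpha>) \<in> set ps" for u \<alpha>
        using that notin \<alpha>s by (auto simp: ps_def End_ring_def dest: set_zip_leftD set_zip_rightD)
      fix n :: "nat \<Rightarrow> int"
      assume mem: "(\<Sum>j<length ps. of_int (n j) * (cnj (snd (ps ! j)) * fst (ps ! j))) \<in> \<Omega>"
      have ps_eq: "ps ! j = (us ! j, 1)" "ps ! (length us + j) = (us ! j, \<alpha>s ! j)" if "j < length us" for j
        using that len by (simp_all add: ps_def nth_append)
      have "(\<Sum>j<length ps. of_int (n j) * (cnj (snd (ps ! j)) * fst (ps ! j))) =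
          (\<Sum>j<length us. of_int (n j) * (cnj (snd (ps ! j)) * fst (ps ! j))) +
          (\<Sum>j<length us. of_int (n (length us + j)) * (cnj (snd (ps ! (length us + j))) * fst (ps ! (length us + j))))"
        unfolding lps by (rule sum_lessThan_add)
      also have "\<dots> = (\<Sum>j<length us. (of_int (n j) + of_int (n (length us + j)) * cnj (\<alpha>s ! j)) * us ! j)"
        unfolding sum.distrib[symmetric] by (intro sum.cong refl) (simp add: ps_eq distrib_right mult.assoc)
      finally have eq: "(\<Sum>j<length ps. of_int (n j) * (cnj (snd (ps ! j)) * fst (ps ! j))) =
          (\<Sum>j<length us. (of_int (n j) + of_int (n (length us + j)) * cnj (\<alpha>s ! j)) * us ! j)" .
      have 0: "\<forall>j<length us. n j = 0 \<and> n (length us + j) = 0"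
        by (rule us[OF mem[unfolded eq]])
      show "\<forall>j<length ps. n j = 0"
      proof (intro allI impI)
        fix j assume "j < length ps"
        then show "n j = 0"
          using 0[rule_format, of j] 0[rule_format, of "j - length us"] by (cases "j < length us") (auto simp: lps)
      qed
    qed (fact ts)
    show ?thesis using alg_indep_serre_system by (simp add: ps_def o_def)
  qed
  ultimately show ?thesis by blast
qed

end
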